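(* Let $\mathbb{K}$ be a field of characteristic zero and let $\mathcal{L}_{r,2}$ be the free $2$-step nilpotent Lie algebra of rank $r$ over $\mathbb{K}$. Then \[ \mu(\mathcal{L}_{r,2}) = \begin{cases} \left\lceil \sqrt{2r(r-1)} \right\rceil + 2, & \text{if } r \geq 4;\\ 2r-1, & \text{if } r=2, 3, 4, 5 \end{cases} \] (the two formulas agree for $r=4,5$).
   Context: All vector spaces, Lie algebras and representations are finite dimensional over a field $\mathbb{K}$ of characteristic zero. The free $2$-step nilpotent Lie algebra of rank $r$ is the vector space $\mathcal{L}_{r,2}=\mathbb{K}^r\oplus\bigwedge^2\mathbb{K}^r$ with bracket $[X,Y]=X\wedge Y$ for $X,Y\in\mathbb{K}^r$ and with $\bigwedge^2\mathbb{K}^r$ central. For a Lie algebra $\mathfrak{g}$, \[ \mu(\mathfrak{g})=\min\{\dim V : (\pi,V)\text{ is a faithful representation of }\mathfrak{g}\}, \] where a representation $\pi:\mathfrak{g}\to\mathfrak{gl}(V)$ is faithful if it is injective. *)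

theory Defs
  imports Complex_Main "HOL-Library.FuncSet" "HOL-Library.Function_Algebras"
    "HOL-Library.Product_Plus"
begin

section \<open>Lie algebras and representations\<close>

locale lie_algebra = vector_space scale
  for scale :: "'k::field \<Rightarrow> 'g::ab_group_add \<Rightarrow> 'g" (infixr \<open>*g\<close> 75) +
  fixes L :: "'g set" and bracket :: "'g \<Rightarrow> 'g \<Rightarrow> 'g"
  assumes subspace_L: "subspace L"
    and finite_dim_L: "\<exists>B. finite B \<and> span B = L"
    and bracket_closed: "\<lbrakk>x \<in> L; y \<in> L\<rbrakk> \<Longrightarrow> bracket x y \<in> L"
    and bracket_add_left: "\<lbrakk>x \<in> L; y \<in> L; z \<in> L\<rbrakk> \<Longrightarrow> bracket (x + y) z = bracket x z + bracket y z"
    and bracket_add_right: "\<lbrakk>x \<in> L; y \<in> L; z \<in> L\<rbrakk> \<Longrightarrow> bracket x (y + z) = bracket x y + bracket x z"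
    and bracket_scale_left: "\<lbrakk>x \<in> L; y \<in> L\<rbrakk> \<Longrightarrow> bracket (c *g x) y = c *g bracket x y"
    and bracket_scale_right: "\<lbrakk>x \<in> L; y \<in> L\<rbrakk> \<Longrightarrow> bracket x (c *g y) = c *g bracket x y"
    and bracket_self: "x \<in> L \<Longrightarrow> bracket x x = 0"
    and jacobi: "\<lbrakk>x \<in> L; y \<in> L; z \<in> L\<rbrakk> \<Longrightarrow>
      bracket x (bracket y z) + bracket y (bracket z x) + bracket z (bracket x y) = 0"

text \<open>An element of \<open>gl(V)\<close> is given by a function on the ambient type, of which only
  the values on \<open>V\<close> matter.\<close>

locale lie_representation = lie_algebra scale L bracket + V: vector_space scaleV
  for scale :: "'k::field \<Rightarrow> 'g::ab_group_add \<Rightarrow> 'g" (infixr \<open>*g\<close> 75)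
    and L :: "'g set" and bracket :: "'g \<Rightarrow> 'g \<Rightarrow> 'g"
    and scaleV :: "'k \<Rightarrow> 'v::ab_group_add \<Rightarrow> 'v" (infixr \<open>*v\<close> 75) +
  fixes V :: "'v set" and \<pi> :: "'g \<Rightarrow> 'v \<Rightarrow> 'v"
  assumes subspace_V: "V.subspace V"
    and finite_dim_V: "\<exists>B. finite B \<and> V.span B = V"
    and rep_closed: "\<lbrakk>x \<in> L; v \<in> V\<rbrakk> \<Longrightarrow> \<pi> x v \<in> V"
    and rep_add_right: "\<lbrakk>x \<in> L; v \<in> V; w \<in> V\<rbrakk> \<Longrightarrow> \<pi> x (v + w) = \<pi> x v + \<pi> x w"
    and rep_scale_right: "\<lbrakk>x \<in> L; v \<in> V\<rbrakk> \<Longrightarrow> \<pi> x (c *v v) = c *v \<pi> x v"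
    and rep_add_left: "\<lbrakk>x \<in> L; y \<in> L; v \<in> V\<rbrakk> \<Longrightarrow> \<pi> (x + y) v = \<pi> x v + \<pi> y v"
    and rep_scale_left: "\<lbrakk>x \<in> L; v \<in> V\<rbrakk> \<Longrightarrow> \<pi> (c *g x) v = c *v \<pi> x v"
    and rep_bracket: "\<lbrakk>x \<in> L; y \<in> L; v \<in> V\<rbrakk> \<Longrightarrow> \<pi> (bracket x y) v = \<pi> x (\<pi> y v) - \<pi> y (\<pi> x v)"

locale faithful_lie_representation = lie_representation +
  assumes faithful: "inj_on (\<lambda>x. restrict (\<pi> x) V) L"

text \<open>The representation spaces in the definition of \<open>\<mu>\<close> are the finite-dimensional subspaces
  of the space of sequences over the field. Lemma
  \<open>faithful_lie_representation_transfer\<close> below shows that representation spaces in other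
  types give no further dimensions.\<close>

definition seq_scale :: "'k::field \<Rightarrow> (nat \<Rightarrow> 'k) \<Rightarrow> nat \<Rightarrow> 'k" where
  "seq_scale c f = (\<lambda>i. c * f i)"

definition mu :: "('k::field \<Rightarrow> 'g::ab_group_add \<Rightarrow> 'g) \<Rightarrow> 'g set \<Rightarrow> ('g \<Rightarrow> 'g \<Rightarrow> 'g) \<Rightarrow> nat" where
  "mu scale L bracket = (LEAST d. \<exists>(V :: (nat \<Rightarrow> 'k) set) \<pi>.
     faithful_lie_representation scale L bracket seq_scale V \<pi> \<and>
     vector_space.dim seq_scale V = d)"


section \<open>The free 2-step nilpotent Lie algebra\<close>

text \<open>Vectors of \<open>\<bbbK>\<^sup>r\<close> are sequences vanishing from index \<open>r\<close> on. An element of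
  \<open>\<And>\<^sup>2 \<bbbK>\<^sup>r\<close> is given by its coordinates in the basis \<open>e\<^sub>i \<and> e\<^sub>j\<close>, \<open>i < j < r\<close>;
  all other entries are zero.\<close>

type_synonym 'k free2 = "(nat \<Rightarrow> 'k) \<times> (nat \<times> nat \<Rightarrow> 'k)"

definition wedge :: "(nat \<Rightarrow> 'k::field) \<Rightarrow> (nat \<Rightarrow> 'k) \<Rightarrow> nat \<times> nat \<Rightarrow> 'k" where
  "wedge x y = (\<lambda>(i, j). if i < j then x i * y j - x j * y i else 0)"

definition free2_carrier :: "nat \<Rightarrow> 'k::field free2 set" where
  "free2_carrier r = {(x, w). (\<forall>i. r \<le> i \<longrightarrow> x i = 0) \<and>
     (\<forall>i j. \<not> (i < j \<and> j < r) \<longrightarrow> w (i, j) = 0)}"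

definition free2_scale :: "'k::field \<Rightarrow> 'k free2 \<Rightarrow> 'k free2" where
  "free2_scale c = (\<lambda>(x, w). (\<lambda>i. c * x i, \<lambda>p. c * w p))"

definition free2_bracket :: "'k::field free2 \<Rightarrow> 'k free2 \<Rightarrow> 'k free2" where
  "free2_bracket = (\<lambda>(x, w) (y, z). (0, wedge x y))"


section \<open>Well-definedness\<close>

lemma vector_space_seq_scale: "vector_space (seq_scale :: 'k::field \<Rightarrow> _)"
  by unfold_locales (auto simp: seq_scale_def fun_eq_iff algebra_simps)

lemma vector_space_free2_scale: "vector_space (free2_scale :: 'k::field \<Rightarrow> _)"
  by unfold_locales (auto simp: free2_scale_def fun_eq_iff algebra_simps plus_prod_def)

lemma sum_fun_apply: "(\<Sum>a\<in>A. f a) x = (\<Sum>a\<in>A. f a x)"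
  by (induction A rule: infinite_finite_induct) auto

lemma fst_sum_prod: "fst (\<Sum>a\<in>A. f a) = (\<Sum>a\<in>A. fst (f a))"
  by (induction A rule: infinite_finite_induct) auto

lemma snd_sum_prod: "snd (\<Sum>a\<in>A. f a) = (\<Sum>a\<in>A. snd (f a))"
  by (induction A rule: infinite_finite_induct) auto

lemma lie_algebra_free2: "lie_algebra free2_scale (free2_carrier r :: 'k::field free2 set) free2_bracket"
proof -
  interpret vs: vector_space "free2_scale :: 'k \<Rightarrow> _" by (rule vector_space_free2_scale)
  have sub: "vs.subspace (free2_carrier r)"
    by (rule vs.subspaceI) (auto simp: free2_carrier_def free2_scale_def zero_prod_def)
  define e :: "nat \<Rightarrow> 'k free2" where "e = (\<lambda>i. (\<lambda>k. if k = i then 1 else 0, 0))"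
  define f :: "nat \<times> nat \<Rightarrow> 'k free2" where "f = (\<lambda>p. (0, \<lambda>q. if q = p then 1 else 0))"
  define P where "P = {(i, j). i < j \<and> j < r}"
  have finP: "finite P"
    by (rule finite_subset[of _ "{..<r} \<times> {..<r}"]) (auto simp: P_def)
  let ?B = "e ` {..<r} \<union> f ` P"
  have "vs.span ?B = free2_carrier r"
  proof (rule vs.span_subspace[OF _ _ sub])
    show "?B \<subseteq> free2_carrier r" by (auto simp: free2_carrier_def e_def f_def P_def)
    show "free2_carrier r \<subseteq> vs.span ?B"
    proof
      fix u :: "'k free2" assume u: "u \<in> free2_carrier r"
      obtain x w where xw: "u = (x, w)" by (cases u)
      have "u = (\<Sum>i<r. free2_scale (x i) (e i)) + (\<Sum>p\<in>P. free2_scale (w p) (f p))" (is "_ = ?s")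
      proof (rule prod_eqI)
        show "fst u = fst ?s" using u
          by (auto simp: xw fun_eq_iff fst_sum_prod sum_fun_apply free2_scale_def e_def f_def
              free2_carrier_def if_distrib sum.delta not_less cong: if_cong)
        show "snd u = snd ?s" using u finP
          by (auto simp: xw fun_eq_iff snd_sum_prod sum_fun_apply free2_scale_def e_def f_def
              free2_carrier_def if_distrib sum.delta P_def cong: if_cong)
      qed
      also have "?s \<in> vs.span ?B"
        by (intro vs.span_add vs.span_sum vs.span_scale vs.span_base) auto
      finally show "u \<in> vs.span ?B" .
    qed
  qed
  moreover have "finite ?B" using finP by auto
  ultimately have fin: "\<exists>B. finite B \<and> vs.span B = free2_carrier r" by blast
  show ?thesis
    by unfold_locales
      (use sub fin in \<open>auto simp: free2_carrier_def free2_scale_def free2_bracket_def wedge_def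
        fun_eq_iff zero_prod_def algebra_simps\<close>)
qed

lemma faithful_lie_representation_transfer:
  fixes scaleV :: "'k::field \<Rightarrow> 'v::ab_group_add \<Rightarrow> 'v"
  assumes "faithful_lie_representation scale L bracket scaleV V \<pi>"
  shows "\<exists>(W :: (nat \<Rightarrow> 'k) set) \<rho>. faithful_lie_representation scale L bracket seq_scale W \<rho> \<and>
    vector_space.dim seq_scale W = vector_space.dim scaleV V"
proof -
  interpret faithful_lie_representation scale L bracket scaleV V \<pi> by fact
  interpret S: vector_space "seq_scale :: 'k \<Rightarrow> _" by (rule vector_space_seq_scale)
  obtain B where B: "B \<subseteq> V" "V.independent B" "V \<subseteq> V.span B" "card B = V.dim V"
    using V.basis_exists by blast
  have finB: "finite B"
    using finite_dim_V B V.independent_span_bound by metis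
  define n where "n = V.dim V"
  obtain b where b: "bij_betw b {..<n} B"
    using ex_bij_betw_nat_finite[OF finB] B by (auto simp: n_def atLeast0LessThan)
  have spanB: "V.span B = V"
    using B subspace_V V.span_subspace by blast
  define W :: "(nat \<Rightarrow> 'k) set" where "W = {f. \<forall>i\<ge>n. f i = 0}"
  define \<psi> where "\<psi> = (\<lambda>f. \<Sum>i<n. scaleV (f i) (b i))"
  define \<phi> where "\<phi> = (\<lambda>v i. if i < n then V.representation B v (b i) else 0)"
  have bB: "b i \<in> B" if "i < n" for i using b that by (auto simp: bij_betw_def)
  have \<psi>V: "\<psi> f \<in> V" for f
    unfolding \<psi>_def using bB B subspace_V
    by (auto intro!: V.subspace_sum V.subspace_scale)
  have \<psi>add: "\<psi> (f + g) = \<psi> f + \<psi> g" for f g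
    by (simp add: \<psi>_def V.scale_left_distrib sum.distrib)
  have \<psi>scale: "\<psi> (seq_scale c f) = scaleV c (\<psi> f)" for c f
    by (simp add: \<psi>_def seq_scale_def V.scale_sum_right)
  have \<phi>W: "\<phi> v \<in> W" for v by (simp add: \<phi>_def W_def)
  have \<phi>add: "\<phi> (v + w) = \<phi> v + \<phi> w" if "v \<in> V" "w \<in> V" for v w
    using that B by (auto simp: \<phi>_def fun_eq_iff V.representation_add spanB)
  have \<phi>diff: "\<phi> (v - w) = \<phi> v - \<phi> w" if "v \<in> V" "w \<in> V" for v w
    using that B by (auto simp: \<phi>_def fun_eq_iff V.representation_diff spanB)
  have \<phi>scale: "\<phi> (scaleV c v) = seq_scale c (\<phi> v)" if "v \<in> V" for c v
    using that B by (auto simp: \<phi>_def fun_eq_iff V.representation_scale spanB seq_scale_def)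
  have \<psi>\<phi>: "\<psi> (\<phi> v) = v" if "v \<in> V" for v
  proof -
    have "\<psi> (\<phi> v) = (\<Sum>i<n. scaleV (V.representation B v (b i)) (b i))"
      by (simp add: \<psi>_def \<phi>_def)
    also have "\<dots> = (\<Sum>w\<in>B. scaleV (V.representation B v w) w)"
      using sum.reindex_bij_betw[OF b] by fastforce
    also have "\<dots> = v"
      by (rule V.sum_representation_eq) (use that B finB in auto)
    finally show ?thesis .
  qed
  have \<phi>\<psi>: "\<phi> (\<psi> f) = f" if "f \<in> W" for f
  proof
    fix i
    show "\<phi> (\<psi> f) i = f i"
    proof (cases "i < n")
      case True
      have inj: "b j = b i \<longleftrightarrow> j = i" if "j < n" for j
        using b that True by (auto simp: bij_betw_def inj_on_def)
      have "V.representation B (\<psi> f) (b i) =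
          (\<Sum>j<n. V.representation B (scaleV (f j) (b j)) (b i))"
        unfolding \<psi>_def using B bB
        by (subst V.representation_sum) (auto intro!: V.span_scale intro: V.span_base)
      also have "\<dots> = (\<Sum>j<n. if j = i then f j else 0)"
        using B bB inj
        by (intro sum.cong refl)
          (simp add: V.representation_scale V.representation_basis V.span_base eq_commute[of "b i"])
      also have "\<dots> = f i" using True by simp
      finally show ?thesis using True by (simp add: \<phi>_def)
    next
      case False
      then show ?thesis using that by (simp add: \<phi>_def W_def)
    qed
  qed
  define \<rho> where "\<rho> = (\<lambda>x f. \<phi> (\<pi> x (\<psi> f)))"
  define d :: "nat \<Rightarrow> nat \<Rightarrow> 'k" where "d = (\<lambda>i k. if k = i then 1 else 0)"
  have subW: "S.subspace W"
    by (rule S.subspaceI) (auto simp: W_def seq_scale_def)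
  have injd: "inj d" by (auto simp: inj_def d_def fun_eq_iff split: if_splits)
  have dexp: "(\<Sum>i<n. seq_scale (f i) (d i)) k = (if k < n then f k else 0)" for f k
    by (simp add: sum_fun_apply seq_scale_def d_def if_distrib cong: if_cong)
  have spand: "S.span (d ` {..<n}) = W"
  proof (rule S.span_subspace[OF _ _ subW])
    show "d ` {..<n} \<subseteq> W" by (auto simp: d_def W_def)
    show "W \<subseteq> S.span (d ` {..<n})"
    proof
      fix f assume "f \<in> W"
      then have "f = (\<Sum>i<n. seq_scale (f i) (d i))"
        by (auto simp: fun_eq_iff dexp W_def)
      also have "\<dots> \<in> S.span (d ` {..<n})"
        by (intro S.span_sum S.span_scale S.span_base) auto
      finally show "f \<in> S.span (d ` {..<n})" .
    qed
  qed
  have indd: "S.independent (d ` {..<n})"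
  proof (rule S.independent_if_scalars_zero)
    fix f x assume s: "(\<Sum>x\<in>d ` {..<n}. seq_scale (f x) x) = 0" and x: "x \<in> d ` {..<n}"
    obtain k where k: "k < n" "x = d k" using x by auto
    have "(\<Sum>x\<in>d ` {..<n}. seq_scale (f x) x) = (\<Sum>i<n. seq_scale (f (d i)) (d i))"
      using injd by (subst sum.reindex) (auto simp: inj_on_def inj_def)
    then have "(\<Sum>i<n. seq_scale (f (d i)) (d i)) k = 0" using s by simp
    then show "f x = 0" using k dexp[of "\<lambda>i. f (d i)" k] by simp
  qed auto
  have dimW: "S.dim W = n"
    using S.dim_span_eq_card_independent[OF indd] injd
    by (simp add: spand card_image inj_on_def inj_def)
  have "faithful_lie_representation scale L bracket seq_scale W \<rho>"
  proof unfold_locales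
    show "S.subspace W" by (rule subW)
    show "\<exists>B. finite B \<and> S.span B = W" using spand by blast
    show "inj_on (\<lambda>x. restrict (\<rho> x) W) L"
    proof (rule inj_onI)
      fix x y assume xy: "x \<in> L" "y \<in> L" "restrict (\<rho> x) W = restrict (\<rho> y) W"
      have "\<pi> x v = \<pi> y v" if v: "v \<in> V" for v
      proof -
        have "\<rho> x (\<phi> v) = \<rho> y (\<phi> v)" using xy(3) \<phi>W by (metis restrict_apply')
        then have "\<psi> (\<phi> (\<pi> x v)) = \<psi> (\<phi> (\<pi> y v))" using v by (simp add: \<rho>_def \<psi>\<phi>)
        then show ?thesis using v xy by (simp add: \<psi>\<phi> rep_closed)
      qed
      then have "restrict (\<pi> x) V = restrict (\<pi> y) V" by (auto simp: restrict_def)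
      then show "x = y" using faithful xy by (auto simp: inj_on_def)
    qed
  qed (auto simp: \<rho>_def \<phi>W \<psi>V \<psi>add \<psi>scale \<phi>add \<phi>diff \<phi>scale \<psi>\<phi> rep_closed rep_add_left
      rep_add_right rep_scale_left rep_scale_right rep_bracket)
  then show ?thesis using dimW n_def by blast
qed

end

theory Submission
  imports Defs "HOL-Computational_Algebra.Polynomial" "HOL-Number_Theory.Cong"
begin

text \<open>
  Lower bound. Given a faithful representation, replace the operator of each basis vector by its
  nilpotent part. Since a commutator \<open>[A\<^sub>i, A\<^sub>j]\<close> is central, the semisimple parts commute with
  everything, so the commutators do not change, and they stay linearly independent. In the filtration
  \<open>V \<supseteq> V1 \<supseteq> V2 \<supseteq> \<dots>\<close> by the powers of the operators, a commutator is determined by its values on a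
  complement of \<open>V1\<close>, and these lie in \<open>V2\<close>. If \<open>dim (V1/V2) \<ge> 2\<close>, this gives
  \<open>r (r - 1) / 2 \<le> k (dim V - k - 2)\<close> with \<open>k = dim (V/V1)\<close>, hence
  \<open>2 r (r - 1) \<le> (dim V - 2)\<^sup>2\<close>. If \<open>dim (V1/V2) = 1\<close>, centrality of the commutators forces either
  \<open>V3 = 0\<close>, and then \<open>dim V \<ge> 2 r - 1\<close>, or a rank condition under which the count above still works.

  Upper bound. Matrices \<open>\<alpha>\<^sub>l\<close>, \<open>\<beta>\<^sub>l\<close> (\<open>l < L\<close>) with \<open>a\<close> and \<open>b\<close> rows such that \<open>\<Sum>\<^sub>l \<alpha>\<^sub>l S \<beta>\<^sub>l\<^sup>T = 0\<close>
  only for the skew matrix \<open>S = 0\<close> define a faithful representation of dimension \<open>a + L + b\<close>. For \<open>L = 2\<close>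
  they exist as soon as \<open>a b \<ge> r (r - 1) / 2\<close> and \<open>a\<close>, \<open>b\<close> are balanced: modulo a large prime, the
  pairs \<open>(\<alpha>, \<beta>)\<close> killed by some \<open>S\<close>, stratified by the rank \<open>h\<close> of \<open>S\<close> and the rank \<open>q\<close> of \<open>\<alpha> S\<close>,
  are too few to exhaust all pairs. A pair that is good modulo a prime is good in characteristic zero.
\<close>

section \<open>Nilpotent parts of operators\<close>

text \<open>What matters about a semisimple part s(T) is s'(T) = 0: if T commutes with B = [T, U],
  then [f(T), U] = f'(T) B for every polynomial f, so s(T) commutes with U. Such an s with T - s(T)
  nilpotent exists over every field of characteristic zero, without eigenvalues. Let m = r (r - 1) /
  2. Counting coordinates gives m \<le> k l with k = dim (V/V1) and l = dim V2, and 4 k l \<le> (k +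
  l)^2 yields the square root only if k + l \<le> dim V - 2. A quotient V1/V2 of dimension one
  breaks this, and has to: the representation of dimension 2 r - 1 has such a middle layer. So the
  lower bound is a disjunction, whose two values are compared only at the end. In the upper bound,
  the pairs killed by a fixed S in the stratum (h, q) have codimension at least (2 h - q) (a - q) +
  q b, to be compared with the number of free entries of a skew S of rank h. For S of full rank, q =
  a and a b = m both numbers agree, so only the scaling of S saves a factor p, and this factor has
  to beat the r^2 8^r choices of pivots and normalised entries.\<close>

lemma poly_bezout:
  fixes p q :: "'k::field poly"
  assumes "p \<noteq> 0"
  obtains d u v where "d = u * p + v * q" "d dvd p" "d dvd q" "d \<noteq> 0"
proof -
  define S where "S = {d. d \<noteq> 0 \<and> (\<exists>u v. d = u * p + v * q)}"
  have "p \<in> S" using assms unfolding S_def by (auto intro: exI[of _ 1] exI[of _ 0])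
  then obtain d where d: "d \<in> S" and dmin: "\<And>e. e \<in> S \<Longrightarrow> degree d \<le> degree e"
    using arg_min_natI[of "\<lambda>x. x \<in> S" p degree] arg_min_nat_le[of "\<lambda>x. x \<in> S" _ degree] by metis
  then obtain u v where uv: "d = u * p + v * q" and d0: "d \<noteq> 0" unfolding S_def by blast
  have dvd: "d dvd a * p + b * q" for a b
  proof (rule ccontr)
    assume n: "\<not> d dvd a * p + b * q"
    let ?r = "(a * p + b * q) mod d"
    have r0: "?r \<noteq> 0" using n by (simp add: mod_eq_0_iff_dvd)
    have "?r = (a * p + b * q) - ((a * p + b * q) div d) * d"
      by (simp add: minus_div_mult_eq_mod)
    also have "\<dots> = (a - ((a * p + b * q) div d) * u) * p + (b - ((a * p + b * q) div d) * v) * q"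
    proof -
      have "c * d = c * u * p + c * v * q" for c by (simp add: uv algebra_simps)
      then show ?thesis by (simp add: left_diff_distrib)
    qed
    finally have "?r \<in> S" using r0 unfolding S_def by blast
    then have "degree d \<le> degree ?r" by (rule dmin)
    moreover have "degree ?r < degree d" using degree_mod_less[OF d0] r0 by blast
    ultimately show False by simp
  qed
  show ?thesis using that[OF uv] dvd[of 1 0] dvd[of 0 1] d0 by simp
qed

text \<open>Write d^(j) for the j-th derivative. Differentiating d | d^(j) g^j and multiplying by g
  gives d | d^(j+1) g^(j+1). At j = \<open>degree d\<close> the derivative is a constant, nonzero in
  characteristic zero, and cancels.\<close>

lemma dvd_power_if_dvd_pderiv_mult:
  fixes d g :: "'k::field_char_0 poly"
  assumes "d \<noteq> 0" "d dvd pderiv d * g"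
  shows "d dvd g ^ degree d"
proof -
  have step: "d dvd (pderiv ^^ j) d * g ^ j" for j
  proof (induction j)
    case (Suc j)
    define e where "e = (pderiv ^^ j) d"
    obtain k where k: "e * g ^ j = d * k" using Suc by (auto simp: e_def elim: dvdE)
    have "pderiv (e * g ^ j) * g = pderiv d * g * k + d * (pderiv k * g)"
      by (simp add: k pderiv_mult algebra_simps)
    then have 1: "d dvd pderiv (e * g ^ j) * g" using assms(2) by (simp add: dvd_add dvd_mult2)
    have "pderiv e * g ^ Suc j = pderiv (e * g ^ j) * g - (e * g ^ j) * of_nat j * pderiv g"
    proof (cases j)
      case (Suc i)
      have "pderiv (e * g ^ Suc i) = pderiv e * g ^ Suc i + e * (of_nat (Suc i) * g ^ i * pderiv g)"
        by (simp only: pderiv_mult pderiv_power_Suc) (simp add: of_nat_poly del: of_nat_Suc)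
      then show ?thesis by (simp only: Suc) (simp add: algebra_simps)
    qed simp
    then have "d dvd pderiv e * g ^ Suc j" using 1 k by (simp add: dvd_diff mult.assoc)
    then show ?case by (simp add: e_def)
  qed simp
  have deg: "degree ((pderiv ^^ j) d) = degree d - j" for j
    by (induction j) (simp_all add: degree_pderiv)
  have nz: "j \<le> degree d \<Longrightarrow> (pderiv ^^ j) d \<noteq> 0" for j
  proof (induction j)
    case (Suc j)
    then have "degree ((pderiv ^^ j) d) \<noteq> 0" using deg by simp
    then show ?case by (simp add: pderiv_eq_0_iff)
  qed (use assms in simp)
  obtain c where c: "(pderiv ^^ degree d) d = [:c:]" using deg[of "degree d"] by (metis degree_eq_zeroE diff_self_eq_0)
  have "c \<noteq> 0" using nz[of "degree d"] c by auto
  then show ?thesis using step[of "degree d"] by (simp add: c dvd_smult_iff)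
qed

text \<open>The radical of \<open>p\<close>, found without factorisation: \<open>q\<close> has least
  degree among the nonzero polynomials with a power divisible by \<open>p\<close>. If the Bezout
  divisor d of \<open>q\<close> and \<open>pderiv q\<close> were not constant, then g with
  \<open>q\<close> = d g would be a smaller candidate, since \<open>q\<close> divides a power of
  g.\<close>

lemma squarefree_kernel_exists:
  fixes p :: "'k::field_char_0 poly"
  assumes "p \<noteq> 0"
  obtains q N u v where "p dvd q ^ N" "u * q + v * pderiv q = 1"
proof -
  define S where "S = {q. q \<noteq> 0 \<and> (\<exists>N. p dvd q ^ N)}"
  have "p \<in> S" using assms unfolding S_def by (auto intro: exI[of _ 1])
  then obtain q where q: "q \<in> S" and qmin: "\<And>e. e \<in> S \<Longrightarrow> degree q \<le> degree e"
    using arg_min_natI[of "\<lambda>x. x \<in> S" p degree] arg_min_nat_le[of "\<lambda>x. x \<in> S" _ degree] by metis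
  then obtain N where N: "p dvd q ^ N" and q0: "q \<noteq> 0" unfolding S_def by blast
  obtain d u v where d: "d = u * q + v * pderiv q" "d dvd q" "d dvd pderiv q" "d \<noteq> 0"
    using poly_bezout[OF q0] by blast
  obtain g where g: "q = d * g" using d(2) by (auto elim: dvdE)
  have g0: "g \<noteq> 0" using q0 g by auto
  have "d dvd pderiv q - d * pderiv g" using d(3) by simp
  then have "d dvd pderiv d * g" by (simp add: g pderiv_mult algebra_simps)
  then have "d dvd g ^ degree d" by (rule dvd_power_if_dvd_pderiv_mult[OF d(4)])
  then have "q dvd g ^ Suc (degree d)" unfolding g by (simp add: mult.commute mult_dvd_mono)
  then have "q ^ N dvd g ^ (Suc (degree d) * N)" by (simp only: power_mult dvd_power_same)
  then have "g \<in> S" unfolding S_def using g0 N dvd_trans by blast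
  then have "degree q \<le> degree g" by (rule qmin)
  then have "degree d = 0" using degree_mult_eq[OF d(4) g0] g by simp
  then obtain c where c: "d = [:c:]" by (auto elim: degree_eq_zeroE)
  with d have c0: "c \<noteq> 0" by auto
  have "smult (inverse c) u * q + smult (inverse c) v * pderiv q = smult (inverse c) d"
    by (simp add: d(1) smult_add_right)
  then have "smult (inverse c) u * q + smult (inverse c) v * pderiv q = 1"
    using c c0 by (simp add: one_pCons)
  then show ?thesis using that N by blast
qed

text \<open>A Newton iteration. Instead of making \<open>s\<close> a root of \<open>q\<close> modulo
  powers of \<open>q\<close>, it makes the derivative of \<open>s\<close> vanish there, which is the
  form that \<open>papp_commutator\<close> asks for.\<close>

lemma poly_semisimple_part:
  fixes q :: "'k::field_char_0 poly"
  assumes "u * q + v * pderiv q = 1"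
  shows "\<exists>s. q dvd [:0, 1:] - s \<and> q ^ N dvd pderiv s"
proof (induction N)
  case 0
  show ?case by (rule exI[of _ "[:0,1:]"]) simp
next
  case (Suc N)
  then obtain s where s: "q dvd [:0, 1:] - s" and "q ^ N dvd pderiv s" by blast
  then obtain c where c: "pderiv s = q ^ N * c" by (auto elim: dvdE)
  define a :: 'k where "a = inverse (of_nat (Suc N))"
  have a: "a * of_nat (Suc N) = 1" unfolding a_def by (metis of_nat_neq_0 left_inverse)
  \<comment> \<open>Chosen to solve c + (N + 1) h q' = 0 modulo \<open>q\<close>; by hypothesis
    \<open>v\<close> is the inverse of \<open>pderiv q\<close> modulo \<open>q\<close>.\<close>
  define h where "h = smult a (- c * v)"
  have "pderiv (s + h * q ^ Suc N) = q ^ N * (c + smult (of_nat (Suc N)) h * pderiv q) + q ^ Suc N * pderiv h"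
    by (simp only: pderiv_add pderiv_mult pderiv_power_Suc c) (simp add: algebra_simps del: of_nat_Suc)
  also have "smult (of_nat (Suc N)) h = - c * v"
    unfolding h_def using a by (simp add: mult.commute del: of_nat_Suc)
  also have "c + - c * v * pderiv q = c * (1 - v * pderiv q)" by (simp add: algebra_simps)
  also have "1 - v * pderiv q = u * q" using assms by (simp add: algebra_simps)
  finally have "pderiv (s + h * q ^ Suc N) = q ^ Suc N * (c * u + pderiv h)"
    by (simp add: algebra_simps)
  moreover have "q dvd [:0, 1:] - (s + h * q ^ Suc N)"
    using s by (metis diff_diff_eq dvd_diff dvd_mult dvd_power zero_less_Suc)
  ultimately show ?case by (metis dvd_triv_left)
qed

section \<open>Polynomials in an endomorphism\<close>

definition papp :: "('k::field \<Rightarrow> 'v \<Rightarrow> 'v) \<Rightarrow> 'k poly \<Rightarrow> ('v \<Rightarrow> 'v) \<Rightarrow> 'v \<Rightarrow> 'v::ab_group_add" where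
  "papp scale p T = fold_coeffs (\<lambda>a f v. scale a v + T (f v)) p (\<lambda>v. 0)"

locale finite_subspace = vector_space scale
  for scale :: "'k::field_char_0 \<Rightarrow> 'v::ab_group_add \<Rightarrow> 'v" +
  fixes V :: "'v set"
  assumes V: "subspace V" and finite_span: "\<exists>B. finite B \<and> span B = V"
begin

definition endo :: "('v \<Rightarrow> 'v) \<Rightarrow> bool" where
  "endo T \<longleftrightarrow> (\<forall>x y. T (x + y) = T x + T y) \<and> (\<forall>c x. T (scale c x) = scale c (T x)) \<and> T ` V \<subseteq> V"

lemma endoD:
  assumes "endo T"
  shows "T (x + y) = T x + T y" "T (scale c x) = scale c (T x)" "T 0 = 0" "T (- x) = - T x"
    "T (x - y) = T x - T y" "T (sum f I) = (\<Sum>i\<in>I. T (f i))" "x \<in> V \<Longrightarrow> T x \<in> V"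
proof -
  show add: "T (x + y) = T x + T y" for x y using assms by (simp add: endo_def)
  show scale: "T (scale c x) = scale c (T x)" for c x using assms by (simp add: endo_def)
  show zero: "T 0 = 0" using scale[of 0] by simp
  show "T (- x) = - T x" for x using scale[of "-1" x] by simp
  then show "T (x - y) = T x - T y" using add[of x "- y"] by simp
  show "T (sum f I) = (\<Sum>i\<in>I. T (f i))"
    by (induction I rule: infinite_finite_induct) (simp_all add: add zero)
  show "x \<in> V \<Longrightarrow> T x \<in> V" using assms by (auto simp: endo_def)
qed

abbreviation "ap \<equiv> papp scale"

end

locale subspace_endo = finite_subspace +
  fixes T assumes T: "endo T"
begin

lemmas T_linear = endoD(1-6)[OF T]
lemmas T_closed = endoD(7)[OF T]

lemma papp_0 [simp]: "ap 0 T v = 0"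
  by (simp add: papp_def)

lemma papp_pCons [simp]: "ap (pCons a p) T v = scale a v + T (ap p T v)"
  by (cases "a = 0 \<and> p = 0") (auto simp: papp_def T_linear)

lemma papp_add: "ap (p + q) T v = ap p T v + ap q T v"
  by (induction p q rule: poly_induct2) (simp_all add: T_linear scale_left_distrib algebra_simps)

lemma papp_smult: "ap (smult c p) T v = scale c (ap p T v)"
  by (induction p) (simp_all add: T_linear scale_right_distrib)

lemma papp_diff: "ap (p - q) T v = ap p T v - ap q T v"
  using papp_add[of p "smult (-1) q"] papp_smult[of "-1" q] by simp

lemma papp_endo: "endo (ap p T)"
proof (induction p)
  case 0
  show ?case using subspace_0[OF V] by (auto simp: endo_def)
next
  case (pCons a p)
  then show ?case using V
    by (auto simp: endo_def T_linear T_closed scale_right_distrib mult.commute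
        subspace_add subspace_scale algebra_simps)
qed

lemmas papp_linear = endoD(1-6)[OF papp_endo]
lemmas papp_closed = endoD(7)[OF papp_endo]

lemma papp_mult: "ap (p * q) T v = ap p T (ap q T v)"
  by (induction p) (simp_all add: papp_add papp_smult)

lemma papp_power: "ap (p ^ n) T v = (ap p T ^^ n) v"
  by (induction n) (simp_all add: papp_mult one_pCons T_linear)

lemma papp_X: "ap [:0, 1:] T v = T v"
  by (simp add: T_linear)

text \<open>\<open>B\<close> is a bare function, constrained only on \<open>V\<close>; its
  additivity there is inherited from the commutator of \<open>T\<close> and \<open>U\<close>. Moving
  one \<open>T\<close> past \<open>U\<close> costs one \<open>B\<close>, which yields the product
  rule and hence the derivative.\<close>

lemma papp_commutator:
  assumes U: "endo U" and B: "\<And>v. v \<in> V \<Longrightarrow> T (U v) - U (T v) = B v"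
    and TB: "\<And>v. v \<in> V \<Longrightarrow> T (B v) = B (T v)" and v: "v \<in> V"
  shows "ap p T (U v) - U (ap p T v) = ap (pderiv p) T (B v)"
proof (induction p)
  case 0
  show ?case using U by (simp add: endoD)
next
  case (pCons a p)
  have BV: "B (ap p T v) = ap p T (B v)"
  proof (induction p)
    case 0
    have "T (U 0) - U (T 0) = B 0" using B subspace_0[OF V] by blast
    then show ?case using U by (simp add: endoD T_linear)
  next
    case (pCons a p)
    have "B (scale a v + T (ap p T v)) = scale a (B v) + B (T (ap p T v))"
      using U v papp_closed[OF v, of p] V
      by (simp flip: B add: T_closed subspace_add subspace_scale T_linear endoD scale_right_diff_distrib)
    then show ?case using pCons TB[OF papp_closed[OF v, of p]] by simp
  qed
  have "ap (pCons a p) T (U v) - U (ap (pCons a p) T v) = T (ap p T (U v)) - U (T (ap p T v))"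
    using U by (simp add: endoD)
  also have "\<dots> = T (ap p T (U v) - U (ap p T v)) + B (ap p T v)"
    using B[OF papp_closed[OF v, of p]] by (simp add: T_linear algebra_simps)
  also have "\<dots> = ap (pderiv (pCons a p)) T (B v)"
    by (simp add: pCons BV pderiv_pCons papp_add)
  finally show ?case .
qed

lemma annihilating_poly_vector:
  assumes "finite B" "V \<subseteq> span B" "v \<in> V"
  shows "\<exists>p. p \<noteq> 0 \<and> ap p T v = 0"
proof (rule ccontr)
  assume n: "\<not> ?thesis"
  define f where "f i = ap (monom 1 i) T v" for i
  have fV: "f i \<in> V" for i using assms papp_closed by (simp add: f_def)
  have comb: "(\<Sum>i\<in>I. scale (c i) (f i)) = ap (\<Sum>i\<in>I. monom (c i) i) T v" if "finite I" for c and I :: "nat set"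
    using that
  proof (induction I)
    case (insert i I)
    have "ap (monom (c i) i) T v = scale (c i) (f i)"
      by (simp add: f_def smult_monom flip: papp_smult)
    then show ?case using insert by (simp add: papp_add)
  qed simp
  have inj: "inj f"
  proof (rule injI)
    fix i j assume "f i = f j"
    then have "ap (monom 1 i - monom 1 j) T v = 0" by (simp add: papp_diff f_def)
    then have "monom (1::'a) i - monom 1 j = 0" using n by blast
    then show "i = j" using monom_eq_iff' by (metis eq_iff_diff_eq_0 zero_neq_one)
  qed
  have "independent (f ` {..card B})"
  proof (rule independent_if_scalars_zero)
    fix c x assume s: "(\<Sum>x\<in>f ` {..card B}. scale (c x) x) = 0" and x: "x \<in> f ` {..card B}"
    obtain k where k: "k \<le> card B" "x = f k" using x by auto
    have "(\<Sum>x\<in>f ` {..card B}. scale (c x) x) = (\<Sum>i\<le>card B. scale (c (f i)) (f i))"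
      using inj by (subst sum.reindex) (auto simp: inj_on_def inj_def)
    then have "ap (\<Sum>i\<le>card B. monom (c (f i)) i) T v = 0" using s comb by simp
    then have "(\<Sum>i\<le>card B. monom (c (f i)) i) = 0" using n by blast
    then have "coeff (\<Sum>i\<le>card B. monom (c (f i)) i) k = 0" by simp
    then show "c x = 0" using k by (simp add: coeff_sum if_distrib cong: if_cong)
  qed simp
  moreover have "f ` {..card B} \<subseteq> span B" using fV assms by auto
  ultimately have "card (f ` {..card B}) \<le> card B" using independent_span_bound assms(1) by blast
  then show False using inj by (simp add: card_image inj_on_def inj_def)
qed

lemma annihilating_poly:
  "\<exists>p. p \<noteq> 0 \<and> (\<forall>v\<in>V. ap p T v = 0)"
proof -
  obtain B where B: "finite B" "span B = V" using finite_span by blast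
  have "\<forall>b\<in>B. \<exists>p. p \<noteq> 0 \<and> ap p T b = 0"
    using annihilating_poly_vector[OF B(1)] B span_superset by blast
  then obtain P where P: "\<And>b. b \<in> B \<Longrightarrow> P b \<noteq> 0 \<and> ap (P b) T b = 0" by metis
  define p where "p = prod P B"
  have p0: "p \<noteq> 0" using P B by (simp add: p_def)
  have "ap p T v = 0" if "v \<in> span B" for v
    using that
  proof (induction rule: span_induct_alt)
    case base
    show ?case by (simp add: papp_linear)
  next
    case (step c x y)
    have "p = prod P (B - {x}) * P x"
      unfolding p_def using B step by (simp add: prod.remove mult.commute)
    then have "ap p T x = 0" using P[OF step(1)] by (simp add: papp_mult papp_linear)
    then show ?case using step by (simp add: papp_linear)
  qed
  then show ?thesis using p0 B by blast
qed

end

context subspace_endo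
begin

text \<open>With \<open>p\<close> annihilating \<open>T\<close> and \<open>p\<close> dividing
  \<open>q ^ N\<close>, both (X - s)^N and \<open>pderiv s\<close> are multiples of
  \<open>p\<close>. The second conclusion stands in for the semisimplicity of s(T).\<close>

lemma jordan_chevalley:
  "\<exists>s M. (\<forall>v\<in>V. ((\<lambda>v. T v - ap s T v) ^^ M) v = 0) \<and> (\<forall>v\<in>V. ap (pderiv s) T v = 0)"
proof -
  obtain p where p: "p \<noteq> 0" "\<And>v. v \<in> V \<Longrightarrow> ap p T v = 0" using annihilating_poly by blast
  obtain q N u w where q: "p dvd q ^ N" "u * q + w * pderiv q = 1"
    using squarefree_kernel_exists[OF p(1)] by blast
  obtain s where s: "q dvd [:0, 1:] - s" "q ^ N dvd pderiv s"
    using poly_semisimple_part[OF q(2)] by blast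
  have van: "ap f T v = 0" if "p dvd f" "v \<in> V" for f v
    using that p(2) by (auto simp: papp_mult papp_closed elim!: dvdE)
  have X: "(\<lambda>v. T v - ap s T v) = ap ([:0, 1:] - s) T"
    by (simp only: fun_eq_iff papp_diff papp_X) simp
  have "p dvd ([:0, 1:] - s) ^ N" using q(1) s(1) dvd_power_same dvd_trans by blast
  then have "((\<lambda>v. T v - ap s T v) ^^ N) v = 0" if "v \<in> V" for v
    unfolding X using van that by (simp flip: papp_power)
  moreover have "p dvd pderiv s" using q(1) s(2) dvd_trans by blast
  ultimately show ?thesis using van by blast
qed

end

section \<open>Nilpotent replacements and a Nakayama lemma\<close>

context finite_subspace
begin

lemma endo_minus: "endo S \<Longrightarrow> endo T \<Longrightarrow> endo (\<lambda>v. S v - T v)"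
  using subspace_diff[OF V] by (auto simp: endo_def scale_right_diff_distrib image_subset_iff)

lemma endo_commutator: "endo S \<Longrightarrow> endo T \<Longrightarrow> endo (\<lambda>v. S (T v) - T (S v))"
  using subspace_diff[OF V] by (auto simp: endo_def scale_right_diff_distrib image_subset_iff)

text \<open>With \<open>S i\<close> = s(A i), the commutator [S i, A j] is s'(A i) [A i, A j] = 0.
  Then \<open>S i\<close> commutes with every polynomial in \<open>A j\<close>, in particular with
  \<open>S j\<close>, so expanding [A i - S i, A j - S j] leaves [A i, A j].\<close>

lemma nilpotent_replacement:
  fixes A :: "nat \<Rightarrow> 'v \<Rightarrow> 'v"
  assumes endo: "\<And>i. i < r \<Longrightarrow> endo (A i)"
    and central: "\<And>i j k v. \<lbrakk>i < r; j < r; k < r; v \<in> V\<rbrakk> \<Longrightarrow>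
      A k (A i (A j v) - A j (A i v)) = A i (A j (A k v)) - A j (A i (A k v))"
  obtains N where "\<And>i. i < r \<Longrightarrow> endo (N i)" "\<And>i. i < r \<Longrightarrow> \<exists>M. \<forall>v\<in>V. (N i ^^ M) v = 0"
    "\<And>i j v. \<lbrakk>i < r; j < r; v \<in> V\<rbrakk> \<Longrightarrow> N i (N j v) - N j (N i v) = A i (A j v) - A j (A i v)"
    "\<And>i j k v. \<lbrakk>i < r; j < r; k < r; v \<in> V\<rbrakk> \<Longrightarrow>
      N k (N i (N j v) - N j (N i v)) = N i (N j (N k v)) - N j (N i (N k v))"
proof -
  have sub: "subspace_endo scale V (A i)" if "i < r" for i
    using endo[OF that] by unfold_locales
  have "\<forall>i. \<exists>s. i < r \<longrightarrow> (\<exists>M. \<forall>v\<in>V. ((\<lambda>v. A i v - ap s (A i) v) ^^ M) v = 0) \<and>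
      (\<forall>v\<in>V. ap (pderiv s) (A i) v = 0)"
    using subspace_endo.jordan_chevalley[OF sub] by metis
  then obtain s where s: "\<And>i. i < r \<Longrightarrow> \<exists>M. \<forall>v\<in>V. ((\<lambda>v. A i v - ap (s i) (A i) v) ^^ M) v = 0"
      "\<And>i v. i < r \<Longrightarrow> v \<in> V \<Longrightarrow> ap (pderiv (s i)) (A i) v = 0"
    by metis
  define S where "S i = ap (s i) (A i)" for i
  define N where "N i = (\<lambda>v. A i v - S i v)" for i
  define C where "C i j = (\<lambda>v. A i (A j v) - A j (A i v))" for i j
  have eS: "endo (S i)" if "i < r" for i
    unfolding S_def using subspace_endo.papp_endo[OF sub[OF that]] .
  have eC: "endo (C i j)" if "i < r" "j < r" for i j
    using endo_commutator[OF endo[OF that(1)] endo[OF that(2)]] by (simp add: C_def)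
  \<comment> \<open>\<open>Z\<close> is the commutator of \<open>A i\<close> and \<open>U\<close>:
    it is \<open>C i j\<close> when \<open>U\<close> is \<open>A j\<close>, and zero in the two
    other uses.\<close>
  have cA: "ap p (A i) (U v) = U (ap p (A i) v)"
    if i: "i < r" and U: "endo U" and z: "\<And>v. v \<in> V \<Longrightarrow> A i (U v) - U (A i v) = Z v"
      "\<And>v. v \<in> V \<Longrightarrow> A i (Z v) = Z (A i v)" "\<And>v. v \<in> V \<Longrightarrow> ap (pderiv p) (A i) (Z v) = 0"
      and v: "v \<in> V" for p i U Z v
    using subspace_endo.papp_commutator[OF sub[OF i] U z(1,2) v, of p] z(3)[OF v] by simp
  have SA: "S i (A j v) = A j (S i v)" if i: "i < r" and j: "j < r" and v: "v \<in> V" for i j v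
    unfolding S_def
    by (rule cA[OF i endo[OF j], of "C i j"])
      (use i j v central endoD(7)[OF eC[OF i j]] s in \<open>auto simp: C_def\<close>)
  have SS: "S i (S j v) = S j (S i v)" if i: "i < r" and j: "j < r" and v: "v \<in> V" for i j v
    unfolding S_def[of j]
    by (rule cA[OF j eS[OF i], of "\<lambda>_. 0", symmetric])
      (use i j v SA subspace_endo.papp_linear[OF sub[OF j]] endoD[OF endo[OF j]] in auto)
  have SC: "S k (C i j v) = C i j (S k v)" if i: "i < r" "j < r" "k < r" "v \<in> V" for i j k v
    unfolding S_def
    by (rule cA[OF i(3) eC[OF i(1,2)], of "\<lambda>_. 0"])
      (use i central[OF i(1,2,3)] subspace_endo.papp_linear(3)[OF sub[OF i(3)]] endoD(3)[OF endo[OF i(3)]]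
        in \<open>auto simp: C_def\<close>)
  have comm: "N i (N j v) - N j (N i v) = C i j v" if "i < r" "j < r" "v \<in> V" for i j v
    using that SA[of i j v] SA[of j i v] SS[of i j v]
    by (simp add: N_def C_def endoD(5)[OF endo] endoD(5)[OF eS])
  have NV: "N i v \<in> V" if "i < r" "v \<in> V" for i v
    using that endoD(7)[OF endo] endoD(7)[OF eS] subspace_diff[OF V] by (simp add: N_def)
  have NC: "N k (C i j v) = C i j (N k v)" if i: "i < r" "j < r" "k < r" "v \<in> V" for i j k v
    using SC[OF i] central[OF i] by (simp add: N_def endoD(5)[OF eC[OF i(1,2)]]) (simp add: C_def)
  show ?thesis
  proof (rule that[of N])
    fix i j k v assume i: "i < r" "j < r" "k < r" "v \<in> V"
    then show "N k (N i (N j v) - N j (N i v)) = N i (N j (N k v)) - N j (N i (N k v))"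
      using comm NC NV by simp
  qed (use comm s(1) in \<open>auto simp: C_def N_def S_def intro: endo_minus endo eS[unfolded S_def]\<close>)
qed

text \<open>Nakayama for noncommuting operators, dropping the head \<open>T\<close> of the list: U
  \<subseteq> Q ys + T U and the invariance of \<open>Q ys\<close> under \<open>T\<close> give U
  \<subseteq> Q ys + T^j U for all j, and T^j vanishes eventually. Each \<open>Q ys\<close> has to
  be invariant only under the operator just before \<open>ys\<close>.\<close>

lemma nilpotent_list_generation:
  assumes U: "subspace U" "U \<subseteq> V" and W: "subspace W" "W \<subseteq> U"
    and Ts: "\<And>T. T \<in> set Ts \<Longrightarrow> endo T \<and> T ` U \<subseteq> U \<and> (\<exists>M. \<forall>v\<in>V. (T ^^ M) v = 0)"
    and Q: "\<And>ys. Q ys = span (W \<union> (\<Union>S\<in>set ys. S ` U))"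
    and inv: "\<And>xs T ys. Ts = xs @ T # ys \<Longrightarrow> T ` Q ys \<subseteq> Q ys"
    and gen: "U \<subseteq> Q Ts"
  shows "U \<subseteq> W"
  using Ts inv gen
proof (induction Ts)
  case Nil
  then show ?case using W by (simp add: Q span_eq_iff[THEN iffD2])
next
  case (Cons T ys)
  have T: "endo T" "T ` U \<subseteq> U" using Cons.prems(1)[of T] by auto
  obtain M where M: "\<And>v. v \<in> V \<Longrightarrow> (T ^^ M) v = 0" using Cons.prems(1)[of T] by auto
  have TQ: "T ` Q ys \<subseteq> Q ys" using Cons.prems(2)[of "[]"] by simp
  have sQ: "subspace (Q ys)" by (simp add: Q)
  have sT: "subspace (T ` U)"
    using U T by (auto simp: subspace_def image_iff endoD(2)[OF T(1), symmetric]
        endoD(1)[OF T(1), symmetric] endoD(3)[OF T(1)] intro: bexI[of _ 0])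
  have dec: "\<exists>q u'. q \<in> Q ys \<and> u' \<in> U \<and> u = q + T u'" if "u \<in> U" for u
  proof -
    have "u \<in> span ((W \<union> (\<Union>S\<in>set ys. S ` U)) \<union> T ` U)"
      using that Cons.prems(3) by (auto simp: Q Un_ac)
    then show ?thesis using sT by (auto simp: span_Un Q span_eq_iff[THEN iffD2])
  qed
  have pow: "(T ^^ j) (x + y) = (T ^^ j) x + (T ^^ j) y" for j x y
    by (induction j) (simp_all add: endoD(1)[OF T(1)])
  have powQ: "q \<in> Q ys \<Longrightarrow> (T ^^ j) q \<in> Q ys" for j q
    using TQ by (induction j) auto
  have iter: "\<exists>q u'. q \<in> Q ys \<and> u' \<in> U \<and> u = q + (T ^^ j) u'" if "u \<in> U" for u j
  proof (induction j)
    case 0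
    show ?case using that subspace_0[OF sQ] by (intro exI[of _ 0] exI[of _ u]) auto
  next
    case (Suc j)
    then obtain q u' where q: "q \<in> Q ys" "u' \<in> U" "u = q + (T ^^ j) u'" by blast
    obtain q' u'' where q': "q' \<in> Q ys" "u'' \<in> U" "u' = q' + T u''" using dec[OF q(2)] by blast
    have "u = (q + (T ^^ j) q') + (T ^^ Suc j) u''"
      by (simp add: q(3) q'(3) pow funpow_swap1 add.assoc)
    then show ?case using q q' powQ subspace_add[OF sQ] by blast
  qed
  have "U \<subseteq> Q ys"
  proof
    fix u assume "u \<in> U"
    then obtain q u' where "q \<in> Q ys" "u' \<in> U" "u = q + (T ^^ M) u'" using iter by blast
    then show "u \<in> Q ys" using M U by auto
  qed
  moreover have "T' ` Q zs \<subseteq> Q zs" if "ys = xs @ T' # zs" for xs T' zs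
    using Cons.prems(2)[of "T # xs" T' zs] that by simp
  ultimately show ?case using Cons.IH Cons.prems(1) by simp
qed

end

locale nilpotent_operators = finite_subspace scale V
  for scale :: "'k::field_char_0 \<Rightarrow> 'v::ab_group_add \<Rightarrow> 'v" and V +
  fixes r :: nat and A :: "nat \<Rightarrow> 'v \<Rightarrow> 'v"
  assumes endo_A: "\<And>i. i < r \<Longrightarrow> endo (A i)"
    and nilpotent_A: "\<And>i. i < r \<Longrightarrow> \<exists>M. \<forall>v\<in>V. (A i ^^ M) v = 0"
    and central_A: "\<And>i j k v. \<lbrakk>i < r; j < r; k < r; v \<in> V\<rbrakk> \<Longrightarrow>
      A k (A i (A j v) - A j (A i v)) = A i (A j (A k v)) - A j (A i (A k v))"
begin

definition C :: "nat \<Rightarrow> nat \<Rightarrow> 'v \<Rightarrow> 'v" where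
  "C i j = (\<lambda>v. A i (A j v) - A j (A i v))"

lemma endo_C: "i < r \<Longrightarrow> j < r \<Longrightarrow> endo (C i j)"
  using endo_commutator endo_A by (simp add: C_def)

lemma A_C: "\<lbrakk>i < r; j < r; k < r; v \<in> V\<rbrakk> \<Longrightarrow> A k (C i j v) = C i j (A k v)"
  using central_A by (simp add: C_def)

lemma C_C:
  assumes "i < r" "j < r" "k < r" "l < r" "v \<in> V"
  shows "C k l (C i j v) = C i j (C k l v)"
proof -
  have "C k l (C i j v) = A k (C i j (A l v)) - A l (C i j (A k v))"
    using assms by (simp add: C_def[of k l] A_C)
  also have "\<dots> = C i j (C k l v)"
    using assms endoD(7)[OF endo_A] endoD(5)[OF endo_C]
    by (simp add: C_def[of k l] A_C)
  finally show ?thesis .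
qed

text \<open>Let A = \<open>A i\<close> with A^M = 0 and C = \<open>C i j\<close>. Then A^(M - n) C^n
  = 0 by induction on n: apply A^m A_j - A_j A^m = m A^(m - 1) C to the range of C^n and divide by
  m, in characteristic zero. The case n = M is the claim.\<close>

lemma nilpotent_C:
  assumes i: "i < r" and j: "j < r"
  shows "\<exists>M. \<forall>v\<in>V. (C i j ^^ M) v = 0"
proof -
  obtain M where M: "\<And>v. v \<in> V \<Longrightarrow> (A i ^^ M) v = 0" using nilpotent_A[OF i] by blast
  have CV: "v \<in> V \<Longrightarrow> (C i j ^^ n) v \<in> V" for n v
    by (induction n) (simp_all add: endoD(7)[OF endo_C[OF i j]])
  have AV: "v \<in> V \<Longrightarrow> (A i ^^ n) v \<in> V" for n v
    by (induction n) (simp_all add: endoD(7)[OF endo_A[OF i]])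
  have AkC: "v \<in> V \<Longrightarrow> A k ((C i j ^^ n) v) = (C i j ^^ n) (A k v)" if "k < r" for k n v
    using that i j by (induction n) (simp_all add: A_C CV)
  have AnC: "v \<in> V \<Longrightarrow> (A i ^^ n) (C i j v) = C i j ((A i ^^ n) v)" for n v
    using i j by (induction n) (simp_all add: A_C AV)
  have com: "(A i ^^ n) (A j v) = A j ((A i ^^ n) v) + scale (of_nat n) ((A i ^^ (n - 1)) (C i j v))"
    if v: "v \<in> V" for n v
  proof (induction n)
    case (Suc n)
    have "(A i ^^ Suc n) (A j v) = A i (A j ((A i ^^ n) v)) + scale (of_nat n) (A i ((A i ^^ (n - 1)) (C i j v)))"
      by (simp add: Suc endoD[OF endo_A[OF i]])
    also have "A i (A j ((A i ^^ n) v)) = A j ((A i ^^ Suc n) v) + (A i ^^ n) (C i j v)"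
      using AnC[OF v] by (simp add: C_def)
    also have "scale (of_nat n) (A i ((A i ^^ (n - 1)) (C i j v))) = scale (of_nat n) ((A i ^^ n) (C i j v))"
      by (cases n) simp_all
    finally show ?case by (simp add: scale_left_distrib add.assoc)
  qed simp
  have "\<forall>v\<in>V. (A i ^^ (M - n)) ((C i j ^^ n) v) = 0" if "n \<le> M" for n
    using that
  proof (induction n)
    case 0
    then show ?case using M by simp
  next
    case (Suc n)
    show ?case
    proof
      fix v assume v: "v \<in> V"
      define m where "m = M - n"
      have m: "m \<noteq> 0" "M - Suc n = m - 1" using Suc by (auto simp: m_def)
      have IH: "(A i ^^ m) ((C i j ^^ n) w) = 0" if "w \<in> V" for w using Suc that by (simp add: m_def)
      have "(A i ^^ m) (A j ((C i j ^^ n) v)) = 0"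
        using IH[of "A j v"] v j by (simp add: AkC endoD(7)[OF endo_A])
      then have "scale (of_nat m) ((A i ^^ (m - 1)) (C i j ((C i j ^^ n) v))) = 0"
        using com[OF CV[OF v], of m] IH[OF v] by (simp add: endoD[OF endo_A[OF j]])
      then show "(A i ^^ (M - Suc n)) ((C i j ^^ Suc n) v) = 0" using m by simp
    qed
  qed
  from this[of M] show ?thesis by auto
qed

definition g :: "'v set \<Rightarrow> 'v set" where
  "g W = span (\<Union>i<r. A i ` W)"

lemma A_in_g: "i < r \<Longrightarrow> v \<in> W \<Longrightarrow> A i v \<in> g W"
  unfolding g_def by (auto intro: span_base)

lemma g_subset: "subspace W \<Longrightarrow> (\<And>i w. i < r \<Longrightarrow> w \<in> U \<Longrightarrow> A i w \<in> W) \<Longrightarrow> g U \<subseteq> W"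
  unfolding g_def by (rule span_minimal) auto

lemma g_mono: "U \<subseteq> W \<Longrightarrow> g U \<subseteq> g W"
  unfolding g_def by (rule span_mono) auto

lemma subspace_g: "subspace (g U)"
  by (simp add: g_def)

text \<open>The operators are removed from the generating list one at a time, the \<open>A i\<close> before the \<open>C i j\<close>, so that
  each operator preserves the span of the images of the later ones.\<close>

lemma nakayama:
  assumes U: "subspace U" "U \<subseteq> V" "g U \<subseteq> U" and W: "subspace W" "W \<subseteq> U" "g W \<subseteq> W"
    and gen: "U \<subseteq> span (W \<union> g U)"
  shows "U \<subseteq> W"
proof -
  define Cs where "Cs = map (\<lambda>(i, j). C i j) (List.product [0..<r] [0..<r])"
  define Ts where "Ts = map A [0..<r] @ Cs"
  define Q where "Q ys = span (W \<union> (\<Union>S\<in>set ys. S ` U))" for ys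
  have AU: "A i u \<in> U" if "i < r" "u \<in> U" for i u using U(3) A_in_g that by blast
  have AW: "A i u \<in> W" if "i < r" "u \<in> W" for i u using W(3) A_in_g that by blast
  have CU: "C i j u \<in> U" if "i < r" "j < r" "u \<in> U" for i j u
    using that AU U(1) by (auto simp: C_def intro: subspace_diff)
  have CW: "C i j u \<in> W" if "i < r" "j < r" "u \<in> W" for i j u
    using that AW W(1) by (auto simp: C_def intro: subspace_diff)
  have Cs: "T \<in> set Cs \<longleftrightarrow> (\<exists>i<r. \<exists>j<r. T = C i j)" for T
    by (simp add: Cs_def image_iff Bex_def)
  have Qinv: "T ` Q ys \<subseteq> Q ys"
    if T: "endo T" and 1: "\<And>w. w \<in> W \<Longrightarrow> T w \<in> W"
      and 2: "\<And>S u. S \<in> set ys \<Longrightarrow> u \<in> U \<Longrightarrow> T (S u) \<in> Q ys" for T ys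
  proof -
    have "T x \<in> Q ys" if "x \<in> Q ys" for x
      using that unfolding Q_def
    proof (induction rule: span_induct_alt)
      case base
      show ?case by (simp add: endoD[OF T] span_zero)
    next
      case (step c x y)
      have "T x \<in> span (W \<union> (\<Union>S\<in>set ys. S ` U))"
        using step(1) 1 2 unfolding Q_def by (auto intro: span_base)
      then show ?case using step by (simp add: endoD[OF T] span_add span_scale)
    qed
    then show ?thesis by blast
  qed
  show ?thesis
  proof (rule nilpotent_list_generation[OF U(1,2) W(1,2), of Ts Q])
    fix T assume "T \<in> set Ts"
    then show "endo T \<and> T ` U \<subseteq> U \<and> (\<exists>M. \<forall>v\<in>V. (T ^^ M) v = 0)"
      using endo_A nilpotent_A AU endo_C nilpotent_C CU unfolding Ts_def by (auto simp: Cs)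
  next
    show "U \<subseteq> Q Ts"
    proof -
      have "g U \<subseteq> Q Ts"
        unfolding g_def Q_def by (rule span_mono) (auto simp: Ts_def)
      moreover have "W \<subseteq> Q Ts" unfolding Q_def by (auto intro: span_base)
      ultimately have "span (W \<union> g U) \<subseteq> Q Ts" by (intro span_minimal) (auto simp: Q_def)
      then show ?thesis using gen by blast
    qed
  next
    fix xs T ys assume split: "Ts = xs @ T # ys"
    have US: "S u \<in> Q ys" if "S \<in> set ys" "u \<in> U" for S u
      unfolding Q_def using that by (auto intro!: span_base)
    show "T ` Q ys \<subseteq> Q ys"
    proof (cases "length xs < r")
      case True
      define i where "i = length xs"
      have T: "T = A i" and ys: "ys = map A [Suc i..<r] @ Cs"
      proof -
        have "T = Ts ! i" using split by (simp add: i_def)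
        then show "T = A i" using True by (simp add: Ts_def nth_append i_def)
        have "ys = drop (Suc i) Ts" using split by (simp add: i_def)
        then show "ys = map A [Suc i..<r] @ Cs" using True by (simp add: Ts_def drop_map i_def)
      qed
      have i: "i < r" using True by (simp add: i_def)
      show ?thesis
      proof (rule Qinv)
        fix S u assume S: "S \<in> set ys" and u: "u \<in> U"
        consider k where "k < r" "S = A k" | k l where "k < r" "l < r" "S = C k l"
          using S unfolding ys by (auto simp: Cs)
        then show "T (S u) \<in> Q ys"
        proof cases
          case 1
          \<comment> \<open>The commutator term stays in \<open>Q ys\<close> because all of
            \<open>Cs\<close> lies to the right of \<open>A i\<close> in the list.\<close>
          have "A i (A k u) = A k (A i u) + C i k u" by (simp add: C_def)
          moreover have "C i k \<in> set ys" using i 1 unfolding ys by (auto simp: Cs)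
          then have "C i k u \<in> Q ys" using US u by blast
          moreover have "A k (A i u) \<in> Q ys" using US[OF S AU[OF i u]] 1 by simp
          ultimately show ?thesis unfolding T 1 Q_def by (simp add: span_add)
        next
          case 2
          then show ?thesis using US[OF S AU[OF i u]] i u U(2) A_C T by auto
        qed
      qed (use T i endo_A AW in auto)
    next
      case False
      have "T = Ts ! length xs" "length xs < length Ts" using split by auto
      then have "T \<in> set Cs" using False by (auto simp: Ts_def nth_append)
      then obtain i j where T: "i < r" "j < r" "T = C i j" by (auto simp: Cs)
      have "set ys \<subseteq> set Cs"
      proof -
        have "ys = drop (Suc (length xs)) Ts" using split by simp
        also have "\<dots> = drop (Suc (length xs) - r) Cs" using False by (simp add: Ts_def)
        finally show ?thesis using set_drop_subset by metis
      qed
      show ?thesis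
      proof (rule Qinv)
        fix S u assume S: "S \<in> set ys" and u: "u \<in> U"
        then obtain k l where k: "k < r" "l < r" "S = C k l" using \<open>set ys \<subseteq> set Cs\<close> Cs by blast
        then have "T (S u) = S (T u)" using T C_C[of k l i j u] u U(2) by auto
        then show "T (S u) \<in> Q ys" using US[OF S CU[OF T(1,2) u]] T by simp
      qed (use T endo_C CW in auto)
    qed
  qed (simp add: Q_def)
qed

end

section \<open>The lower bound\<close>

definition pairs :: "nat \<Rightarrow> (nat \<times> nat) set" where
  "pairs r = {(i, j). i < j \<and> j < r}"

lemma finite_pairs [simp]: "finite (pairs r)"
  by (rule finite_subset[of _ "{..<r} \<times> {..<r}"]) (auto simp: pairs_def)

lemma sum_pairs:
  fixes f :: "nat \<Rightarrow> nat \<Rightarrow> 'a::ab_group_add"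
  assumes "\<And>i. i < r \<Longrightarrow> f i i = 0"
  shows "(\<Sum>(i, j)\<in>pairs r. f i j + f j i) = (\<Sum>i<r. \<Sum>j<r. f i j)"
proof -
  let ?P = "pairs r" and ?Q = "(\<lambda>(i, j). (j, i)) ` pairs r" and ?D = "(\<lambda>i. (i, i)) ` {..<r}"
  have "(\<Sum>i<r. \<Sum>j<r. f i j) = (\<Sum>(i, j)\<in>{..<r} \<times> {..<r}. f i j)"
    by (simp add: sum.cartesian_product)
  also have "{..<r} \<times> {..<r} = (?P \<union> ?Q) \<union> ?D"
    by (auto simp: pairs_def image_iff)
  also have "(\<Sum>(i, j)\<in>(?P \<union> ?Q) \<union> ?D. f i j) =
      (\<Sum>(i, j)\<in>?P. f i j) + (\<Sum>(i, j)\<in>?Q. f i j) + (\<Sum>(i, j)\<in>?D. f i j)"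
    by (subst sum.union_disjoint, simp, simp, force simp: pairs_def,
        subst sum.union_disjoint) (auto simp: pairs_def finite_pairs[unfolded pairs_def])
  also have "(\<Sum>(i, j)\<in>?Q. f i j) = (\<Sum>(i, j)\<in>?P. f j i)"
    by (subst sum.reindex) (auto simp: inj_on_def case_prod_unfold)
  also have "(\<Sum>(i, j)\<in>?D. f i j) = 0"
    using assms by (subst sum.reindex) (auto simp: inj_on_def)
  finally show ?thesis by (simp add: sum.distrib case_prod_unfold)
qed

lemma card_pairs: "2 * card (pairs r) = r * (r - 1)"
proof -
  have "2 * int (card (pairs r)) = (\<Sum>(i, j)\<in>pairs r. (if i = j then 0 else 1) + (if j = i then 0 else 1))"
  proof -
    have "(\<Sum>(i, j)\<in>pairs r. (if i = j then 0 else 1) + (if j = i then 0 else 1)) = (\<Sum>_\<in>pairs r. 2 :: int)"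
      by (rule sum.cong) (auto simp: pairs_def)
    then show ?thesis by simp
  qed
  also have "\<dots> = (\<Sum>i<r. \<Sum>j<r. if i = j then 0 else (1::int))"
    by (rule sum_pairs) simp
  also have "\<dots> = (\<Sum>i<r. int r - 1)"
  proof (rule sum.cong)
    fix i assume i: "i \<in> {..<r}"
    have "(\<Sum>j<r. if i = j then 0 else (1::int)) = (\<Sum>j<r. 1 - (if i = j then 1 else 0))"
      by (rule sum.cong) auto
    also have "\<dots> = int r - 1" using i by (simp add: sum_subtractf)
    finally show "(\<Sum>j<r. if i = j then 0 else (1::int)) = int r - 1" .
  qed simp
  also have "\<dots> = int (r * (r - 1))" by (cases r) (simp_all add: algebra_simps)
  finally show ?thesis by linarith
qed

section \<open>Linear systems and a bilinear relation\<close>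

lemma homogeneous_system_nontrivial_solution:
  fixes M :: "'e \<Rightarrow> 'p \<Rightarrow> 'k::field"
  assumes "finite E" "finite P" "card E < card P"
  shows "\<exists>c. (\<exists>p\<in>P. c p \<noteq> 0) \<and> (\<forall>e\<in>E. (\<Sum>p\<in>P. M e p * c p) = 0)"
  using assms
proof (induction E arbitrary: P M rule: finite_induct)
  case empty
  then show ?case by (intro exI[of _ "\<lambda>_. 1"]) (auto simp: card_gt_0_iff)
next
  case (insert e E)
  show ?case
  proof (cases "\<exists>q\<in>P. M e q \<noteq> 0")
    case False
    have "card E < card P" using insert by simp
    then obtain c where "\<exists>p\<in>P. c p \<noteq> 0" "\<forall>e\<in>E. (\<Sum>p\<in>P. M e p * c p) = 0"
      using insert.IH[OF insert.prems(1), of M] by blast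
    then show ?thesis using False by (intro exI[of _ c]) auto
  next
    case True
    then obtain q where q: "q \<in> P" "M e q \<noteq> 0" by blast
    define N where "N f p = M f p - M f q * M e p / M e q" for f p
    have "card E < card (P - {q})" using insert q by simp
    then obtain c where c: "\<exists>p\<in>P - {q}. c p \<noteq> 0" "\<forall>f\<in>E. (\<Sum>p\<in>P - {q}. N f p * c p) = 0"
      using insert.IH[of "P - {q}" N] insert.prems(1) by blast
    define s where "s = (\<Sum>p\<in>P - {q}. M e p * c p)"
    define d where "d = c(q := - s / M e q)"
    have sum_d: "(\<Sum>p\<in>P. M f p * d p) = - M f q * s / M e q + (\<Sum>p\<in>P - {q}. M f p * c p)" for f
      using insert.prems(1) q by (simp add: sum.remove[OF _ q(1)] d_def)
    have "(\<Sum>p\<in>P. M f p * d p) = 0" if "f \<in> E" for f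
    proof -
      have "0 = (\<Sum>p\<in>P - {q}. N f p * c p)" using c that by simp
      also have "\<dots> = (\<Sum>p\<in>P - {q}. M f p * c p) - (\<Sum>p\<in>P - {q}. M f q / M e q * (M e p * c p))"
        unfolding sum_subtractf[symmetric] by (rule sum.cong) (simp_all add: N_def field_simps)
      also have "(\<Sum>p\<in>P - {q}. M f q / M e q * (M e p * c p)) = M f q * s / M e q"
        by (simp add: s_def sum_distrib_left sum_divide_distrib)
      finally show ?thesis by (simp add: sum_d)
    qed
    moreover have "(\<Sum>p\<in>P. M e p * d p) = 0" using q by (simp add: sum_d s_def)
    moreover have "\<exists>p\<in>P. d p \<noteq> 0" using c(1) by (auto simp: d_def)
    ultimately show ?thesis by blast
  qed
qed

lemma card_le_if_system_trivial:
  fixes M :: "'e \<Rightarrow> 'p \<Rightarrow> 'k::field"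
  assumes "finite E" "finite P"
    and "\<And>c. (\<forall>e\<in>E. (\<Sum>p\<in>P. M e p * c p) = 0) \<Longrightarrow> \<forall>p\<in>P. c p = 0"
  shows "card P \<le> card E"
  using homogeneous_system_nontrivial_solution[OF assms(1,2), of M] assms(3) by (meson not_le)

lemma two_independent_solutions:
  fixes M :: "'e \<Rightarrow> nat \<Rightarrow> 'k::field"
  assumes E: "finite E" "card E + 2 \<le> r"
  shows "\<exists>x y p q. p < r \<and> q < r \<and> x p * y q - x q * y p \<noteq> 0 \<and>
    (\<forall>e\<in>E. (\<Sum>i<r. M e i * x i) = 0) \<and> (\<forall>e\<in>E. (\<Sum>i<r. M e i * y i) = 0)"
proof -
  obtain x p where x: "p < r" "x p \<noteq> 0" "\<And>e. e \<in> E \<Longrightarrow> (\<Sum>i<r. M e i * x i) = 0"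
    using homogeneous_system_nontrivial_solution[OF E(1), of "{..<r}" M] E(2) by auto
  \<comment> \<open>The additional equation \<open>None\<close> forces y p = 0, so the minor at p, q
    reduces to x p * y q.\<close>
  define M' where "M' e i = (case e of None \<Rightarrow> if i = p then 1 else 0 | Some e \<Rightarrow> M e i)" for e i
  have "card (insert None (Some ` E)) < r" using E by (simp add: card_insert_if card_image)
  then obtain y q where y: "q < r" "y q \<noteq> 0" "\<And>e. e \<in> insert None (Some ` E) \<Longrightarrow> (\<Sum>i<r. M' e i * y i) = 0"
    using homogeneous_system_nontrivial_solution[of "insert None (Some ` E)" "{..<r}" M'] E(1) by auto
  have "(\<Sum>i<r. M' None i * y i) = y p" using x(1) by (simp add: M'_def if_distrib if_distribR cong: if_cong)
  then have "y p = 0" using y(3) by simp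
  moreover have "(\<Sum>i<r. M e i * y i) = 0" if "e \<in> E" for e
    using y(3)[of "Some e"] that by (simp add: M'_def)
  ultimately show ?thesis using x y
    by (intro exI[of _ x] exI[of _ y] exI[of _ p] exI[of _ q]) simp
qed

lemma cramer_2:
  fixes b :: "'k::field"
  assumes "b * y - c * x \<noteq> 0" "b * X + c * Y = 0" "x * X + y * Y = 0"
  shows "X = 0" "Y = 0"
proof -
  have "(b * y - c * x) * X = y * (b * X + c * Y) - c * (x * X + y * Y)"
    "(b * y - c * x) * Y = b * (x * X + y * Y) - x * (b * X + c * Y)"
    by (simp_all add: algebra_simps)
  then have "(b * y - c * x) * X = 0" "(b * y - c * x) * Y = 0" unfolding assms(2,3) by simp_all
  then show "X = 0" "Y = 0" using assms(1) by simp_all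
qed

text \<open>The relation is that of \<open>centrality_relation\<close>. Two rows \<open>b\<close>,
  \<open>b'\<close> with a nonzero minor turn each pair of relations into an invertible 2 x 2
  system. On the indices p, q this gives 2 t p q = t q p and t p q = 2 t q p, hence 3 t q p = 0; the
  other entries follow from these.\<close>

lemma bilinear_relation_trivial:
  fixes t :: "nat \<Rightarrow> nat \<Rightarrow> 'k::field_char_0"
  assumes b: "\<And>i j l. \<lbrakk>i < r; j < r; l < r\<rbrakk> \<Longrightarrow> b l * (t i j - t j i) = b j * t l i - b i * t l j"
    and b': "\<And>i j l. \<lbrakk>i < r; j < r; l < r\<rbrakk> \<Longrightarrow> b' l * (t i j - t j i) = b' j * t l i - b' i * t l j"
    and pq: "p < r" "q < r" "b p * b' q - b q * b' p \<noteq> 0"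
    and ij: "i < r" "j < r"
  shows "t i j = 0"
proof -
  note cr = cramer_2[OF pq(3)]
  have "b p * (2 * t p q - t q p) + b q * (- t p p) = 0" "b' p * (2 * t p q - t q p) + b' q * (- t p p) = 0"
    using b[OF pq(1,2,1)] b'[OF pq(1,2,1)] by (simp_all add: algebra_simps)
  note 1 = cr[OF this]
  have "b p * (t q q) + b q * (t p q - 2 * t q p) = 0" "b' p * (t q q) + b' q * (t p q - 2 * t q p) = 0"
    using b[OF pq(1,2,2)] b'[OF pq(1,2,2)] by (simp_all add: algebra_simps)
  note 2 = cr[OF this]
  have "3 * t q p = 0" using 1 2 by (simp add: algebra_simps)
  then have z: "t q p = 0" "t p q = 0" "t p p = 0" "t q q = 0" using 1 2 by auto
  have x: "t q x = 0 \<and> t p x = 0 \<and> t x p = 0 \<and> t x q = 0" if "x < r" for x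
  proof -
    have "b p * (t q x) + b q * (- (t x p - t p x)) = 0" "b' p * (t q x) + b' q * (- (t x p - t p x)) = 0"
    using b[OF that pq(1,2)] b'[OF that pq(1,2)] z by (simp_all add: algebra_simps)
    note 3 = cr[OF this]
    have "b p * (- (t x q - t q x)) + b q * (t p x) = 0" "b' p * (- (t x q - t q x)) + b' q * (t p x) = 0"
    using b[OF that pq(2,1)] b'[OF that pq(2,1)] z by (simp_all add: algebra_simps)
    note 4 = cr[OF this]
    show ?thesis using 3 4 by simp
  qed
  have "b p \<noteq> 0 \<or> b q \<noteq> 0" using pq(3) by auto
  then show ?thesis
  proof
    assume "b p \<noteq> 0"
    then have "t i j = t j i" using b[OF ij pq(1)] x ij by simp
    then show ?thesis using b[OF pq(1) ij(2,1)] x[OF ij(2)] x[OF ij(1)] \<open>b p \<noteq> 0\<close> by simp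
  next
    assume "b q \<noteq> 0"
    then have "t i j = t j i" using b[OF ij pq(2)] x ij by simp
    then show ?thesis using b[OF pq(2) ij(2,1)] x[OF ij(2)] x[OF ij(1)] \<open>b q \<noteq> 0\<close> by simp
  qed
qed

section \<open>The filtration of a faithful nilpotent family\<close>

locale faithful_nilpotent_operators = nilpotent_operators +
  assumes r: "2 \<le> r"
    and independent_C: "\<And>c. (\<And>v. v \<in> V \<Longrightarrow> (\<Sum>p\<in>pairs r. scale (c p) (C (fst p) (snd p) v)) = 0) \<Longrightarrow>
      \<forall>p\<in>pairs r. c p = 0"
begin

abbreviation "m \<equiv> card (pairs r)"

text \<open>The action of the bivector with coordinates \<open>c\<close>.\<close>

definition Z where
  "Z c v = (\<Sum>p\<in>pairs r. scale (c p) (C (fst p) (snd p) v))"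

lemma pairs_lt: "p \<in> pairs r \<Longrightarrow> fst p < r \<and> snd p < r"
  by (auto simp: pairs_def)

lemma endo_Z: "endo (Z c)"
proof -
  have "endo (C (fst p) (snd p))" if "p \<in> pairs r" for p
    using pairs_lt[OF that] endo_C by blast
  then show ?thesis unfolding endo_def Z_def
    by (auto simp: endo_def scale_right_distrib sum.distrib scale_sum_right mult.commute image_subset_iff
        intro!: subspace_sum[OF V] subspace_scale[OF V])
qed

lemma A_Z:
  assumes "k < r" "v \<in> V"
  shows "A k (Z c v) = Z c (A k v)"
  unfolding Z_def endoD(6)[OF endo_A[OF assms(1)]]
  by (rule sum.cong) (use pairs_lt A_C assms in \<open>auto simp: endoD(2)[OF endo_A[OF assms(1)]]\<close>)

lemma C_swap: "C j i v = - C i j v"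
  by (simp add: C_def)

text \<open>The bivector is x wedge y, and the right-hand side is the commutator of \<Sum> x_i A_i
  and \<Sum> y_j A_j.\<close>

lemma Z_decomposable: "Z (\<lambda>(i, j). x i * y j - x j * y i) v = (\<Sum>i<r. \<Sum>j<r. scale (x i * y j) (C i j v))"
proof -
  have "Z (\<lambda>(i, j). x i * y j - x j * y i) v =
      (\<Sum>(i, j)\<in>pairs r. scale (x i * y j) (C i j v) + scale (x j * y i) (C j i v))"
  proof -
    have "scale (a - b) (C i j v) = scale a (C i j v) + scale b (C j i v)" for a b i j
      by (simp add: C_swap[of j i] scale_left_diff_distrib)
    then show ?thesis unfolding Z_def by (simp add: case_prod_unfold)
  qed
  also have "\<dots> = (\<Sum>i<r. \<Sum>j<r. scale (x i * y j) (C i j v))"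
    by (rule sum_pairs) (simp add: C_def)
  finally show ?thesis .
qed

lemma pairs_nonempty: "(0, 1) \<in> pairs r" "0 < m"
proof -
  show "(0, 1) \<in> pairs r" using r by (simp add: pairs_def)
  then show "0 < m" by (auto simp: card_gt_0_iff)
qed

lemma C_nonzero: "\<exists>v\<in>V. \<exists>i<r. \<exists>j<r. C i j v \<noteq> 0"
proof (rule ccontr)
  assume n: "\<not> ?thesis"
  have "\<forall>p\<in>pairs r. (1 :: 'a) = 0"
    by (rule independent_C, rule sum.neutral) (use n pairs_lt in auto)
  then show False using pairs_nonempty by auto
qed

abbreviation "V1 \<equiv> g V"
abbreviation "V2 \<equiv> g V1"
abbreviation "V3 \<equiv> g V2"
abbreviation "V4 \<equiv> g V3"

lemma V_chain: "V1 \<subseteq> V" "V2 \<subseteq> V1" "V3 \<subseteq> V2" "V4 \<subseteq> V3"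
proof -
  show 1: "V1 \<subseteq> V" using g_subset[OF V] endoD(7)[OF endo_A] by blast
  show 2: "V2 \<subseteq> V1" using g_mono[OF 1] .
  show 3: "V3 \<subseteq> V2" using g_mono[OF 2] .
  show 4: "V4 \<subseteq> V3" using g_mono[OF 3] .
qed

lemma subspace_zero: "subspace {0}"
  by (simp add: subspace_def)

lemma eq_zero_if_subset_g:
  assumes "subspace U" "U \<subseteq> V" "g U \<subseteq> U" "U \<subseteq> g U"
  shows "U \<subseteq> {0}"
proof (rule nakayama[OF assms(1-3) subspace_zero])
  show "{0} \<subseteq> U" using subspace_0[OF assms(1)] by simp
  show "g {0} \<subseteq> {0}" by (rule g_subset[OF subspace_zero]) (simp add: endoD[OF endo_A])
  show "U \<subseteq> span ({0} \<union> g U)" using assms(4) span_superset by fastforce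
qed

lemma Z_in_V2:
  assumes "v \<in> V" shows "Z c v \<in> V2"
  unfolding Z_def
proof (rule subspace_sum[OF subspace_g])
  fix p assume p: "p \<in> pairs r"
  have "C i j v \<in> V2" if "i < r" "j < r" for i j
    unfolding C_def using that assms by (intro subspace_diff[OF subspace_g] A_in_g)
  then show "scale (c p) (C (fst p) (snd p) v) \<in> V2"
    using pairs_lt[OF p] by (intro subspace_scale[OF subspace_g]) auto
qed

lemma V2_nonzero: "\<not> V2 \<subseteq> {0}"
proof
  assume 0: "V2 \<subseteq> {0}"
  obtain v i j where v: "v \<in> V" "i < r" "j < r" "C i j v \<noteq> 0" using C_nonzero by blast
  have "C i j v \<in> V2"
    unfolding C_def using v by (intro subspace_diff[OF subspace_g] A_in_g)
  then show False using 0 v by blast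
qed

text \<open>The kernel of \<open>Z c\<close> is stable under the operators, since \<open>Z c\<close>
  commutes with them, and it spans \<open>V\<close> together with \<open>V1\<close>; by
  \<open>nakayama\<close> it is all of \<open>V\<close>.\<close>

lemma Z_eq_0_if_zero_on_generators:
  assumes "span E = V" "V1 = span E1" "E1 \<subseteq> E" "\<And>v. v \<in> E - E1 \<Longrightarrow> Z c v = 0"
  shows "\<forall>p\<in>pairs r. c p = 0"
proof (rule independent_C)
  define W where "W = {v \<in> V. Z c v = 0}"
  have "V \<subseteq> W"
  proof (rule nakayama)
    show "subspace W" unfolding W_def using V by (auto simp: subspace_def endoD[OF endo_Z])
    show "g W \<subseteq> W"
      by (rule g_subset[OF \<open>subspace W\<close>])
        (auto simp: W_def endoD(7)[OF endo_A] endoD(3)[OF endo_A] simp flip: A_Z)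
    have "E \<subseteq> W \<union> V1" using assms span_superset unfolding W_def by blast
    then show "V \<subseteq> span (W \<union> V1)" using span_mono assms(1) by blast
  qed (use V V_chain in \<open>auto simp: W_def\<close>)
  then show "(\<Sum>p\<in>pairs r. scale (c p) (C (fst p) (snd p) v)) = 0" if "v \<in> V" for v
    using that by (auto simp: W_def Z_def)
qed

end

text \<open>Differences such as \<open>E0 - E1\<close> represent bases of the successive quotients.
  The chain goes down to \<open>V4\<close> because centrality is compared modulo
  \<open>V4\<close>.\<close>

locale adapted_basis = faithful_nilpotent_operators +
  fixes E0 E1 E2 E3 E4
  assumes E_chain: "E4 \<subseteq> E3" "E3 \<subseteq> E2" "E2 \<subseteq> E1" "E1 \<subseteq> E0"
    and ind_E: "independent E0" and fin_E: "finite E0"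
    and span_E: "span E0 = V" "span E1 = V1" "span E2 = V2" "span E3 = V3" "span E4 = V4"
begin

abbreviation "rep v b \<equiv> representation E0 v b"

lemma fin_Ei: "finite E1" "finite E2" "finite E3" "finite E4"
  by (rule finite_subset[OF _ fin_E], use E_chain in blast)+

lemma in_span_iff:
  assumes "v \<in> V" "D \<subseteq> E0"
  shows "v \<in> span D \<longleftrightarrow> (\<forall>b\<in>E0 - D. rep v b = 0)"
proof
  assume "v \<in> span D"
  then have "representation E0 v = representation D v"
    using representation_extend[OF ind_E] assms by blast
  then show "\<forall>b\<in>E0 - D. rep v b = 0" using representation_ne_zero by fastforce
next
  assume 0: "\<forall>b\<in>E0 - D. rep v b = 0"
  have "v = (\<Sum>b\<in>E0. scale (rep v b) b)"
    using sum_representation_eq[OF ind_E] assms fin_E span_E by simp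
  also have "\<dots> = (\<Sum>b\<in>D. scale (rep v b) b)"
    using fin_E assms 0 by (intro sum.mono_neutral_right) auto
  also have "\<dots> \<in> span D" by (intro span_sum span_scale span_base)
  finally show "v \<in> span D" .
qed

lemma rep_lin:
  "x \<in> V \<Longrightarrow> y \<in> V \<Longrightarrow> rep (x + y) b = rep x b + rep y b"
  "x \<in> V \<Longrightarrow> y \<in> V \<Longrightarrow> rep (x - y) b = rep x b - rep y b"
  "x \<in> V \<Longrightarrow> rep (scale c x) b = c * rep x b"
  "(\<And>i. i \<in> I \<Longrightarrow> f i \<in> V) \<Longrightarrow> rep (\<Sum>i\<in>I. f i) b = (\<Sum>i\<in>I. rep (f i) b)"
  using ind_E span_E
  by (simp_all add: representation_add representation_diff representation_scale representation_sum)

lemma rep_basis: "b \<in> E0 \<Longrightarrow> rep b c = (if c = b then 1 else 0)"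
  using representation_basis[OF ind_E] by simp

lemma sub: "V4 \<subseteq> V" "V3 \<subseteq> V" "V2 \<subseteq> V" "V1 \<subseteq> V"
  using V_chain by blast+

lemma AV: "i < r \<Longrightarrow> v \<in> V \<Longrightarrow> A i v \<in> V"
  by (rule endoD(7)[OF endo_A])

lemma CV: "i < r \<Longrightarrow> j < r \<Longrightarrow> v \<in> V \<Longrightarrow> C i j v \<in> V"
  by (rule endoD(7)[OF endo_C])

text \<open>Each equation in \<open>Es\<close> is the vanishing of one coordinate of \<open>Z c\<close> at one vector.\<close>

lemma m_le_card_equations:
  assumes "finite Es" "\<And>v b. (v, b) \<in> Es \<Longrightarrow> v \<in> V"
    and "\<And>c. (\<And>v b. (v, b) \<in> Es \<Longrightarrow> rep (Z c v) b = 0) \<Longrightarrow> \<forall>v\<in>E0 - E1. Z c v = 0"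
  shows "m \<le> card Es"
proof (rule card_le_if_system_trivial[of Es "pairs r" "\<lambda>e p. rep (C (fst p) (snd p) (fst e)) (snd e)"])
  fix c assume 0: "\<forall>e\<in>Es. (\<Sum>p\<in>pairs r. rep (C (fst p) (snd p) (fst e)) (snd e) * c p) = 0"
  have "rep (Z c v) b = (\<Sum>p\<in>pairs r. rep (C (fst p) (snd p) v) b * c p)" if "v \<in> V" for v b
    unfolding Z_def using that CV pairs_lt
    by (subst rep_lin(4)) (auto simp: rep_lin(3) mult.commute intro!: subspace_scale[OF V] sum.cong)
  then have "rep (Z c v) b = 0" if "(v, b) \<in> Es" for v b using 0 assms(2) that by fastforce
  then show "\<forall>p\<in>pairs r. c p = 0"
    using Z_eq_0_if_zero_on_generators[of E0 E1] assms(3) span_E E_chain by metis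
qed (use assms in auto)

lemma eq_0_if_rep_0: "v \<in> V \<Longrightarrow> (\<And>b. b \<in> E0 \<Longrightarrow> rep v b = 0) \<Longrightarrow> v = 0"
  using in_span_iff[of v "{}"] by simp

lemma m_le_generators_times_V2: "m \<le> card (E0 - E1) * card E2"
proof -
  have "m \<le> card ((E0 - E1) \<times> E2)"
  proof (rule m_le_card_equations)
    fix c assume 0: "\<And>v b. (v, b) \<in> (E0 - E1) \<times> E2 \<Longrightarrow> rep (Z c v) b = 0"
    have "Z c v = 0" if v: "v \<in> E0 - E1" for v
    proof (rule eq_0_if_rep_0)
      have vV: "v \<in> V" using v span_E span_superset by blast
      then show "Z c v \<in> V" by (rule endoD(7)[OF endo_Z])
      show "rep (Z c v) b = 0" if "b \<in> E0" for b
        using in_span_iff[OF \<open>Z c v \<in> V\<close>, of E2] Z_in_V2[OF vV] E_chain span_E 0 v that by blast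
    qed
    then show "\<forall>v\<in>E0 - E1. Z c v = 0" by blast
  qed (use fin_E fin_Ei span_E(1) in \<open>auto intro: span_base\<close>)
  then show ?thesis by (simp add: card_cartesian_product)
qed

end

section \<open>The case of a one-dimensional quotient V1/V2\<close>

locale one_dim_middle = adapted_basis +
  fixes u assumes u: "E1 - E2 = {u}"
begin

text \<open>The linear form by which the operators send \<open>v\<close> into V1/V2:
  \<open>A i v\<close> is \<beta> v i times \<open>u\<close> modulo \<open>V2\<close>.\<close>

definition \<beta> where "\<beta> v i = rep (A i v) u"

lemma uE: "u \<in> E0" "u \<in> V" "u \<in> V1" "u \<notin> E2" "u \<in> E1"
proof -
  show 1: "u \<in> E1" "u \<notin> E2" using u by blast+
  then show "u \<in> E0" using E_chain by blast
  show "u \<in> V1" using 1 span_base span_E(2) by blast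
  then show "u \<in> V" using sub by blast
qed

lemma E0_V: "v \<in> E0 \<Longrightarrow> v \<in> V"
  using span_E(1) span_base by blast

lemma E_sub: "E1 \<subseteq> E0" "E2 \<subseteq> E0" "E3 \<subseteq> E0" "E4 \<subseteq> E0"
  using E_chain by blast+

lemma V2_I: "x \<in> V \<Longrightarrow> (\<And>b. b \<in> E0 - E2 \<Longrightarrow> rep x b = 0) \<Longrightarrow> x \<in> V2"
  and V4_I: "x \<in> V \<Longrightarrow> (\<And>b. b \<in> E0 - E4 \<Longrightarrow> rep x b = 0) \<Longrightarrow> x \<in> V4"
  using in_span_iff[of x E2] in_span_iff[of x E4] E_sub span_E(3,5) by simp_all

lemma V1_D: "x \<in> V1 \<Longrightarrow> b \<in> E0 - E1 \<Longrightarrow> rep x b = 0"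
  and V2_D: "x \<in> V2 \<Longrightarrow> b \<in> E0 - E2 \<Longrightarrow> rep x b = 0"
  and V3_D: "x \<in> V3 \<Longrightarrow> b \<in> E0 - E3 \<Longrightarrow> rep x b = 0"
  and V4_D: "x \<in> V4 \<Longrightarrow> b \<in> E0 - E4 \<Longrightarrow> rep x b = 0"
  using in_span_iff[of x E1] in_span_iff[of x E2] in_span_iff[of x E3] in_span_iff[of x E4]
    E_sub span_E sub[THEN subsetD, of x] by simp_all

lemma V_sub: "x \<in> V \<Longrightarrow> y \<in> V \<Longrightarrow> x - y \<in> V" "x \<in> V \<Longrightarrow> y \<in> V \<Longrightarrow> x + y \<in> V" "x \<in> V \<Longrightarrow> scale c x \<in> V"
  using subspace_diff[OF V] subspace_add[OF V] subspace_scale[OF V] by blast+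

lemma A_mod:
  assumes i: "i < r" and v: "v \<in> V"
  shows "A i v - scale (\<beta> v i) u \<in> V2"
proof -
  have a: "A i v \<in> V1" "A i v \<in> V" using A_in_g[OF i v] AV[OF i v] .
  show ?thesis
  proof (rule V2_I)
    show "A i v - scale (\<beta> v i) u \<in> V" using a uE V_sub by simp
    fix b assume b: "b \<in> E0 - E2"
    show "rep (A i v - scale (\<beta> v i) u) b = 0"
  proof (cases "b = u")
    case True
    then show ?thesis using a uE by (simp add: rep_lin V_sub rep_basis \<beta>_def)
  next
    case False
    then have "b \<in> E0 - E1" using b u by blast
    then have "rep (A i v) b = 0" using V1_D a by blast
    then show ?thesis using a uE False by (simp add: rep_lin V_sub rep_basis)
  qed
  qed
qed

lemma C_mod:
  assumes i: "i < r" and j: "j < r" and v: "v \<in> V"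
  shows "C i j v - (scale (\<beta> v j) (A i u) - scale (\<beta> v i) (A j u)) \<in> V3"
proof -
  have "C i j v - (scale (\<beta> v j) (A i u) - scale (\<beta> v i) (A j u)) =
      A i (A j v - scale (\<beta> v j) u) - A j (A i v - scale (\<beta> v i) u)"
    by (simp add: C_def endoD(2,5)[OF endo_A[OF i]] endoD(2,5)[OF endo_A[OF j]])
  then show ?thesis using i j v by (simp add: subspace_diff[OF subspace_g] A_in_g A_mod)
qed

lemma C_V2: "i < r \<Longrightarrow> j < r \<Longrightarrow> v \<in> V2 \<Longrightarrow> C i j v \<in> V4"
  by (simp add: C_def subspace_diff[OF subspace_g] A_in_g)

text \<open>Compares the two sides of \<open>A\<^sub>l [A\<^sub>i, A\<^sub>j] v = [A\<^sub>i, A\<^sub>j] A\<^sub>l v\<close> modulo \<open>V4\<close>.\<close>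

lemma centrality_relation:
  assumes i: "i < r" and j: "j < r" and l: "l < r" and v: "v \<in> V" and b: "b \<in> E0 - E4"
  defines "t \<equiv> \<lambda>i j. rep (A i (A j u)) b"
  shows "\<beta> v l * (t i j - t j i) = \<beta> v j * t l i - \<beta> v i * t l j"
proof -
  have van: "rep x b = 0" if "x \<in> V4" for x
    using V4_D[OF that b] .
  define y where "y = C i j v - (scale (\<beta> v j) (A i u) - scale (\<beta> v i) (A j u))"
  define x where "x = A l v - scale (\<beta> v l) u"
  have y: "y \<in> V3" and x: "x \<in> V2" unfolding y_def x_def using C_mod A_mod i j l v by auto
  have xV: "x \<in> V" and yV: "y \<in> V" using x y sub by auto
  have "A l (C i j v) = A l (scale (\<beta> v j) (A i u) - scale (\<beta> v i) (A j u)) + A l y"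
    by (simp add: y_def flip: endoD(1)[OF endo_A[OF l]])
  then have 1: "rep (A l (C i j v)) b = \<beta> v j * t l i - \<beta> v i * t l j"
    using van[OF A_in_g[OF l y]] i j l uE yV
    by (simp add: endoD(2,5)[OF endo_A[OF l]] rep_lin V_sub AV t_def)
  have "C i j (A l v) = scale (\<beta> v l) (C i j u) + C i j x"
    by (simp add: x_def endoD(2,5)[OF endo_C[OF i j]])
  then have "rep (C i j (A l v)) b = \<beta> v l * (t i j - t j i)"
    using van[OF C_V2[OF i j x]] i j l uE xV
    by (simp add: rep_lin V_sub CV) (simp add: C_def rep_lin AV t_def)
  then show ?thesis using 1 A_C[OF i j l v] by simp
qed

lemma V2_spanned: "V2 \<subseteq> span ((\<lambda>i. A i u) ` {..<r} \<union> V3)"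
proof (rule g_subset)
  fix i x assume i: "i < r" and x: "x \<in> V1"
  have "x \<in> span (insert u E2)" using x span_E(2) u E_chain by (metis Diff_partition insert_is_Un sup_commute)
  then obtain k where "x - scale k u \<in> V2" using span_breakdown_eq span_E(3) by blast
  then have "A i (x - scale k u) \<in> V3" using A_in_g[OF i] by blast
  then have "scale k (A i u) + A i (x - scale k u) \<in> span ((\<lambda>i. A i u) ` {..<r} \<union> V3)"
    using i by (intro span_add span_scale span_base) auto
  then show "A i x \<in> span ((\<lambda>i. A i u) ` {..<r} \<union> V3)"
    by (simp add: endoD(2,5)[OF endo_A[OF i]])
qed simp

text \<open>\<open>V2\<close> is spanned by the vectors \<open>A i u\<close> and \<open>V3\<close>,
  so the hypothesis puts \<open>V3\<close> = \<open>g V2\<close> into \<open>V4\<close> =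
  \<open>g V3\<close>, and Nakayama applies.\<close>

lemma V3_zero:
  assumes "\<And>i l b. \<lbrakk>i < r; l < r; b \<in> E0 - E4\<rbrakk> \<Longrightarrow> rep (A l (A i u)) b = 0"
  shows "V3 \<subseteq> {0}"
proof (rule eq_zero_if_subset_g)
  have 1: "A l (A i u) \<in> V4" if "i < r" "l < r" for i l
    using that assms uE by (intro V4_I AV)
  show "V3 \<subseteq> V4"
  proof (rule g_subset[OF subspace_g])
    fix l x assume l: "l < r" and x: "x \<in> V2"
    have "x \<in> span ((\<lambda>i. A i u) ` {..<r} \<union> V3)" using x V2_spanned by blast
    then show "A l x \<in> V4"
    proof (induction rule: span_induct_alt)
      case base
      show ?case using endoD(3)[OF endo_A[OF l]] subspace_0[OF subspace_g] by simp
    next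
      case (step c x y)
      then show ?case using 1 l A_in_g[OF l, of _ V3]
        by (auto simp: endoD(1,2)[OF endo_A[OF l]] intro!: subspace_add[OF subspace_g] subspace_scale[OF subspace_g])
    qed
  qed
qed (use sub V_chain subspace_g in auto)

lemma E3_empty: "V3 \<subseteq> {0} \<Longrightarrow> E3 = {}"
proof (rule ccontr)
  assume 0: "V3 \<subseteq> {0}" "E3 \<noteq> {}"
  then obtain x where "x \<in> E3" by blast
  then have "x = 0" using 0 span_E(4) span_base by blast
  then show False using \<open>x \<in> E3\<close> ind_E E_chain dependent_zero by blast
qed

text \<open>The minor says that x wedge y is a nonzero bivector, and the sums say that it acts by
  zero on a complement of \<open>V1\<close>.\<close>

lemma contradiction_if_commuting:
  assumes pq: "p < r" "q < r" "x p * y q - x q * y p \<noteq> (0::'a)"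
    and 0: "\<And>v. v \<in> E0 - E1 \<Longrightarrow> (\<Sum>i<r. \<Sum>j<r. scale (x i * y j) (C i j v)) = 0"
  shows False
proof -
  let ?c = "\<lambda>(i, j). x i * y j - x j * y i"
  have z: "\<forall>p\<in>pairs r. ?c p = 0"
    using Z_eq_0_if_zero_on_generators[of E0 E1 ?c] span_E E_chain 0 by (simp add: Z_decomposable)
  have "p < q \<or> q < p" using pq(3) by (metis diff_self linorder_neqE_nat mult.commute)
  then have "(p, q) \<in> pairs r \<or> (q, p) \<in> pairs r" using pq by (auto simp: pairs_def)
  then have "x p * y q - x q * y p = 0 \<or> x q * y p - x p * y q = 0" using z by fastforce
  then show False using pq(3) by auto
qed

text \<open>Now \<open>C_mod\<close> is an equality: writing A_x = \<Sum> x_i A_i, [A_x, A_y] v =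
  \<beta>_v(y) A_x u - \<beta>_v(x) A_y u. If V/V1 had dimension at most r - 2, independent x, y
  would be killed by all forms \<beta>_v; if \<open>V2\<close> had, independent x, y would satisfy
  A_x u = A_y u = 0. Either way A_x and A_y would commute. The two bounds add up to dim V \<ge> 2 r
  - 1.\<close>

lemma bound_if_V3_zero:
  assumes "V3 \<subseteq> {0}"
  shows "r \<le> card (E0 - E1) + 1" "r \<le> card E2 + 1"
proof -
  have C: "C i j v = scale (\<beta> v j) (A i u) - scale (\<beta> v i) (A j u)" if "i < r" "j < r" "v \<in> V" for i j v
    using C_mod[OF that] assms by auto
  have C2: "(\<Sum>i<r. \<Sum>j<r. scale (x i * y j) (C i j v)) =
      scale (\<Sum>j<r. \<beta> v j * y j) (\<Sum>i<r. scale (x i) (A i u)) -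
      scale (\<Sum>i<r. \<beta> v i * x i) (\<Sum>j<r. scale (y j) (A j u))" if v: "v \<in> V" for x y v
  proof -
    have "(\<Sum>i<r. \<Sum>j<r. scale (x i * y j) (C i j v)) =
      (\<Sum>i<r. \<Sum>j<r. scale (\<beta> v j * y j) (scale (x i) (A i u))) -
      (\<Sum>i<r. \<Sum>j<r. scale (\<beta> v i * x i) (scale (y j) (A j u)))"
      unfolding sum_subtractf[symmetric]
      by (intro sum.cong refl) (simp add: C v scale_right_diff_distrib ac_simps)
    also have "(\<Sum>i<r. \<Sum>j<r. scale (\<beta> v j * y j) (scale (x i) (A i u))) =
        scale (\<Sum>j<r. \<beta> v j * y j) (\<Sum>i<r. scale (x i) (A i u))"
      by (simp only: scale_sum_left scale_sum_right)
    also have "(\<Sum>i<r. \<Sum>j<r. scale (\<beta> v i * x i) (scale (y j) (A j u))) =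
        scale (\<Sum>i<r. \<beta> v i * x i) (\<Sum>j<r. scale (y j) (A j u))"
      by (subst sum.swap) (simp only: scale_sum_left scale_sum_right)
    finally show ?thesis .
  qed
  show "r \<le> card (E0 - E1) + 1"
  proof (rule ccontr)
    assume "\<not> ?thesis"
    then have c: "card (E0 - E1) + 2 \<le> r" by simp
    obtain x y p q where pq: "p < r" "q < r" "x p * y q - x q * y p \<noteq> 0"
      and 0: "\<And>v. v \<in> E0 - E1 \<Longrightarrow> (\<Sum>i<r. \<beta> v i * x i) = 0" "\<And>v. v \<in> E0 - E1 \<Longrightarrow> (\<Sum>i<r. \<beta> v i * y i) = 0"
      using two_independent_solutions[OF finite_Diff[OF fin_E] c, of \<beta>]
      by (elim exE conjE) (rule that, auto)
    show False
      by (rule contradiction_if_commuting[OF pq]) (use 0 C2 E0_V in simp)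
  qed
  show "r \<le> card E2 + 1"
  proof (rule ccontr)
    assume "\<not> ?thesis"
    then have c: "card E2 + 2 \<le> r" by simp
    obtain x y p q where pq: "p < r" "q < r" "x p * y q - x q * y p \<noteq> 0"
      and 0: "\<And>b. b \<in> E2 \<Longrightarrow> (\<Sum>i<r. rep (A i u) b * x i) = 0"
        "\<And>b. b \<in> E2 \<Longrightarrow> (\<Sum>i<r. rep (A i u) b * y i) = 0"
      using two_independent_solutions[OF fin_Ei(2) c, of "\<lambda>b i. rep (A i u) b"]
      by (elim exE conjE) (rule that, auto)
    have z: "(\<Sum>i<r. scale (x i) (A i u)) = 0"
      if 0: "\<And>b. b \<in> E2 \<Longrightarrow> (\<Sum>i<r. rep (A i u) b * x i) = 0" for x
    proof (rule eq_0_if_rep_0)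
      have 1: "(\<Sum>i<r. scale (x i) (A i u)) \<in> V2"
        by (intro subspace_sum[OF subspace_g] subspace_scale[OF subspace_g] A_in_g uE) simp
      then show 2: "(\<Sum>i<r. scale (x i) (A i u)) \<in> V" using sub by blast
      fix b assume b: "b \<in> E0"
      show "rep (\<Sum>i<r. scale (x i) (A i u)) b = 0"
      proof (cases "b \<in> E2")
        case True
        have "rep (\<Sum>i<r. scale (x i) (A i u)) b = (\<Sum>i<r. rep (A i u) b * x i)"
          using uE by (subst rep_lin(4)) (auto simp: rep_lin V_sub AV mult.commute)
        then show ?thesis using 0[OF True] by simp
      next
        case False
        then show ?thesis using V2_D[OF 1] b by blast
      qed
    qed
    show False
      by (rule contradiction_if_commuting[OF pq]) (simp add: C2 E0_V z[OF 0(1)] z[OF 0(2)])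
  qed
qed

end

context one_dim_middle
begin

lemma beta_nonzero: "\<exists>v\<in>E0 - E1. \<exists>i<r. \<beta> v i \<noteq> 0"
proof (rule ccontr)
  assume n: "\<not> ?thesis"
  have AE: "A i v \<in> V2" if "i < r" "v \<in> E0" for i v
  proof (cases "v \<in> E1")
    case True
    then show ?thesis using A_in_g[OF that(1)] span_base span_E(2) by blast
  next
    case False
    then show ?thesis using A_mod[OF that(1) E0_V[OF that(2)]] n that by simp
  qed
  have "V1 \<subseteq> V2"
  proof (rule g_subset[OF subspace_g])
    fix i x assume i: "i < r" and "x \<in> V"
    then have "x \<in> span E0" using span_E(1) by simp
    then show "A i x \<in> V2"
    proof (induction rule: span_induct_alt)
      case (step c x y)
      have "scale c (A i x) + A i y \<in> V2"
        using step AE[OF i] by (intro subspace_add subspace_scale subspace_g) auto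
      then show ?case by (simp add: endoD[OF endo_A[OF i]])
    qed (simp add: endoD[OF endo_A[OF i]] subspace_0[OF subspace_g])
  qed
  then have "u \<in> span E2" using uE span_E(3) by blast
  then show False using V2_D[of u u] uE by (simp add: span_E rep_basis)
qed

text \<open>Subtracting multiples of \<open>v1\<close> from the other generators removes their forms
  \<beta>. The operators then send these generators into \<open>V2\<close> and the bivectors send
  them into \<open>V3\<close>, so each costs only dim V3 equations; \<open>D\<close> carries the
  equations at \<open>v1\<close>.\<close>

lemma dim_V3_bound:
  assumes v1: "v1 \<in> E0 - E1" and dep: "\<And>v. v \<in> E0 - E1 \<Longrightarrow> \<exists>c. \<forall>i<r. \<beta> v i = c * \<beta> v1 i"
    and D: "D \<subseteq> E0" "\<And>c. Z c v1 \<in> span D"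
  shows "m \<le> card D + (card (E0 - E1) - 1) * card E3"
proof -
  obtain l where l: "\<And>v i. v \<in> E0 - E1 \<Longrightarrow> i < r \<Longrightarrow> \<beta> v i = l v * \<beta> v1 i" using dep by metis
  let ?F = "(\<lambda>(v, b). (v - scale (l v) v1, b)) ` ((E0 - E1 - {v1}) \<times> E3)"
  let ?Es = "{v1} \<times> D \<union> ?F"
  have Z3: "Z c (v - scale (l v) v1) \<in> V3" if v: "v \<in> E0 - E1" for c v
    unfolding Z_def
  proof (rule subspace_sum[OF subspace_g])
    fix p assume p: "p \<in> pairs r"
    have vV: "v \<in> V" "v1 \<in> V" using v v1 E0_V by auto
    then have A2: "A i (v - scale (l v) v1) \<in> V2" if "i < r" for i
    proof -
      have "A i (v - scale (l v) v1) = (A i v - scale (\<beta> v i) u) - scale (l v) (A i v1 - scale (\<beta> v1 i) u)"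
        by (simp add: endoD[OF endo_A[OF that]] l[OF v that] scale_right_diff_distrib)
      then show ?thesis
        using A_mod[OF that] vV by (auto intro: subspace_diff subspace_scale subspace_g)
    qed
    have "C (fst p) (snd p) (v - scale (l v) v1) \<in> V3"
      unfolding C_def using pairs_lt[OF p] A2 A_in_g[of _ _ V2] by (intro subspace_diff[OF subspace_g]) auto
    then show "scale (c p) (C (fst p) (snd p) (v - scale (l v) v1)) \<in> V3"
      by (rule subspace_scale[OF subspace_g])
  qed
  have "m \<le> card ?Es"
  proof (rule m_le_card_equations)
    show "finite ?Es" using fin_E fin_Ei D(1) finite_subset by blast
    show "v \<in> V" if "(v, b) \<in> ?Es" for v b using that v1 E0_V V_sub by auto
    fix c assume 0: "\<And>v b. (v, b) \<in> ?Es \<Longrightarrow> rep (Z c v) b = 0"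
    have z1: "Z c v1 = 0"
    proof (rule eq_0_if_rep_0)
      show 1: "Z c v1 \<in> V" using endoD(7)[OF endo_Z] v1 E0_V by blast
      show "rep (Z c v1) b = 0" if "b \<in> E0" for b
        using 0[of v1 b] in_span_iff[OF 1 D(1)] D(2) that by blast
    qed
    have "Z c v = 0" if v: "v \<in> E0 - E1" for v
    proof (cases "v = v1")
      case False
      have "Z c (v - scale (l v) v1) = 0"
      proof (rule eq_0_if_rep_0)
        show 1: "Z c (v - scale (l v) v1) \<in> V"
          using Z3[OF v] sub by blast
        show "rep (Z c (v - scale (l v) v1)) b = 0" if "b \<in> E0" for b
        proof (cases "b \<in> E3")
          case True
          then show ?thesis using v False by (intro 0) force
        next
          case f: False
          then show ?thesis using V3_D[OF Z3[OF v]] that by blast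
        qed
      qed
      then show ?thesis by (simp add: endoD[OF endo_Z] z1)
    qed (use z1 in simp)
    then show "\<forall>v\<in>E0 - E1. Z c v = 0" by blast
  qed
  also have "\<dots> \<le> card ({v1} \<times> D) + card ?F" by (rule card_Un_le)
  also have "card ?F \<le> card ((E0 - E1 - {v1}) \<times> E3)"
    using fin_E fin_Ei by (intro card_image_le) auto
  also have "\<dots> = (card (E0 - E1) - 1) * card E3" using v1 by (simp add: card_cartesian_product)
  finally show ?thesis by (simp add: card_cartesian_product)
qed

text \<open>Modulo \<open>V3\<close>, \<open>A i u\<close> is a i times \<open>w\<close>, so in the
  coordinate \<open>b\<close> the vector A_l A_i u has the entry a i * h l. Centrality gives h l *
  \<Delta> = \<beta> v l * G, where \<Delta> is the nonzero minor of a and \<beta> v. Inserting this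
  into G yields G \<Delta> = - G \<Delta>, so G and h vanish.\<close>

lemma V3_zero_if_dim_1:
  assumes v: "v \<in> V" and w: "E2 - E3 = {w}"
    and pq: "p < r" "q < r" "rep (A p u) w * \<beta> v q - rep (A q u) w * \<beta> v p \<noteq> 0"
  shows "V3 \<subseteq> {0}"
proof (rule V3_zero)
  define a where "a i = rep (A i u) w" for i
  have wE: "w \<in> E2" "w \<in> E0" "w \<in> V" using w E_sub E0_V by auto
  have Aw: "A i u - scale (a i) w \<in> V3" if i: "i < r" for i
  proof -
    have 1: "A i u \<in> V2" "A i u \<in> V" using A_in_g[OF i] uE AV i by auto
    have 2: "A i u - scale (a i) w \<in> V" using 1 wE V_sub by simp
    have "rep (A i u - scale (a i) w) b = 0" if b: "b \<in> E0 - E3" for b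
    proof (cases "b = w")
      case True
      then show ?thesis using 1 wE by (simp add: rep_lin V_sub rep_basis a_def)
    next
      case False
      then have "b \<in> E0 - E2" using b w by blast
      then have "rep (A i u) b = 0" using V2_D 1 by blast
      then show ?thesis using 1 wE False by (simp add: rep_lin V_sub rep_basis)
    qed
    then show ?thesis using in_span_iff[OF 2 E_sub(3)] span_E(4) by simp
  qed
  fix i l b assume i: "i < r" and l: "l < r" and b: "b \<in> E0 - E4"
  define h where "h l = rep (A l w) b" for l
  have t: "rep (A l (A i u)) b = a i * h l" if i: "i < r" and l: "l < r" for i l
  proof -
    have x: "A i u - scale (a i) w \<in> V3" "A i u - scale (a i) w \<in> V" using Aw[OF i] sub by auto
    have "A l (A i u) = A l (A i u - scale (a i) w) + scale (a i) (A l w)"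
      by (simp add: endoD[OF endo_A[OF l]])
    moreover have "rep (A l (A i u - scale (a i) w)) b = 0"
      using V4_D[OF A_in_g[OF l x(1)] b] .
    ultimately show ?thesis using l wE x by (simp add: rep_lin V_sub AV h_def)
  qed
  have rel: "\<beta> v l * (a j * h i - a i * h j) = h l * (\<beta> v j * a i - \<beta> v i * a j)"
    if "i < r" "j < r" "l < r" for i j l
    using centrality_relation[OF that v b] that by (simp add: t algebra_simps)
  define G where "G = a q * h p - a p * h q"
  define \<Delta> where "\<Delta> = a p * \<beta> v q - a q * \<beta> v p"
  have \<Delta>: "\<Delta> \<noteq> 0" using pq(3) by (simp add: \<Delta>_def a_def)
  have hG: "h l * \<Delta> = \<beta> v l * G" if "l < r" for l
    using rel[OF pq(1,2) that] by (simp add: G_def \<Delta>_def algebra_simps)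
  have "G * \<Delta> = a q * (h p * \<Delta>) - a p * (h q * \<Delta>)" by (simp add: G_def algebra_simps)
  also have "\<dots> = - (G * \<Delta>)" using hG pq by (simp add: \<Delta>_def algebra_simps)
  finally have "G = 0" using \<Delta> by (simp add: eq_neg_iff_add_eq_0)
  then have "h l = 0" using hG[OF l] \<Delta> by simp
  then show "rep (A l (A i u)) b = 0" using t[OF i l] by simp
qed

text \<open>By \<open>C_mod\<close>, the coordinate of \<open>C i j v\<close> at \<open>w\<close> is
  a minor of the two proportional forms.\<close>

lemma Z_in_V3_if_proportional:
  assumes v: "v \<in> V" and w: "E2 - E3 = {w}"
    and par: "\<And>i j. i < r \<Longrightarrow> j < r \<Longrightarrow> rep (A i u) w * \<beta> v j - rep (A j u) w * \<beta> v i = 0"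
  shows "Z c v \<in> span E3"
proof -
  have zV: "Z c v \<in> V" using endoD(7)[OF endo_Z] v by blast
  have "rep (Z c v) b = 0" if b: "b \<in> E0 - E3" for b
  proof (cases "b = w")
    case False
    then have "b \<in> E0 - E2" using b w by blast
    then show ?thesis using V2_D Z_in_V2[OF v] by blast
  next
    case True
    have "rep (C i j v) w = 0" if "i < r" "j < r" for i j
    proof -
      define y where "y = C i j v - (scale (\<beta> v j) (A i u) - scale (\<beta> v i) (A j u))"
      have y: "y \<in> V3" "y \<in> V" unfolding y_def using C_mod that v sub by auto
      have "C i j v = (scale (\<beta> v j) (A i u) - scale (\<beta> v i) (A j u)) + y" by (simp add: y_def)
      then have "rep (C i j v) w = \<beta> v j * rep (A i u) w - \<beta> v i * rep (A j u) w"
        using V3_D[OF y(1), of w] y w b True that uE by (simp add: rep_lin V_sub AV)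
      then show ?thesis using par[OF that] by (simp add: mult.commute)
    qed
    then show ?thesis unfolding Z_def True using v CV pairs_lt
      by (subst rep_lin(4)) (auto simp: rep_lin(3) V_sub)
  qed
  then show ?thesis using in_span_iff[OF zV E_sub(3)] by blast
qed

lemma dims: "card E0 = card (E0 - E1) + 1 + card (E2 - E3) + card E3" "card E2 = card (E2 - E3) + card E3"
proof -
  have "card E0 = card (E0 - E1) + card E1" "card E1 = card (E1 - E2) + card E2"
    "card E2 = card (E2 - E3) + card E3"
    using fin_E fin_Ei E_chain by (metis card_Diff_subset card_mono le_add_diff_inverse2)+
  then show "card E0 = card (E0 - E1) + 1 + card (E2 - E3) + card E3" "card E2 = card (E2 - E3) + card E3"
    using u by auto
qed

end

section \<open>The case distinction for the dimension bound\<close>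

context adapted_basis
begin

lemma square_bound:
  assumes "m \<le> k * l" "k + l + 2 \<le> n"
  shows "2 * r * (r - 1) \<le> (n - 2)\<^sup>2"
proof -
  have "2 * r * (r - 1) = 4 * m" using card_pairs[of r] by simp
  also have "\<dots> \<le> 4 * (k * l)" using assms by simp
  also have "\<dots> \<le> (k + l)\<^sup>2"
  proof -
    have "int (4 * (k * l)) \<le> int ((k + l)\<^sup>2)"
      using zero_le_power2[of "int k - int l"] by (simp add: power2_eq_square algebra_simps)
    then show ?thesis by (simp only: of_nat_le_iff)
  qed
  also have "\<dots> \<le> (n - 2)\<^sup>2" using assms by (intro power_mono) auto
  finally show ?thesis .
qed

text \<open>If V1/V2 has dimension one, then dim V = k + 1 + d + e with k, d, e the dimensions of
  V/V1, V2/V3, V3. Two independent forms \<beta> force V3 = 0 and the linear bound. If all forms are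
  proportional, m \<le> d + k e, which is sharp enough except for d = 1; there either V3 = 0 or the
  equations at \<open>v1\<close> shrink to those in \<open>V3\<close>.\<close>

lemma dimension_bound: "2 * r \<le> card E0 + 1 \<or> 2 * r * (r - 1) \<le> (card E0 - 2)\<^sup>2"
proof -
  have cards: "card E0 = card (E0 - E1) + (card (E1 - E2) + card E2)"
    using card_Diff_subset[of E1 E0] card_Diff_subset[of E2 E1] card_mono[of E0 E1] card_mono[of E1 E2]
      fin_E fin_Ei E_chain by simp
  consider "card (E1 - E2) = 0" | "card (E1 - E2) = 1" | "card (E1 - E2) \<ge> 2" by linarith
  then show ?thesis
  proof cases
    case 1
    then have "E1 \<subseteq> E2" using fin_Ei by simp
    then have "V1 \<subseteq> V2" using span_mono span_E by blast
    then have "V1 \<subseteq> {0}" using V_chain subspace_g by (intro eq_zero_if_subset_g) auto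
    then show ?thesis using V2_nonzero V_chain by blast
  next
    case 3
    then show ?thesis using square_bound[OF m_le_generators_times_V2] cards by simp
  next
    case 2
    then obtain u where "E1 - E2 = {u}" by (meson card_1_singletonE)
    then interpret one_dim_middle scale V r A E0 E1 E2 E3 E4 u by unfold_locales
    define k d e where "k = card (E0 - E1)" and "d = card (E2 - E3)" and "e = card E3"
    have n: "card E0 = k + 1 + d + e" "card E2 = d + e" using dims by (simp_all add: k_def d_def e_def)
    have m: "2 * m = r * (r - 1)" by (rule card_pairs)
    show ?thesis
    proof (cases "\<exists>v\<in>E0 - E1. \<exists>v'\<in>E0 - E1. \<exists>p<r. \<exists>q<r. \<beta> v p * \<beta> v' q - \<beta> v q * \<beta> v' p \<noteq> 0")
      case True
      then obtain v v' p q where v: "v \<in> V" "v' \<in> V"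
        and pq: "p < r" "q < r" "\<beta> v p * \<beta> v' q - \<beta> v q * \<beta> v' p \<noteq> 0" using E0_V by blast
      have "V3 \<subseteq> {0}"
      proof (rule V3_zero)
        fix i l b assume "i < r" "l < r" and b: "b \<in> E0 - E4"
        then show "rep (A l (A i u)) b = 0"
          using bilinear_relation_trivial[OF _ _ pq, of "\<lambda>i j. rep (A i (A j u)) b" l i]
            centrality_relation[OF _ _ _ v(1) b] centrality_relation[OF _ _ _ v(2) b] by blast
      qed
      then show ?thesis using bound_if_V3_zero n by (simp add: k_def)
    next
      case False
      obtain v1 i1 where v1: "v1 \<in> E0 - E1" and i1: "i1 < r" "\<beta> v1 i1 \<noteq> 0" using beta_nonzero by blast
      have dep: "\<exists>c. \<forall>i<r. \<beta> v i = c * \<beta> v1 i" if v: "v \<in> E0 - E1" for v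
      proof (intro exI allI impI)
        fix i assume "i < r"
        then have "\<beta> v i * \<beta> v1 i1 - \<beta> v i1 * \<beta> v1 i = 0" using False v v1 i1 by blast
        then show "\<beta> v i = \<beta> v i1 / \<beta> v1 i1 * \<beta> v1 i" using i1 by (simp add: field_simps)
      qed
      have v1V: "v1 \<in> V" using v1 E0_V by blast
      have k: "1 \<le> k" unfolding k_def using v1 fin_E by (simp add: Suc_le_eq card_gt_0_iff) blast
      have d: "1 \<le> d"
      proof (rule ccontr)
        assume "\<not> 1 \<le> d"
        then have "card (E2 - E3) = 0" by (simp add: d_def)
        then have "E2 - E3 = {}" using fin_Ei(2) by (metis card_0_eq finite_Diff)
        then have "V2 \<subseteq> V3" using span_mono[of E2 E3] span_E by simp
        then have "V2 \<subseteq> {0}" using V_chain sub subspace_g by (intro eq_zero_if_subset_g) auto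
        then show False using V2_nonzero by blast
      qed
      have "Z c v1 \<in> span E2" for c using Z_in_V2[OF v1V] span_E by simp
      then have "m \<le> card E2 + (k - 1) * e"
        using dim_V3_bound[OF v1 dep E_sub(2)] by (simp add: k_def e_def)
      then have m1: "m \<le> d + k * e" using k n by (cases k) simp_all
      \<comment> \<open>Equivalent to m \<ge> 2 r - 3; for k = 1 it meets m \<le> d + e = dim V -
        2.\<close>
      have sq: "(int r - 2) * (int r - 3) \<ge> 0"
        using r by (cases "r = 2") simp_all
      consider "k = 1" | "k \<ge> 2" "d \<ge> 2" | "d = 1" using k d by linarith
      then show ?thesis
      proof cases
        case 1
        have "int r * (int r - 1) = 2 * int m" using arg_cong[OF m, of int] r by (simp add: of_nat_diff)
        then have "4 * int r \<le> 2 * int m + 6" using sq by (simp add: algebra_simps)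
        then show ?thesis using m1 n 1 by simp
      next
        case 2
        \<comment> \<open>The difference of the two sides is (k - 1) (d - 1) - 1. This gains the
          second dimension that \<open>square_bound\<close> asks for.\<close>
        have "d + k * e \<le> k * (d + e - 1)"
        proof -
          obtain d' where d': "d = d' + 2" using 2 le_Suc_ex by (metis add.commute)
          obtain k' where k': "k = k' + 2" using 2 le_Suc_ex by (metis add.commute)
          show ?thesis by (simp add: d' k' algebra_simps)
        qed
        then show ?thesis using square_bound[of k "d + e - 1" "card E0"] m1 n 2 by simp
      next
        case 3
        then obtain w where w: "E2 - E3 = {w}" unfolding d_def by (meson card_1_singletonE)
        show ?thesis
        proof (cases "\<exists>p<r. \<exists>q<r. rep (A p u) w * \<beta> v1 q - rep (A q u) w * \<beta> v1 p \<noteq> 0")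
          case True
          then have "V3 \<subseteq> {0}" using V3_zero_if_dim_1[OF v1V w] by blast
          then have "e = 0" using E3_empty by (simp add: e_def)
          then have "r * (r - 1) \<le> 2" using m1 m 3 by simp
          moreover have "3 * 2 \<le> r * (r - 1)" if "3 \<le> r" using that by (intro mult_le_mono) auto
          ultimately have "r = 2" using r by linarith
          then show ?thesis using n k 3 by simp
        next
          case False
          then have "Z c v1 \<in> span E3" for c using Z_in_V3_if_proportional[OF v1V w] by blast
          then have "m \<le> e + (k - 1) * e"
            using dim_V3_bound[OF v1 dep E_sub(3)] by (simp add: k_def e_def)
          then have "m \<le> k * e" using k by (cases k) simp_all
          then show ?thesis using square_bound[of k e "card E0"] n 3 by simp
        qed
      qed
    qed
  qed
qed

end

context faithful_nilpotent_operators
begin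

lemma dim_bound: "2 * r \<le> dim V + 1 \<or> 2 * r * (r - 1) \<le> (dim V - 2)\<^sup>2"
proof -
  have extend: "\<exists>B. S \<subseteq> B \<and> independent B \<and> span B = U" if "independent S" "span S \<subseteq> U" "subspace U" for S U
    using maximal_independent_subset_extend[of S U] that span_superset[of S] span_subspace by (metis order_trans)
  obtain E4 where E4: "independent E4" "span E4 = V4"
    using extend[of "{}" V4] independent_empty subspace_g subspace_0[OF subspace_g] by auto
  obtain E3 where E3: "E4 \<subseteq> E3" "independent E3" "span E3 = V3"
    using extend[of E4 V3] E4 V_chain subspace_g by auto
  obtain E2 where E2: "E3 \<subseteq> E2" "independent E2" "span E2 = V2"
    using extend[of E3 V2] E3 V_chain subspace_g by auto
  obtain E1 where E1: "E2 \<subseteq> E1" "independent E1" "span E1 = V1"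
    using extend[of E2 V1] E2 V_chain subspace_g by auto
  obtain E0 where E0: "E1 \<subseteq> E0" "independent E0" "span E0 = V"
    using extend[of E1 V] E1 V_chain V by auto
  have "E0 \<subseteq> V" using E0 span_superset by blast
  then have "finite E0"
    using finite_span E0(2) independent_span_bound by metis
  then interpret adapted_basis scale V r A E0 E1 E2 E3 E4
    using E0 E1 E2 E3 E4 by unfold_locales
  have "dim V = card E0" using dim_span_eq_card_independent[OF E0(2)] E0(3) by simp
  then show ?thesis using dimension_bound by simp
qed

end

text \<open>Subtracting from each \<open>A i\<close> its semisimple part makes it nilpotent and leaves all commutators unchanged.\<close>

lemma (in finite_subspace) central_commutators_dim_bound:
  fixes A :: "nat \<Rightarrow> 'v \<Rightarrow> 'v"
  assumes r: "2 \<le> r" and endo: "\<And>i. i < r \<Longrightarrow> endo (A i)"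
    and central: "\<And>i j k v. \<lbrakk>i < r; j < r; k < r; v \<in> V\<rbrakk> \<Longrightarrow>
      A k (A i (A j v) - A j (A i v)) = A i (A j (A k v)) - A j (A i (A k v))"
    and independent: "\<And>c. (\<And>v. v \<in> V \<Longrightarrow>
        (\<Sum>p\<in>pairs r. scale (c p) (A (fst p) (A (snd p) v) - A (snd p) (A (fst p) v))) = 0) \<Longrightarrow>
      \<forall>p\<in>pairs r. c p = 0"
  shows "2 * r \<le> dim V + 1 \<or> 2 * r * (r - 1) \<le> (dim V - 2)\<^sup>2"
proof -
  obtain N where N: "\<And>i. i < r \<Longrightarrow> endo (N i)" "\<And>i. i < r \<Longrightarrow> \<exists>M. \<forall>v\<in>V. (N i ^^ M) v = 0"
    and NA: "\<And>i j v. \<lbrakk>i < r; j < r; v \<in> V\<rbrakk> \<Longrightarrow> N i (N j v) - N j (N i v) = A i (A j v) - A j (A i v)"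
    and Nc: "\<And>i j k v. \<lbrakk>i < r; j < r; k < r; v \<in> V\<rbrakk> \<Longrightarrow>
      N k (N i (N j v) - N j (N i v)) = N i (N j (N k v)) - N j (N i (N k v))"
    by (rule nilpotent_replacement[OF endo central]) blast+
  interpret nilpotent_operators scale V r N
    by unfold_locales (use N Nc in auto)
  interpret faithful_nilpotent_operators scale V r N
  proof unfold_locales
    fix c assume 0: "\<And>v. v \<in> V \<Longrightarrow> (\<Sum>p\<in>pairs r. scale (c p) (C (fst p) (snd p) v)) = 0"
    show "\<forall>p\<in>pairs r. c p = 0"
    proof (rule independent)
      fix v assume v: "v \<in> V"
      have "(\<Sum>p\<in>pairs r. scale (c p) (A (fst p) (A (snd p) v) - A (snd p) (A (fst p) v))) =
          (\<Sum>p\<in>pairs r. scale (c p) (C (fst p) (snd p) v))"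
        by (rule sum.cong) (auto simp: C_def NA v pairs_def)
      then show "(\<Sum>p\<in>pairs r. scale (c p) (A (fst p) (A (snd p) v) - A (snd p) (A (fst p) v))) = 0"
        using 0 v by simp
    qed
  qed (rule r)
  show ?thesis by (rule dim_bound)
qed

section \<open>From representations to families of operators\<close>

definition unit_vec :: "nat \<Rightarrow> 'k::field free2" where
  "unit_vec i = (\<lambda>k. if k = i then 1 else 0, 0)"

lemma unit_vec_carrier: "i < r \<Longrightarrow> unit_vec i \<in> free2_carrier r"
  by (auto simp: unit_vec_def free2_carrier_def)

lemma bracket_unit_vec:
  "p \<in> pairs r \<Longrightarrow> free2_bracket (unit_vec (fst p)) (unit_vec (snd p)) = (0, \<lambda>q. if q = p then 1 else 0)"
  by (auto simp: unit_vec_def free2_bracket_def wedge_def pairs_def fun_eq_iff)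

lemma bracket_bracket: "free2_bracket x (free2_bracket y z) = 0"
  by (auto simp: free2_bracket_def wedge_def fun_eq_iff zero_prod_def split: prod.splits)

lemma free2_rep_dim_bound:
  fixes scaleV :: "'k::field_char_0 \<Rightarrow> 'v::ab_group_add \<Rightarrow> 'v"
  assumes rep: "faithful_lie_representation free2_scale (free2_carrier r) free2_bracket scaleV W \<pi>"
    and r: "2 \<le> r"
  shows "2 * r \<le> vector_space.dim scaleV W + 1 \<or> 2 * r * (r - 1) \<le> (vector_space.dim scaleV W - 2)\<^sup>2"
proof -
  interpret R: faithful_lie_representation free2_scale "free2_carrier r" free2_bracket scaleV W \<pi> by (rule rep)
  interpret finite_subspace scaleV W
    by unfold_locales (use R.subspace_V R.finite_dim_V in auto)
  interpret VP: vector_space_pair scaleV scaleV by unfold_locales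
  \<comment> \<open>\<open>endo\<close> demands linearity on the whole ambient type, while
    \<open>\<pi>\<close> is constrained only on \<open>W\<close>; composing with a projection onto
    \<open>W\<close> bridges this.\<close>
  have "\<exists>P. P ` UNIV \<subseteq> W \<and> Vector_Spaces.linear scaleV scaleV P \<and> (\<forall>v\<in>W. P (id v) = v)"
    by (rule VP.linear_exists_left_inverse_on) (use R.subspace_V R.V.linear_id in \<open>auto simp: id_def\<close>)
  then obtain P where PW: "\<And>v. P v \<in> W" and Pl: "Vector_Spaces.linear scaleV scaleV P"
    and P: "\<And>v. v \<in> W \<Longrightarrow> P v = v" by auto
  define A where "A i v = \<pi> (unit_vec i) (P v)" for i v
  let ?z = "\<lambda>p. free2_bracket (unit_vec (fst p)) (unit_vec (snd p)) :: 'k free2"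
  have \<pi>0: "\<pi> 0 v = 0" if "v \<in> W" for v
    using R.rep_scale_left[of 0 v 0] that R.subspace_L R.subspace_0 by simp
  have A: "A i v = \<pi> (unit_vec i) v" if "v \<in> W" for i v using that P by (simp add: A_def)
  have AW: "A i v \<in> W" if "i < r" for i v
    unfolding A_def by (rule R.rep_closed[OF unit_vec_carrier[OF that] PW])
  have zL: "free2_bracket (unit_vec i) (unit_vec j) \<in> (free2_carrier r :: 'k free2 set)" if "i < r" "j < r" for i j
    by (intro R.bracket_closed unit_vec_carrier that)
  have C: "A i (A j v) - A j (A i v) = \<pi> (free2_bracket (unit_vec i) (unit_vec j)) v"
    if "i < r" "j < r" "v \<in> W" for i j v
    using that by (simp add: A AW[unfolded A] R.rep_bracket unit_vec_carrier R.rep_closed)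
  show ?thesis
  proof (rule central_commutators_dim_bound[OF r, of A])
    fix i assume i: "i < r"
    have u: "unit_vec i \<in> (free2_carrier r :: 'k free2 set)" by (rule unit_vec_carrier[OF i])
    show "endo (A i)"
      using Pl PW u AW[OF i]
      by (auto simp: endo_def A_def R.rep_add_right R.rep_scale_right VP.linear_add VP.linear_scale)
  next
    fix i j k v assume i: "i < r" "j < r" "k < r" and v: "v \<in> W"
    have "A k (A i (A j v) - A j (A i v)) - (A i (A j (A k v)) - A j (A i (A k v))) =
        \<pi> (unit_vec k) (\<pi> (free2_bracket (unit_vec i) (unit_vec j)) v) -
        \<pi> (free2_bracket (unit_vec i) (unit_vec j)) (\<pi> (unit_vec k) v)"
      using i v by (simp add: C AW) (simp add: A R.rep_closed zL)
    also have "\<dots> = \<pi> (free2_bracket (unit_vec k) (free2_bracket (unit_vec i) (unit_vec j))) v"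
      by (rule R.rep_bracket[symmetric]) (use i v zL unit_vec_carrier in auto)
    also have "\<dots> = 0" by (simp add: bracket_bracket \<pi>0 v)
    finally show "A k (A i (A j v) - A j (A i v)) = A i (A j (A k v)) - A j (A i (A k v))" by simp
  next
    fix c :: "nat \<times> nat \<Rightarrow> 'k"
    assume 0: "\<And>v. v \<in> W \<Longrightarrow> (\<Sum>p\<in>pairs r. scaleV (c p) (A (fst p) (A (snd p) v) - A (snd p) (A (fst p) v))) = 0"
    have lt: "fst p < r \<and> snd p < r" if "p \<in> pairs r" for p using that by (auto simp: pairs_def)
    have sum_L: "(\<Sum>p\<in>S. free2_scale (c p) (?z p)) \<in> free2_carrier r \<and>
        (\<forall>v\<in>W. \<pi> (\<Sum>p\<in>S. free2_scale (c p) (?z p)) v = (\<Sum>p\<in>S. scaleV (c p) (\<pi> (?z p) v)))"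
      if "finite S" "S \<subseteq> pairs r" for S
      using that
    proof (induction S)
      case empty
      then show ?case using \<pi>0 R.subspace_0[OF R.subspace_L] by auto
    next
      case (insert p S)
      have z: "?z p \<in> free2_carrier r" using zL lt insert.prems by blast
      then have "free2_scale (c p) (?z p) \<in> free2_carrier r" by (rule R.subspace_scale[OF R.subspace_L])
      then show ?case using insert z
        by (auto simp: R.rep_add_left R.rep_scale_left intro: R.subspace_add[OF R.subspace_L])
    qed
    \<comment> \<open>The central element with coordinates \<open>c\<close>. It acts by zero, so
      faithfulness gives s = 0, that is c = 0.\<close>
    define s where "s = (\<Sum>p\<in>pairs r. free2_scale (c p) (?z p))"
    have s: "s \<in> free2_carrier r" and \<pi>s: "\<And>v. v \<in> W \<Longrightarrow> \<pi> s v = (\<Sum>p\<in>pairs r. scaleV (c p) (\<pi> (?z p) v))"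
      using sum_L[of "pairs r"] by (auto simp: s_def)
    have "\<pi> s v = \<pi> 0 v" if v: "v \<in> W" for v
    proof -
      have "\<pi> s v = (\<Sum>p\<in>pairs r. scaleV (c p) (A (fst p) (A (snd p) v) - A (snd p) (A (fst p) v)))"
        unfolding \<pi>s[OF v] by (rule sum.cong) (use C lt v in auto)
      then show ?thesis using 0[OF v] \<pi>0[OF v] by simp
    qed
    then have "restrict (\<pi> s) W = restrict (\<pi> 0) W" by (auto simp: restrict_def)
    then have "s = 0"
      using R.faithful s R.subspace_0[OF R.subspace_L] by (auto simp: inj_on_def)
    have "c q = 0" if q: "q \<in> pairs r" for q
    proof -
      have "snd s = (\<Sum>p\<in>pairs r. (\<lambda>x. if x = p then c p else 0))"
        unfolding s_def snd_sum_prod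
        by (rule sum.cong) (auto simp: bracket_unit_vec free2_scale_def fun_eq_iff)
      then have "snd s q = c q" using q by (simp add: sum_fun_apply)
      then show ?thesis using \<open>s = 0\<close> by (simp add: zero_prod_def)
    qed
    then show "\<forall>p\<in>pairs r. c p = 0" by blast
  qed
qed

section \<open>Counting modulo a prime\<close>

text \<open>Residues are integers in \<open>R\<close> rather than elements of a field type: the
  prime is chosen depending on \<open>r\<close>, and the matrices found modulo \<open>p\<close> are
  read again as integer matrices in characteristic zero.\<close>

locale prime_modulus =
  fixes p :: nat
  assumes prime_p: "prime p"
begin

abbreviation R :: "int set" where "R \<equiv> {0..<int p}"

definition cong_p :: "int \<Rightarrow> int \<Rightarrow> bool" (infix \<open>\<equiv>\<^sub>p\<close> 50) where
  "x \<equiv>\<^sub>p y \<longleftrightarrow> x mod int p = y mod int p"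

lemma cp_0_iff: "x \<equiv>\<^sub>p 0 \<longleftrightarrow> int p dvd x"
  by (simp add: cong_p_def mod_eq_0_iff_dvd)

lemma cp_iff_dvd_diff: "x \<equiv>\<^sub>p y \<longleftrightarrow> int p dvd x - y"
  by (simp add: cong_p_def mod_eq_dvd_iff)

lemma cp_trans [trans]: "x \<equiv>\<^sub>p y \<Longrightarrow> y \<equiv>\<^sub>p z \<Longrightarrow> x \<equiv>\<^sub>p z"
  by (simp add: cong_p_def)

lemma cp_sym: "x \<equiv>\<^sub>p y \<Longrightarrow> y \<equiv>\<^sub>p x"
  by (simp add: cong_p_def)

lemma cp_refl [simp]: "x \<equiv>\<^sub>p x"
  by (simp add: cong_p_def)

lemma cp_add: "x \<equiv>\<^sub>p y \<Longrightarrow> x' \<equiv>\<^sub>p y' \<Longrightarrow> x + x' \<equiv>\<^sub>p y + y'"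
  unfolding cong_p_def by (rule mod_add_cong)

lemma cp_diff: "x \<equiv>\<^sub>p y \<Longrightarrow> x' \<equiv>\<^sub>p y' \<Longrightarrow> x - x' \<equiv>\<^sub>p y - y'"
  unfolding cong_p_def by (rule mod_diff_cong)

lemma cp_mult: "x \<equiv>\<^sub>p y \<Longrightarrow> x' \<equiv>\<^sub>p y' \<Longrightarrow> x * x' \<equiv>\<^sub>p y * y'"
  unfolding cong_p_def by (rule mod_mult_cong)

lemma cp_scalar_left: "x \<equiv>\<^sub>p y \<Longrightarrow> c * x \<equiv>\<^sub>p c * y"
  by (simp add: cp_mult)

lemma cp_scalar_right: "x \<equiv>\<^sub>p y \<Longrightarrow> x * c \<equiv>\<^sub>p y * c"
  by (simp add: cp_mult)

lemma cp_minus_minus_iff: "- x \<equiv>\<^sub>p - y \<longleftrightarrow> x \<equiv>\<^sub>p y"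
  by (simp add: cp_iff_dvd_diff) (metis dvd_diff_commute)

lemma cp_diff_iff_0: "x - y \<equiv>\<^sub>p 0 \<longleftrightarrow> x \<equiv>\<^sub>p y"
  by (simp add: cp_iff_dvd_diff)

lemma cp_add_rcancel: "x + z \<equiv>\<^sub>p y + z \<longleftrightarrow> x \<equiv>\<^sub>p y"
  by (simp add: cp_iff_dvd_diff)

lemma p_gt_1: "1 < p"
  using prime_p prime_gt_1_nat by blast

lemma mod_R: "x mod int p \<in> R"
  using p_gt_1 by simp

lemma R_eq: "x \<in> R \<Longrightarrow> y \<in> R \<Longrightarrow> x \<equiv>\<^sub>p y \<Longrightarrow> x = y"
  by (simp add: cong_p_def)

lemma cong_mod: "x mod int p \<equiv>\<^sub>p x"
  by (simp add: cong_p_def)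

lemma inverse_mod:
  assumes "\<not> x \<equiv>\<^sub>p 0"
  obtains w where "w * x \<equiv>\<^sub>p 1"
proof -
  have "coprime x (int p)"
    using assms prime_p by (metis cp_0_iff coprime_commute prime_imp_coprime prime_nat_int_transfer)
  then show ?thesis using that cong_solve_coprime_int unfolding cong_p_def cong_def
    by (metis mult.commute)
qed

lemma sum_cong_p: "(\<And>i. i \<in> A \<Longrightarrow> f i \<equiv>\<^sub>p g i) \<Longrightarrow> sum f A \<equiv>\<^sub>p sum g A"
  by (induction A rule: infinite_finite_induct) (simp_all add: cp_add)

section \<open>Row bases modulo a prime\<close>

definition independent_rows :: "'e set \<Rightarrow> ('d \<Rightarrow> 'e \<Rightarrow> int) \<Rightarrow> 'd set \<Rightarrow> bool" where
  "independent_rows E M J \<longleftrightarrow>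
    (\<forall>z. (\<forall>e\<in>E. (\<Sum>j\<in>J. z j * M j e) \<equiv>\<^sub>p 0) \<longrightarrow> (\<forall>j\<in>J. z j \<equiv>\<^sub>p 0))"

text \<open>The rows in \<open>J\<close> form a basis of the row space modulo \<open>p\<close>, and \<open>Y\<close> expresses all rows in this basis.\<close>

definition pivot :: "'d set \<Rightarrow> 'e set \<Rightarrow> ('d \<Rightarrow> 'e \<Rightarrow> int) \<Rightarrow> 'd set \<Rightarrow> ('d \<Rightarrow> 'd \<Rightarrow> int) \<Rightarrow> bool" where
  "pivot D E M J Y \<longleftrightarrow> J \<subseteq> D \<and> independent_rows E M J \<and> (\<forall>d\<in>D. \<forall>j\<in>J. Y d j \<in> R) \<and>
    (\<forall>d\<in>J. \<forall>j\<in>J. Y d j = (if j = d then 1 else 0)) \<and>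
    (\<forall>d\<in>D. \<forall>e\<in>E. M d e \<equiv>\<^sub>p (\<Sum>j\<in>J. Y d j * M j e))"

lemma card_PiE_R: "finite K \<Longrightarrow> card (PiE K (\<lambda>_. R)) = p ^ card K"
  by (simp add: card_PiE)

lemma finite_PiE_R: "finite K \<Longrightarrow> finite (PiE K (\<lambda>_. R))"
  by (rule finite_PiE) auto

text \<open>Independence makes the map from coefficient vectors to row combinations injective, so
  p^|J| \<le> p^|E|.\<close>

lemma independent_rows_card:
  assumes "finite E" "finite J" "independent_rows E M J"
  shows "card J \<le> card E"
proof -
  define f where "f z = restrict (\<lambda>e. (\<Sum>j\<in>J. z j * M j e) mod int p) E" for z
  have "inj_on f (PiE J (\<lambda>_. R))"
  proof (rule inj_onI)
    fix y z assume y: "y \<in> PiE J (\<lambda>_. R)" and z: "z \<in> PiE J (\<lambda>_. R)" and f: "f y = f z"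
    have "(\<Sum>j\<in>J. (y j - z j) * M j e) \<equiv>\<^sub>p 0" if "e \<in> E" for e
    proof -
      have "(\<Sum>j\<in>J. y j * M j e) \<equiv>\<^sub>p (\<Sum>j\<in>J. z j * M j e)"
        using fun_cong[OF f, of e] that by (simp add: f_def cong_p_def)
      then show ?thesis by (simp add: left_diff_distrib sum_subtractf cp_diff_iff_0)
    qed
    then have "\<forall>j\<in>J. y j - z j \<equiv>\<^sub>p 0"
      using assms(3)[unfolded independent_rows_def, rule_format, of "\<lambda>j. y j - z j"] by blast
    then show "y = z" using y z R_eq
      by (intro PiE_ext[OF y z]) (auto simp: cp_diff_iff_0 PiE_iff)
  qed
  moreover have "f ` PiE J (\<lambda>_. R) \<subseteq> PiE E (\<lambda>_. R)"
    using mod_R by (auto simp: f_def)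
  ultimately have "card (PiE J (\<lambda>_. R)) \<le> card (PiE E (\<lambda>_. R))"
    using finite_PiE_R[OF assms(1)] by (rule card_inj_on_le)
  then have "p ^ card J \<le> p ^ card E"
    unfolding card_PiE_R[OF assms(1)] card_PiE_R[OF assms(2)] .
  then show ?thesis by (rule power_le_imp_le_exp[OF p_gt_1])
qed

lemma pivot_exists:
  assumes D: "finite D"
  shows "\<exists>J Y. pivot D E M J Y"
proof -
  define F where "F = {J. J \<subseteq> D \<and> independent_rows E M J}"
  have F: "{} \<in> F" "finite F"
    by (simp add: F_def independent_rows_def)
      (rule finite_subset[of _ "Pow D"], use D in \<open>auto simp: F_def\<close>)
  then have "Max (card ` F) \<in> card ` F" by (intro Max_in) auto
  then obtain J where J: "J \<in> F" and "Max (card ` F) = card J" by (rule imageE)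
  then have max: "card J' \<le> card J" if "J' \<in> F" for J'
    using F(2) that Max_ge[of "card ` F" "card J'"] by simp
  have JD: "J \<subseteq> D" and ind: "independent_rows E M J" using J by (auto simp: F_def)
  have finJ: "finite J" using JD D finite_subset by blast
  have "\<exists>y. (\<forall>j\<in>J. y j \<in> R) \<and> (d \<in> J \<longrightarrow> (\<forall>j\<in>J. y j = (if j = d then 1 else 0))) \<and>
      (\<forall>e\<in>E. M d e \<equiv>\<^sub>p (\<Sum>j\<in>J. y j * M j e))" if d: "d \<in> D" for d
  proof (cases "d \<in> J")
    case True
    have "(\<Sum>j\<in>J. (if j = d then 1 else 0) * M j e) = (\<Sum>j\<in>J. if j = d then M j e else 0)" for e
      by (rule sum.cong) auto
    then have "(\<Sum>j\<in>J. (if j = d then 1 else 0) * M j e) = M d e" for e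
      using finJ True by simp
    then show ?thesis using p_gt_1 by (intro exI[of _ "\<lambda>j. if j = d then 1 else 0"]) auto
  next
    case False
    have "insert d J \<notin> F"
      using max[of "insert d J"] finJ False by auto
    then have "\<not> independent_rows E M (insert d J)" using d JD by (simp add: F_def)
    then obtain z where z: "\<forall>e\<in>E. (\<Sum>j\<in>insert d J. z j * M j e) \<equiv>\<^sub>p 0" "\<exists>j\<in>insert d J. \<not> z j \<equiv>\<^sub>p 0"
      unfolding independent_rows_def by blast
    have z': "z d * M d e + (\<Sum>j\<in>J. z j * M j e) \<equiv>\<^sub>p 0" if "e \<in> E" for e
      using z(1) that finJ False by simp
    have "\<not> z d \<equiv>\<^sub>p 0"
    proof
      assume d0: "z d \<equiv>\<^sub>p 0"
      have "(\<Sum>j\<in>J. z j * M j e) \<equiv>\<^sub>p 0" if "e \<in> E" for e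
        using cp_diff[OF z'[OF that] cp_scalar_right[OF d0, of "M d e"]] by simp
      then show False using ind z(2) d0 unfolding independent_rows_def by blast
    qed
    then obtain w where w: "w * z d \<equiv>\<^sub>p 1" by (rule inverse_mod)
    \<comment> \<open>\<open>- w\<close> solves the relation for row \<open>d\<close>; reducing
      modulo \<open>p\<close> puts the coefficients into \<open>R\<close>, so that they can be
      counted.\<close>
    define y where "y j = (- w * z j) mod int p" for j
    have "M d e \<equiv>\<^sub>p (\<Sum>j\<in>J. y j * M j e)" if e: "e \<in> E" for e
    proof -
      have "(\<Sum>j\<in>J. y j * M j e) \<equiv>\<^sub>p (\<Sum>j\<in>J. (- w * z j) * M j e)"
        unfolding y_def by (intro sum_cong_p cp_scalar_right cong_mod)
      also have "(\<Sum>j\<in>J. (- w * z j) * M j e) = - w * (\<Sum>j\<in>J. z j * M j e)"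
        by (simp add: sum_distrib_left mult.assoc)
      also have "\<dots> \<equiv>\<^sub>p w * z d * M d e"
        using cp_add[OF cp_scalar_left[OF z'[OF e], of "- w"] cp_refl[of "w * z d * M d e"]]
        by (simp add: algebra_simps)
      also have "w * z d * M d e \<equiv>\<^sub>p M d e" using cp_scalar_right[OF w, of "M d e"] by simp
      finally show ?thesis by (rule cp_sym)
    qed
    moreover have "\<forall>j\<in>J. y j \<in> R" using mod_R by (simp only: y_def) blast
    ultimately show ?thesis using False by blast
  qed
  then have "\<forall>d. \<exists>y. d \<in> D \<longrightarrow> (\<forall>j\<in>J. y j \<in> R) \<and> (d \<in> J \<longrightarrow> (\<forall>j\<in>J. y j = (if j = d then 1 else 0))) \<and>
      (\<forall>e\<in>E. M d e \<equiv>\<^sub>p (\<Sum>j\<in>J. y j * M j e))" by blast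
  then obtain Y where "\<And>d. d \<in> D \<Longrightarrow> (\<forall>j\<in>J. Y d j \<in> R) \<and> (d \<in> J \<longrightarrow> (\<forall>j\<in>J. Y d j = (if j = d then 1 else 0))) \<and>
      (\<forall>e\<in>E. M d e \<equiv>\<^sub>p (\<Sum>j\<in>J. Y d j * M j e))" by metis
  then show ?thesis using JD ind unfolding pivot_def by (intro exI[of _ J] exI[of _ Y]) blast
qed

lemma pivot_scale:
  assumes "pivot D E M J Y" "\<not> w \<equiv>\<^sub>p 0" "\<And>d e. d \<in> D \<Longrightarrow> e \<in> E \<Longrightarrow> N d e \<equiv>\<^sub>p w * M d e"
  shows "pivot D E N J Y"
proof -
  have JD: "J \<subseteq> D" using assms(1) by (simp add: pivot_def)
  have scale: "(\<Sum>j\<in>J. z j * N j e) \<equiv>\<^sub>p w * (\<Sum>j\<in>J. z j * M j e)" if "e \<in> E" for z e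
  proof -
    have "(\<Sum>j\<in>J. z j * N j e) \<equiv>\<^sub>p (\<Sum>j\<in>J. z j * (w * M j e))"
      using JD that by (intro sum_cong_p cp_scalar_left assms(3)) auto
    then show ?thesis by (simp add: sum_distrib_left mult.left_commute)
  qed
  obtain w' where w': "w' * w \<equiv>\<^sub>p 1" using inverse_mod[OF assms(2)] by blast
  have "independent_rows E N J"
    unfolding independent_rows_def
  proof (intro allI impI)
    fix z assume z: "\<forall>e\<in>E. (\<Sum>j\<in>J. z j * N j e) \<equiv>\<^sub>p 0"
    have "(\<Sum>j\<in>J. z j * M j e) \<equiv>\<^sub>p 0" if "e \<in> E" for e
    proof -
      have "w * (\<Sum>j\<in>J. z j * M j e) \<equiv>\<^sub>p 0" using scale[OF that, of z] z that cp_trans cp_sym by blast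
      then have "w' * w * (\<Sum>j\<in>J. z j * M j e) \<equiv>\<^sub>p w' * 0" by (simp only: mult.assoc cp_scalar_left)
      moreover have "w' * w * (\<Sum>j\<in>J. z j * M j e) \<equiv>\<^sub>p 1 * (\<Sum>j\<in>J. z j * M j e)" using w' by (rule cp_scalar_right)
      ultimately have "1 * (\<Sum>j\<in>J. z j * M j e) \<equiv>\<^sub>p w' * 0" using cp_sym cp_trans by blast
      then show ?thesis by simp
    qed
    then show "\<forall>j\<in>J. z j \<equiv>\<^sub>p 0" using assms(1) by (auto simp: pivot_def independent_rows_def)
  qed
  moreover have "N d e \<equiv>\<^sub>p (\<Sum>j\<in>J. Y d j * N j e)" if "d \<in> D" "e \<in> E" for d e
  proof -
    have "N d e \<equiv>\<^sub>p w * M d e" by (rule assms(3)[OF that])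
    also have "w * M d e \<equiv>\<^sub>p w * (\<Sum>j\<in>J. Y d j * M j e)"
      using assms(1) that by (intro cp_scalar_left) (simp add: pivot_def)
    also have "\<dots> \<equiv>\<^sub>p (\<Sum>j\<in>J. Y d j * N j e)" using scale[OF that(2)] by (rule cp_sym)
    finally show ?thesis .
  qed
  ultimately show ?thesis using assms(1) by (simp add: pivot_def)
qed

end

context prime_modulus
begin

text \<open>The index (i, l, u) stands for row i, layer l and column u, with two layers
  throughout.\<close>

definition layered_matrices :: "nat \<Rightarrow> nat \<Rightarrow> (nat \<times> nat \<times> nat \<Rightarrow> int) set" where
  "layered_matrices r n = PiE ({..<n} \<times> {..<2} \<times> {..<r}) (\<lambda>_. R)"

text \<open>The matrix equation A_0 S B_0^T + A_1 S B_1^T = 0 modulo \<open>p\<close>.\<close>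

definition annihilating :: "nat \<Rightarrow> (nat \<Rightarrow> nat \<Rightarrow> int) \<Rightarrow> nat \<Rightarrow> nat \<Rightarrow>
    (nat \<times> nat \<times> nat \<Rightarrow> int) \<Rightarrow> (nat \<times> nat \<times> nat \<Rightarrow> int) \<Rightarrow> bool" where
  "annihilating r S a b A B \<longleftrightarrow>
    (\<forall>i<a. \<forall>j<b. (\<Sum>l<2. \<Sum>u<r. \<Sum>v<r. A (i, l, u) * S u v * B (j, l, v)) \<equiv>\<^sub>p 0)"

end

section \<open>Counting the pairs annihilated by one skew matrix\<close>

locale skew_mod = prime_modulus +
  fixes r :: nat and S :: "nat \<Rightarrow> nat \<Rightarrow> int" and I X
  assumes skew: "\<And>u v. S v u = - S u v"
    and pivot_S: "pivot {..<r} {..<r} S I X"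
begin

lemma I: "I \<subseteq> {..<r}" "finite I"
  using pivot_S finite_subset by (auto simp: pivot_def)

lemma S_eq: "u < r \<Longrightarrow> v < r \<Longrightarrow> S u v \<equiv>\<^sub>p (\<Sum>\<iota>\<in>I. X u \<iota> * S \<iota> v)"
  using pivot_S by (simp add: pivot_def)

lemma I_r: "\<iota> \<in> I \<Longrightarrow> \<iota> < r"
  using I by auto

text \<open>The block of a skew matrix on a row basis is nonsingular: a vector supported on
  \<open>I\<close> and killed by the rows in \<open>I\<close> is killed by all rows, which are
  combinations of these, and by skewness it is then a relation among the rows in
  \<open>I\<close>.\<close>

lemma principal_injective:
  assumes "\<And>\<iota>. \<iota> \<in> I \<Longrightarrow> (\<Sum>\<kappa>\<in>I. z \<kappa> * S \<iota> \<kappa>) \<equiv>\<^sub>p 0" "\<kappa> \<in> I"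
  shows "z \<kappa> \<equiv>\<^sub>p 0"
proof -
  have "(\<Sum>\<kappa>\<in>I. z \<kappa> * S \<kappa> u) \<equiv>\<^sub>p 0" if u: "u < r" for u
  proof -
    have "(\<Sum>\<kappa>\<in>I. z \<kappa> * S \<kappa> u) = - (\<Sum>\<kappa>\<in>I. z \<kappa> * S u \<kappa>)"
      by (subst skew) (simp add: sum_negf)
    also have "(\<Sum>\<kappa>\<in>I. z \<kappa> * S u \<kappa>) \<equiv>\<^sub>p (\<Sum>\<kappa>\<in>I. z \<kappa> * (\<Sum>\<iota>\<in>I. X u \<iota> * S \<iota> \<kappa>))"
      by (intro sum_cong_p cp_scalar_left S_eq u I_r)
    then have "- (\<Sum>\<kappa>\<in>I. z \<kappa> * S u \<kappa>) \<equiv>\<^sub>p - (\<Sum>\<kappa>\<in>I. z \<kappa> * (\<Sum>\<iota>\<in>I. X u \<iota> * S \<iota> \<kappa>))"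
      by (simp only: cp_minus_minus_iff)
    also have "(\<Sum>\<kappa>\<in>I. z \<kappa> * (\<Sum>\<iota>\<in>I. X u \<iota> * S \<iota> \<kappa>)) = (\<Sum>\<iota>\<in>I. X u \<iota> * (\<Sum>\<kappa>\<in>I. z \<kappa> * S \<iota> \<kappa>))"
      unfolding sum_distrib_left by (subst sum.swap) (simp only: mult.left_commute)
    also have "- \<dots> \<equiv>\<^sub>p - (\<Sum>\<iota>\<in>I. X u \<iota> * 0)"
      unfolding cp_minus_minus_iff by (intro sum_cong_p cp_scalar_left assms(1))
    finally show ?thesis by simp
  qed
  then show ?thesis using pivot_S assms(2) by (auto simp: pivot_def independent_rows_def)
qed

abbreviation "\<Omega> \<equiv> layered_matrices r"
abbreviation "annihilates \<equiv> annihilating r S"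

text \<open>Since \<open>S = X S\<^sub>I\<close>, the form \<open>\<Sum> A S B\<close> only depends on \<open>A X\<close> and \<open>S\<^sub>I B\<close>.\<close>

definition AX where "AX A = (\<lambda>(l, \<iota>) i. \<Sum>u<r. A (i, l, u) * X u \<iota>)"
definition SB where "SB B = (\<lambda>(l, \<iota>) j. \<Sum>v<r. S \<iota> v * B (j, l, v))"

abbreviation "D \<equiv> {..<2::nat} \<times> I"

lemma annihilates_iff:
  "annihilates a b A B \<longleftrightarrow> (\<forall>i<a. \<forall>j<b. (\<Sum>d\<in>D. AX A d i * SB B d j) \<equiv>\<^sub>p 0)"
proof -
  have "(\<Sum>l<2. \<Sum>u<r. \<Sum>v<r. A (i, l, u) * S u v * B (j, l, v)) \<equiv>\<^sub>p (\<Sum>d\<in>D. AX A d i * SB B d j)" for i j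
  proof -
    have "(\<Sum>u<r. \<Sum>v<r. A (i, l, u) * S u v * B (j, l, v)) \<equiv>\<^sub>p (\<Sum>\<iota>\<in>I. AX A (l, \<iota>) i * SB B (l, \<iota>) j)" for l
    proof -
      have "(\<Sum>u<r. \<Sum>v<r. A (i, l, u) * S u v * B (j, l, v)) \<equiv>\<^sub>p
          (\<Sum>u<r. \<Sum>v<r. A (i, l, u) * (\<Sum>\<iota>\<in>I. X u \<iota> * S \<iota> v) * B (j, l, v))"
        by (intro sum_cong_p cp_scalar_left cp_scalar_right S_eq) auto
      also have "\<dots> = (\<Sum>u<r. \<Sum>v<r. \<Sum>\<iota>\<in>I. A (i, l, u) * X u \<iota> * (S \<iota> v * B (j, l, v)))"
        by (simp add: sum_distrib_left sum_distrib_right ac_simps)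
      also have "\<dots> = (\<Sum>u<r. \<Sum>\<iota>\<in>I. \<Sum>v<r. A (i, l, u) * X u \<iota> * (S \<iota> v * B (j, l, v)))"
        by (intro sum.cong refl sum.swap)
      also have "\<dots> = (\<Sum>\<iota>\<in>I. \<Sum>u<r. \<Sum>v<r. A (i, l, u) * X u \<iota> * (S \<iota> v * B (j, l, v)))"
        by (rule sum.swap)
      also have "\<dots> = (\<Sum>\<iota>\<in>I. AX A (l, \<iota>) i * SB B (l, \<iota>) j)"
        by (simp add: AX_def SB_def sum_product)
      finally show ?thesis .
    qed
    then have "(\<Sum>l<2. \<Sum>u<r. \<Sum>v<r. A (i, l, u) * S u v * B (j, l, v)) \<equiv>\<^sub>p
        (\<Sum>l<2. \<Sum>\<iota>\<in>I. AX A (l, \<iota>) i * SB B (l, \<iota>) j)" by (intro sum_cong_p)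
    then show ?thesis by (simp add: sum.cartesian_product)
  qed
  then show ?thesis unfolding annihilating_def using cp_trans cp_sym by blast
qed

lemma card_D: "card D = 2 * card I"
  by (simp add: card_cartesian_product)

lemma restrict_eqD: "restrict f A = restrict g A \<Longrightarrow> x \<in> A \<Longrightarrow> f x = g x"
  by (metis restrict_apply')

lemma split_sum: "(\<Sum>u<r. f u) = (\<Sum>u\<in>I. f u) + (\<Sum>u\<in>{..<r} - I. f u)" for f :: "nat \<Rightarrow> int"
  using sum.subset_diff[OF I(1), of f] by simp

lemma sum_delta_I:
  assumes "\<iota> \<in> I" shows "(\<Sum>u\<in>I. f u * X u \<iota>) = f \<iota>"
proof -
  have "(\<Sum>u\<in>I. f u * X u \<iota>) = (\<Sum>u\<in>I. if u = \<iota> then f u else 0)"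
    using pivot_S assms by (intro sum.cong) (auto simp: pivot_def)
  then show ?thesis using assms I by simp
qed

text \<open>Let h = \<open>card I\<close> and q = \<open>card J\<close>. The 2 h x a matrix
  \<open>AX A\<close> of rank q is given by its pivot rows and the coefficients of the others. Since
  \<open>X\<close> is the identity on \<open>I\<close>, the columns of \<open>A\<close> in
  \<open>I\<close> are recovered from \<open>AX A\<close> and the remaining columns. The exponent
  counts these three data.\<close>

lemma card_A_with_pivot:
  assumes J: "J \<subseteq> D"
  shows "card {A \<in> \<Omega> a. \<exists>Y. pivot D {..<a} (AX A) J Y}
    \<le> p ^ (2 * (r - card I) * a + (2 * card I - card J) * card J + card J * a)"
proof -
  let ?T = "{A \<in> \<Omega> a. \<exists>Y. pivot D {..<a} (AX A) J Y}"
  define Y where "Y A = (SOME Y. pivot D {..<a} (AX A) J Y)" for A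
  have Y: "pivot D {..<a} (AX A) J (Y A)" if "A \<in> ?T" for A
    using someI_ex[of "\<lambda>Y. pivot D {..<a} (AX A) J Y"] that unfolding Y_def by blast
  let ?K1 = "{..<a} \<times> {..<2::nat} \<times> ({..<r} - I)" and ?K2 = "(D - J) \<times> J" and ?K3 = "J \<times> {..<a}"
  define code where "code A = (restrict A ?K1, restrict (\<lambda>(d, j). Y A d j) ?K2,
      restrict (\<lambda>(d, i). AX A d i mod int p) ?K3)" for A
  have finJ: "finite J" using J I finite_subset by blast
  have "inj_on code ?T"
  proof (rule inj_onI)
    fix A A' assume A: "A \<in> ?T" "A' \<in> ?T" and c: "code A = code A'"
    note P = Y[OF A(1), unfolded pivot_def] Y[OF A(2), unfolded pivot_def]
    have c1: "A x = A' x" if "x \<in> ?K1" for x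
      using c restrict_eqD[of A ?K1 A' x] that by (simp add: code_def)
    have c2: "Y A d j = Y A' d j" if "d \<in> D" "j \<in> J" for d j
    proof (cases "d \<in> J")
      case True
      then show ?thesis using P that by simp
    next
      case False
      then show ?thesis
        using c restrict_eqD[of "\<lambda>(d, j). Y A d j" ?K2 "\<lambda>(d, j). Y A' d j" "(d, j)"] that by (simp add: code_def)
    qed
    have c3: "AX A d i \<equiv>\<^sub>p AX A' d i" if "d \<in> J" "i < a" for d i
      using c restrict_eqD[of "\<lambda>(d, i). AX A d i mod int p" ?K3 "\<lambda>(d, i). AX A' d i mod int p" "(d, i)"] that
      by (simp add: code_def cong_p_def)
    have AX: "AX A d i \<equiv>\<^sub>p AX A' d i" if d: "d \<in> D" and i: "i < a" for d i
    proof -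
      have "AX A d i \<equiv>\<^sub>p (\<Sum>j\<in>J. Y A d j * AX A j i)" using P d i by blast
      also have "\<dots> \<equiv>\<^sub>p (\<Sum>j\<in>J. Y A' d j * AX A' j i)"
        using c2[OF d] c3[OF _ i] by (intro sum_cong_p cp_mult) auto
      also have "\<dots> \<equiv>\<^sub>p AX A' d i" using P d i cp_sym by blast
      finally show ?thesis .
    qed
    show "A = A'"
    proof (rule PiE_ext)
      show "A \<in> PiE ({..<a} \<times> {..<2} \<times> {..<r}) (\<lambda>_. R)" "A' \<in> PiE ({..<a} \<times> {..<2} \<times> {..<r}) (\<lambda>_. R)"
        using A by (auto simp: layered_matrices_def)
      fix x assume x: "x \<in> {..<a} \<times> {..<2::nat} \<times> {..<r}"
      obtain i l u where xe: "x = (i, l, u)" by (metis prod_cases3)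
      show "A x = A' x"
      proof (cases "u \<in> I")
        case False
        then show ?thesis using c1 x xe by auto
      next
        case True
        have split: "AX B (l, u) i = B (i, l, u) + (\<Sum>v\<in>{..<r} - I. B (i, l, v) * X v u)" for B
          by (simp add: AX_def split_sum sum_delta_I[OF True, of "\<lambda>v. B (i, l, v)"])
        have "(\<Sum>v\<in>{..<r} - I. A (i, l, v) * X v u) = (\<Sum>v\<in>{..<r} - I. A' (i, l, v) * X v u)"
          by (rule sum.cong) (use c1 x xe in auto)
        moreover have "AX A (l, u) i \<equiv>\<^sub>p AX A' (l, u) i" using x xe True by (intro AX) auto
        ultimately have "A x \<equiv>\<^sub>p A' x" by (simp add: split xe cp_add_rcancel)
        then show ?thesis using A x by (intro R_eq) (auto simp: layered_matrices_def PiE_iff)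
      qed
    qed
  qed
  moreover have "code ` ?T \<subseteq> PiE ?K1 (\<lambda>_. R) \<times> PiE ?K2 (\<lambda>_. R) \<times> PiE ?K3 (\<lambda>_. R)"
  proof (rule image_subsetI)
    fix A assume A: "A \<in> ?T"
    have "restrict A ?K1 \<in> PiE ?K1 (\<lambda>_. R)" using A I by (auto simp: layered_matrices_def PiE_iff)
    moreover have "restrict (\<lambda>(d, j). Y A d j) ?K2 \<in> PiE ?K2 (\<lambda>_. R)"
      using Y[OF A] unfolding pivot_def by (intro restrict_PiE_iff[THEN iffD2]) (simp only: split_paired_Ball_Sigma, auto)
    moreover have "restrict (\<lambda>(d, i). AX A d i mod int p) ?K3 \<in> PiE ?K3 (\<lambda>_. R)"
      using mod_R by (intro restrict_PiE_iff[THEN iffD2]) (simp only: split_paired_Ball_Sigma split_conv, blast)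
    ultimately show "code A \<in> PiE ?K1 (\<lambda>_. R) \<times> PiE ?K2 (\<lambda>_. R) \<times> PiE ?K3 (\<lambda>_. R)"
      by (simp add: code_def)
  qed
  moreover have fin: "finite ?K1" "finite ?K2" "finite ?K3" using finJ I by auto
  ultimately have "card ?T \<le> card (PiE ?K1 (\<lambda>_. R) \<times> PiE ?K2 (\<lambda>_. R) \<times> PiE ?K3 (\<lambda>_. R))"
    by (intro card_inj_on_le[of code]) (auto intro!: finite_PiE_R)
  also have "\<dots> = p ^ (card ?K1 + card ?K2 + card ?K3)"
    by (simp only: card_cartesian_product[of "PiE _ _"] card_PiE_R[OF fin(1)] card_PiE_R[OF fin(2)]
        card_PiE_R[OF fin(3)] power_add mult.assoc)
  also have "card ?K1 + card ?K2 + card ?K3 =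
      2 * (r - card I) * a + (2 * card I - card J) * card J + card J * a"
    using I J finJ by (simp add: card_cartesian_product card_Diff_subset card_D)
  finally show ?thesis .
qed

text \<open>The pivot rows are independent, so annihilation means that the rows of
  \<open>SB B\<close> in \<open>J\<close> are fixed combinations of those outside \<open>J\<close>.
  By \<open>principal_injective\<close>, \<open>SB B\<close> and the columns outside
  \<open>I\<close> determine \<open>B\<close>.\<close>

lemma card_annihilated_B:
  assumes piv: "pivot D {..<a} (AX A) J Y"
  shows "card {B \<in> \<Omega> b. annihilates a b A B} \<le> p ^ (2 * (r - card I) * b + (2 * card I - card J) * b)"
proof -
  let ?T = "{B \<in> \<Omega> b. annihilates a b A B}"
  let ?K1 = "{..<b} \<times> {..<2::nat} \<times> ({..<r} - I)" and ?K2 = "(D - J) \<times> {..<b}"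
  define code where "code B = (restrict B ?K1, restrict (\<lambda>(d, j). SB B d j mod int p) ?K2)" for B
  have J: "J \<subseteq> D" using piv by (simp add: pivot_def)
  have finD: "finite D" using I by simp
  have finJ: "finite J" using J finD finite_subset by blast
  have SBJ: "SB B \<kappa> j \<equiv>\<^sub>p - (\<Sum>d\<in>D - J. Y d \<kappa> * SB B d j)"
    if B: "annihilates a b A B" and \<kappa>: "\<kappa> \<in> J" and j: "j < b" for B \<kappa> j
  proof -
    define z where "z \<kappa> = (\<Sum>d\<in>D. Y d \<kappa> * SB B d j)" for \<kappa>
    have "(\<Sum>\<kappa>\<in>J. z \<kappa> * AX A \<kappa> i) \<equiv>\<^sub>p 0" if i: "i \<in> {..<a}" for i
    proof -
      have "(\<Sum>\<kappa>\<in>J. z \<kappa> * AX A \<kappa> i) = (\<Sum>\<kappa>\<in>J. \<Sum>d\<in>D. Y d \<kappa> * AX A \<kappa> i * SB B d j)"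
        unfolding z_def sum_distrib_right by (intro sum.cong refl) (simp add: ac_simps)
      also have "\<dots> = (\<Sum>d\<in>D. (\<Sum>\<kappa>\<in>J. Y d \<kappa> * AX A \<kappa> i) * SB B d j)"
        unfolding sum_distrib_right by (rule sum.swap)
      also have "\<dots> \<equiv>\<^sub>p (\<Sum>d\<in>D. AX A d i * SB B d j)"
        by (intro sum_cong_p cp_scalar_right, rule cp_sym) (use piv i in \<open>auto simp: pivot_def\<close>)
      also have "\<dots> \<equiv>\<^sub>p 0" using B i j by (simp add: annihilates_iff)
      finally show ?thesis .
    qed
    then have "z \<kappa> \<equiv>\<^sub>p 0" using piv \<kappa> unfolding pivot_def independent_rows_def by blast
    moreover have "z \<kappa> = SB B \<kappa> j + (\<Sum>d\<in>D - J. Y d \<kappa> * SB B d j)"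
    proof -
      have "z \<kappa> = (\<Sum>d\<in>J. Y d \<kappa> * SB B d j) + (\<Sum>d\<in>D - J. Y d \<kappa> * SB B d j)"
        unfolding z_def sum.subset_diff[OF J finD] by (rule add.commute)
      also have "(\<Sum>d\<in>J. Y d \<kappa> * SB B d j) = (\<Sum>d\<in>J. if d = \<kappa> then SB B d j else 0)"
        using piv \<kappa> by (intro sum.cong) (auto simp: pivot_def)
      finally show ?thesis using \<kappa> finJ by simp
    qed
    ultimately have "SB B \<kappa> j + (\<Sum>d\<in>D - J. Y d \<kappa> * SB B d j) \<equiv>\<^sub>p 0" by simp
    then show ?thesis by (simp add: cp_iff_dvd_diff)
  qed
  have "inj_on code ?T"
  proof (rule inj_onI)
    fix B B' assume B: "B \<in> ?T" "B' \<in> ?T" and c: "code B = code B'"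
    have c1: "B x = B' x" if "x \<in> ?K1" for x
      using c restrict_eqD[of B ?K1 B' x] that by (simp add: code_def)
    have c2: "SB B d j \<equiv>\<^sub>p SB B' d j" if "d \<in> D - J" "j < b" for d j
      using c restrict_eqD[of "\<lambda>(d, j). SB B d j mod int p" ?K2 "\<lambda>(d, j). SB B' d j mod int p" "(d, j)"] that
      by (simp add: code_def cong_p_def)
    have SB: "SB B d j \<equiv>\<^sub>p SB B' d j" if d: "d \<in> D" and j: "j < b" for d j
    proof (cases "d \<in> J")
      case True
      have "SB B d j \<equiv>\<^sub>p - (\<Sum>d'\<in>D - J. Y d' d * SB B d' j)" using SBJ B True j by blast
      also have "\<dots> \<equiv>\<^sub>p - (\<Sum>d'\<in>D - J. Y d' d * SB B' d' j)"
        unfolding cp_minus_minus_iff using c2[OF _ j] by (intro sum_cong_p cp_scalar_left)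
      also have "\<dots> \<equiv>\<^sub>p SB B' d j" using SBJ B True j cp_sym by blast
      finally show ?thesis .
    qed (use c2 d j in simp)
    show "B = B'"
    proof (rule PiE_ext)
      show "B \<in> PiE ({..<b} \<times> {..<2} \<times> {..<r}) (\<lambda>_. R)" "B' \<in> PiE ({..<b} \<times> {..<2} \<times> {..<r}) (\<lambda>_. R)"
        using B by (auto simp: layered_matrices_def)
      fix x assume x: "x \<in> {..<b} \<times> {..<2::nat} \<times> {..<r}"
      obtain j l v where xe: "x = (j, l, v)" by (metis prod_cases3)
      show "B x = B' x"
      proof (cases "v \<in> I")
        case False
        then show ?thesis using c1 x xe by auto
      next
        case True
        define z where "z \<kappa> = B (j, l, \<kappa>) - B' (j, l, \<kappa>)" for \<kappa>
        have "(\<Sum>\<kappa>\<in>I. z \<kappa> * S \<iota> \<kappa>) \<equiv>\<^sub>p 0" if \<iota>: "\<iota> \<in> I" for \<iota>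
        proof -
          have "SB B (l, \<iota>) j \<equiv>\<^sub>p SB B' (l, \<iota>) j" using x xe \<iota> by (intro SB) auto
          then have "SB B (l, \<iota>) j - SB B' (l, \<iota>) j \<equiv>\<^sub>p 0" by (simp add: cp_diff_iff_0)
          also have "SB B (l, \<iota>) j - SB B' (l, \<iota>) j = (\<Sum>\<kappa><r. z \<kappa> * S \<iota> \<kappa>)"
            by (simp add: SB_def z_def algebra_simps flip: sum_subtractf)
          also have "\<dots> = (\<Sum>\<kappa>\<in>I. z \<kappa> * S \<iota> \<kappa>)"
            unfolding split_sum by (simp add: z_def) (rule sum.neutral, use c1 x xe in auto)
          finally show ?thesis .
        qed
        then have "z v \<equiv>\<^sub>p 0" using principal_injective True by blast
        then have "B x \<equiv>\<^sub>p B' x" by (simp add: z_def xe cp_diff_iff_0)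
        then show ?thesis using B x by (intro R_eq) (auto simp: layered_matrices_def PiE_iff)
      qed
    qed
  qed
  moreover have "code ` ?T \<subseteq> PiE ?K1 (\<lambda>_. R) \<times> PiE ?K2 (\<lambda>_. R)"
  proof (rule image_subsetI)
    fix B assume B: "B \<in> ?T"
    have "restrict B ?K1 \<in> PiE ?K1 (\<lambda>_. R)" using B I by (auto simp: layered_matrices_def PiE_iff)
    moreover have "restrict (\<lambda>(d, i). SB B d i mod int p) ?K2 \<in> PiE ?K2 (\<lambda>_. R)"
      using mod_R by (intro restrict_PiE_iff[THEN iffD2]) (simp only: split_paired_Ball_Sigma split_conv, blast)
    ultimately show "code B \<in> PiE ?K1 (\<lambda>_. R) \<times> PiE ?K2 (\<lambda>_. R)"
      by (simp add: code_def)
  qed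
  moreover have fin: "finite ?K1" "finite ?K2" using finD I by auto
  ultimately have "card ?T \<le> card (PiE ?K1 (\<lambda>_. R) \<times> PiE ?K2 (\<lambda>_. R))"
    by (intro card_inj_on_le[of code]) (auto intro!: finite_PiE_R)
  also have "\<dots> = p ^ (card ?K1 + card ?K2)"
    by (simp only: card_cartesian_product[of "PiE _ _"] card_PiE_R[OF fin(1)] card_PiE_R[OF fin(2)] power_add)
  also have "card ?K1 + card ?K2 = 2 * (r - card I) * b + (2 * card I - card J) * b"
    using I J finJ by (simp add: card_cartesian_product card_Diff_subset card_D)
  finally show ?thesis .
qed

end

section \<open>Counting skew matrices and the union bound\<close>

definition skew_of :: "(nat \<times> nat \<Rightarrow> 'a::ab_group_add) \<Rightarrow> nat \<Rightarrow> nat \<Rightarrow> 'a" where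
  "skew_of s u v = (if u < v then s (u, v) else if v < u then - s (v, u) else 0)"

lemma skew_of_swap: "skew_of s v u = - skew_of s u v"
  by (auto simp: skew_of_def)

definition pairs_meeting :: "nat \<Rightarrow> nat set \<Rightarrow> (nat \<times> nat) set" where
  "pairs_meeting r I = {(u, v) \<in> pairs r. u \<in> I \<or> v \<in> I}"

lemma finite_pairs_meeting: "finite (pairs_meeting r I)"
  by (rule finite_subset[of _ "pairs r"]) (auto simp: pairs_meeting_def)

text \<open>In the r x r grid, these pairs, their transposes, the diagonal over \<open>I\<close> and
  the square over the complement of \<open>I\<close> are disjoint.\<close>

lemma card_pairs_meeting:
  assumes I: "I \<subseteq> {..<r}"
  shows "2 * card (pairs_meeting r I) + card I + (r - card I)\<^sup>2 \<le> r\<^sup>2"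
proof -
  let ?P = "pairs_meeting r I" and ?Q = "(\<lambda>(u, v). (v, u)) ` pairs_meeting r I"
    and ?D = "(\<lambda>u. (u, u)) ` I" and ?N = "({..<r} - I) \<times> ({..<r} - I)"
  have finI: "finite I" using I finite_subset by blast
  have "card (((?P \<union> ?Q) \<union> ?D) \<union> ?N) \<le> card ({..<r} \<times> {..<r})"
    using I by (intro card_mono) (auto simp: pairs_meeting_def pairs_def)
  moreover have "card (((?P \<union> ?Q) \<union> ?D) \<union> ?N) = card ?P + card ?Q + card ?D + card ?N"
  proof -
    have "card (((?P \<union> ?Q) \<union> ?D) \<union> ?N) = card ((?P \<union> ?Q) \<union> ?D) + card ?N"
      by (rule card_Un_disjoint) (use finI in \<open>auto simp: finite_pairs_meeting, auto simp: pairs_meeting_def\<close>)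
    also have "card ((?P \<union> ?Q) \<union> ?D) = card (?P \<union> ?Q) + card ?D"
      by (rule card_Un_disjoint) (use finI in \<open>auto simp: finite_pairs_meeting, auto simp: pairs_meeting_def pairs_def\<close>)
    also have "card (?P \<union> ?Q) = card ?P + card ?Q"
      by (rule card_Un_disjoint) (auto simp: finite_pairs_meeting, auto simp: pairs_meeting_def pairs_def)
    finally show ?thesis .
  qed
  moreover have "card ?Q = card ?P" by (rule card_image) (auto simp: inj_on_def)
  moreover have "card ?D = card I" by (rule card_image) (auto simp: inj_on_def)
  moreover have "card ?N = (r - card I)\<^sup>2"
    using I finI by (simp add: card_cartesian_product card_Diff_subset power2_eq_square)
  ultimately show ?thesis by (simp add: power2_eq_square)
qed

context prime_modulus
begin

text \<open>A skew matrix is determined by its rows in \<open>I\<close>. The normalisation \<open>s e = 1\<close> saves the one factor \<open>p\<close>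
  that the union bound needs when \<open>a b = r (r - 1) / 2\<close>.\<close>

lemma card_skew_with_pivot:
  assumes I: "I \<subseteq> {..<r}"
  shows "card {s \<in> PiE (pairs r) (\<lambda>_. R). (\<exists>X. pivot {..<r} {..<r} (skew_of s) I X) \<and>
      (\<exists>e\<in>pairs_meeting r I. s e = 1)}
    \<le> card (pairs_meeting r I) * p ^ (card (pairs_meeting r I) - 1)" (is "card ?T \<le> _")
proof -
  let ?P = "pairs_meeting r I"
  let ?Te = "\<lambda>e. {s \<in> PiE (pairs r) (\<lambda>_. R). (\<exists>X. pivot {..<r} {..<r} (skew_of s) I X) \<and> s e = 1}"
  \<comment> \<open>The entries meeting \<open>I\<close> determine \<open>X\<close>, because the
    block on \<open>I\<close> is nonsingular, and then S = X S_I.\<close>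
  have det: "s = s'" if s: "s \<in> PiE (pairs r) (\<lambda>_. R)" "s' \<in> PiE (pairs r) (\<lambda>_. R)"
    and X: "pivot {..<r} {..<r} (skew_of s) I X" and X': "pivot {..<r} {..<r} (skew_of s') I X'"
    and eq: "\<And>q. q \<in> ?P \<Longrightarrow> s q = s' q" for s s' X X'
  proof -
    interpret s: skew_mod p r "skew_of s" I X
      by unfold_locales (use X skew_of_swap in auto)
    interpret s': skew_mod p r "skew_of s'" I X'
      by unfold_locales (use X' skew_of_swap in auto)
    have S: "skew_of s u v = skew_of s' u v" if "u < r" "v < r" "u \<in> I \<or> v \<in> I" for u v
      using that eq by (auto simp: skew_of_def pairs_meeting_def pairs_def)
    have XX: "X u \<iota> - X' u \<iota> \<equiv>\<^sub>p 0" if u: "u < r" and \<iota>: "\<iota> \<in> I" for u \<iota>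
    proof (rule s.principal_injective[OF _ \<iota>])
      fix \<kappa> assume \<kappa>: "\<kappa> \<in> I"
      have "(\<Sum>\<iota>\<in>I. X u \<iota> * skew_of s \<iota> \<kappa>) \<equiv>\<^sub>p skew_of s u \<kappa>"
        using s.S_eq[OF u s.I_r[OF \<kappa>]] by (rule cp_sym)
      moreover have "skew_of s u \<kappa> \<equiv>\<^sub>p (\<Sum>\<iota>\<in>I. X' u \<iota> * skew_of s \<iota> \<kappa>)"
      proof -
        have "skew_of s u \<kappa> = skew_of s' u \<kappa>" using S u \<kappa> s.I_r by simp
        also have "skew_of s' u \<kappa> \<equiv>\<^sub>p (\<Sum>\<iota>\<in>I. X' u \<iota> * skew_of s' \<iota> \<kappa>)" using s'.S_eq[OF u s.I_r[OF \<kappa>]] .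
        also have "(\<Sum>\<iota>\<in>I. X' u \<iota> * skew_of s' \<iota> \<kappa>) = (\<Sum>\<iota>\<in>I. X' u \<iota> * skew_of s \<iota> \<kappa>)"
          using S \<kappa> s.I_r by (intro sum.cong) auto
        finally show ?thesis .
      qed
      ultimately have "(\<Sum>\<iota>\<in>I. X u \<iota> * skew_of s \<iota> \<kappa>) \<equiv>\<^sub>p (\<Sum>\<iota>\<in>I. X' u \<iota> * skew_of s \<iota> \<kappa>)"
        by (rule cp_trans)
      then have "(\<Sum>\<iota>\<in>I. (X u \<iota> - X' u \<iota>) * skew_of s \<iota> \<kappa>) \<equiv>\<^sub>p 0"
        by (simp add: left_diff_distrib sum_subtractf cp_diff_iff_0)
      then have "- (\<Sum>\<iota>\<in>I. (X u \<iota> - X' u \<iota>) * skew_of s \<iota> \<kappa>) \<equiv>\<^sub>p - 0" by (simp only: cp_minus_minus_iff)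
      then show "(\<Sum>\<iota>\<in>I. (X u \<iota> - X' u \<iota>) * skew_of s \<kappa> \<iota>) \<equiv>\<^sub>p 0"
        by (subst skew_of_swap) (simp add: sum_negf)
    qed
    show ?thesis
    proof (rule PiE_ext[OF s])
      fix q assume q: "q \<in> pairs r"
      obtain u v where uv: "q = (u, v)" "u < v" "v < r" using q by (auto simp: pairs_def)
      have "skew_of s u v \<equiv>\<^sub>p (\<Sum>\<iota>\<in>I. X u \<iota> * skew_of s \<iota> v)" using s.S_eq[of u v] uv by simp
      also have "\<dots> \<equiv>\<^sub>p (\<Sum>\<iota>\<in>I. X' u \<iota> * skew_of s \<iota> v)"
        using XX[of u] uv by (intro sum_cong_p cp_scalar_right) (simp add: cp_diff_iff_0)
      also have "\<dots> = (\<Sum>\<iota>\<in>I. X' u \<iota> * skew_of s' \<iota> v)" using S uv s.I_r by (intro sum.cong) auto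
      also have "\<dots> \<equiv>\<^sub>p skew_of s' u v" by (rule cp_sym) (use s'.S_eq[of u v] uv in simp)
      finally have "s q \<equiv>\<^sub>p s' q" using uv by (simp add: skew_of_def)
      then show "s q = s' q" using s q by (intro R_eq) (auto simp: PiE_iff)
    qed
  qed
  have Te: "card (?Te e) \<le> p ^ (card ?P - 1)" if e: "e \<in> ?P" for e
  proof -
    have "inj_on (\<lambda>s. restrict s (?P - {e})) (?Te e)"
    proof (rule inj_onI)
      fix s s' assume s: "s \<in> ?Te e" "s' \<in> ?Te e" and c: "restrict s (?P - {e}) = restrict s' (?P - {e})"
      have "s q = s' q" if "q \<in> ?P" for q
        using that s fun_cong[OF c, of q] by (cases "q = e") auto
      then show "s = s'" using s det by blast
    qed
    moreover have "(\<lambda>s. restrict s (?P - {e})) ` ?Te e \<subseteq> PiE (?P - {e}) (\<lambda>_. R)"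
    proof (rule image_subsetI)
      fix s assume "s \<in> ?Te e"
      then have s: "s \<in> PiE (pairs r) (\<lambda>_. R)" by blast
      have "s q \<in> R" if "q \<in> ?P" for q
        using PiE_mem[OF s, of q] that by (auto simp: pairs_meeting_def)
      then show "restrict s (?P - {e}) \<in> PiE (?P - {e}) (\<lambda>_. R)" by (intro restrict_PiE_iff[THEN iffD2]) blast
    qed
    ultimately have "card (?Te e) \<le> card (PiE (?P - {e}) (\<lambda>_. R))"
      by (rule card_inj_on_le) (intro finite_PiE_R finite_Diff finite_pairs_meeting)
    also have "\<dots> = p ^ (card ?P - 1)"
      using e by (subst card_PiE_R) (auto simp: finite_pairs_meeting)
    finally show ?thesis .
  qed
  have "?T = (\<Union>e\<in>?P. ?Te e)" by blast
  then have "card ?T \<le> (\<Sum>e\<in>?P. card (?Te e))" using card_UN_le[OF finite_pairs_meeting[of r I], of ?Te] by simp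
  also have "\<dots> \<le> (\<Sum>e\<in>?P. p ^ (card ?P - 1))" by (rule sum_mono) (rule Te)
  finally show ?thesis by simp
qed

text \<open>After cancellation the claim is P \<le> (2 h - q) (a - q) + q b, the codimension of the
  pairs counted. For h \<ge> a the right side is at least a b, and P \<le> r (r - 1) / 2. For h < a
  it is at least h (a + b - h), and the condition 2 r \<le> a + 2 b + 2 is what makes this reach
  P.\<close>

lemma exponent_bound:
  fixes a b r h q P :: nat
  assumes P: "2 * P + h + (r - h)\<^sup>2 \<le> r\<^sup>2" and h: "h \<le> r" and q: "q \<le> a" "q \<le> 2 * h"
    and ab: "b = a \<or> b = a + 1" "r * (r - 1) \<le> 2 * a * b" "2 * r \<le> a + 2 * b + 2"
  shows "P + (2 * (r - h) * a + (2 * h - q) * q + q * a) + (2 * (r - h) * b + (2 * h - q) * b)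
    \<le> 2 * r * a + 2 * r * b"
proof -
  define P' h' r' a' b' q' where "P' = int P" and "h' = int h" and "r' = int r" and "a' = int a"
    and "b' = int b" and "q' = int q"
  note d = this
  have P1: "2 * P' \<le> h' * (2 * r' - h' - 1)"
  proof -
    obtain k where k: "r = h + k" using h le_Suc_ex by blast
    have "int (2 * P + h + (r - h)\<^sup>2) \<le> int (r\<^sup>2)" using P by (simp only: of_nat_le_iff)
    then show ?thesis by (simp add: d k power2_eq_square algebra_simps)
  qed
  have i: "0 \<le> h'" "h' \<le> r'" "q' \<le> a'" "q' \<le> 2 * h'" "0 \<le> q'" "b' = a' \<or> b' = a' + 1"
    "2 * r' \<le> a' + 2 * b' + 2" using h q ab by (auto simp: d)
  have ab': "r' * (r' - 1) \<le> 2 * (a' * b')"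
  proof -
    have "int (r * (r - 1)) \<le> int (2 * a * b)" using ab(2) by (simp only: of_nat_le_iff)
    then show ?thesis by (cases r) (simp_all add: d algebra_simps)
  qed
  have "h' * (2 * r' - h' - 1) \<le> 2 * ((2 * h' - q') * (a' - q') + q' * b')"
  proof (cases "h' \<ge> a'")
    case True
    have "0 \<le> (a' - q') * (2 * h' - q' - b')"
    proof (cases "q' = a'")
      case False
      then have "0 \<le> 2 * h' - q' - b'" using i True by auto
      then show ?thesis using i by simp
    qed simp
    then have 1: "a' * b' \<le> (2 * h' - q') * (a' - q') + q' * b'" by (simp add: algebra_simps)
    have "0 \<le> (r' - h') * (r' - h' - 1)"
      using i by (cases "r' = h'") auto
    then have "h' * (2 * r' - h' - 1) \<le> r' * (r' - 1)" by (simp add: algebra_simps)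
    also have "r' * (r' - 1) \<le> 2 * (a' * b')" by (rule ab')
    also have "\<dots> \<le> 2 * ((2 * h' - q') * (a' - q') + q' * b')" using 1 by (rule mult_left_mono) simp
    finally show ?thesis .
  next
    case False
    \<comment> \<open>As a' - b' is 0 or -1, the factors are equal or consecutive integers.\<close>
    have "0 \<le> (h' - q') * (h' - q' + (a' - b'))"
    proof (cases "h' - q' \<ge> 1")
      case True
      then show ?thesis using i by (intro mult_nonneg_nonneg) auto
    next
      case f: False
      then show ?thesis using i by (intro mult_nonpos_nonpos) auto
    qed
    then have 1: "h' * (a' + b') - h' * h' \<le> (2 * h' - q') * (a' - q') + q' * b'"
      by (simp add: algebra_simps)
    have "h' * (2 * r' - h' - 1) \<le> h' * (2 * (a' + b') - 2 * h')"
      using i False by (intro mult_left_mono) auto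
    then show ?thesis using 1 by (simp add: algebra_simps)
  qed
  then have "P' + (2 * (r' - h') * a' + (2 * h' - q') * q' + q' * a') + (2 * (r' - h') * b' + (2 * h' - q') * b')
      \<le> 2 * r' * a' + 2 * r' * b'" using P1 by (simp add: algebra_simps)
  then have "int (P + (2 * (r - h) * a + (2 * h - q) * q + q * a) + (2 * (r - h) * b + (2 * h - q) * b))
      \<le> int (2 * r * a + 2 * r * b)" using h q by (simp add: d of_nat_diff)
  then show ?thesis by (simp only: of_nat_le_iff)
qed

lemma annihilating_scale:
  assumes "annihilating r S a b A B" "\<And>u v. u < r \<Longrightarrow> v < r \<Longrightarrow> S' u v \<equiv>\<^sub>p w * S u v"
  shows "annihilating r S' a b A B"
  unfolding annihilating_def
proof (intro allI impI)
  fix i j assume ij: "i < a" "j < b"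
  have "(\<Sum>l<2. \<Sum>u<r. \<Sum>v<r. A (i, l, u) * S' u v * B (j, l, v)) \<equiv>\<^sub>p
      (\<Sum>l<2. \<Sum>u<r. \<Sum>v<r. A (i, l, u) * (w * S u v) * B (j, l, v))"
    by (intro sum_cong_p cp_scalar_right cp_scalar_left assms(2)) auto
  also have "\<dots> = w * (\<Sum>l<2. \<Sum>u<r. \<Sum>v<r. A (i, l, u) * S u v * B (j, l, v))"
    by (simp add: sum_distrib_left ac_simps)
  also have "\<dots> \<equiv>\<^sub>p w * 0" using assms(1) ij by (intro cp_scalar_left) (simp add: annihilating_def)
  finally show "(\<Sum>l<2. \<Sum>u<r. \<Sum>v<r. A (i, l, u) * S' u v * B (j, l, v)) \<equiv>\<^sub>p 0" by simp
qed

text \<open>The rows in \<open>I\<close> generate all rows, so a matrix that is nonzero modulo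
  \<open>p\<close> has a nonzero entry there. Dividing by it preserves the row basis, its
  coefficients and the annihilated pairs.\<close>

lemma normalise_skew:
  fixes c :: "nat \<times> nat \<Rightarrow> int"
  assumes q: "q \<in> pairs r" "\<not> c q \<equiv>\<^sub>p 0" and ann: "annihilating r (skew_of c) a b A B"
  shows "\<exists>I s X. I \<subseteq> {..<r} \<and> s \<in> PiE (pairs r) (\<lambda>_. R) \<and> pivot {..<r} {..<r} (skew_of s) I X \<and>
    (\<exists>e\<in>pairs_meeting r I. s e = 1) \<and> annihilating r (skew_of s) a b A B"
proof -
  obtain I X where X: "pivot {..<r} {..<r} (skew_of c) I X" using pivot_exists[of "{..<r}"] by blast
  then have I: "I \<subseteq> {..<r}" by (simp add: pivot_def)
  have finI: "finite I" using I finite_subset by blast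
  have "\<exists>e\<in>pairs_meeting r I. \<not> c e \<equiv>\<^sub>p 0"
  proof (rule ccontr)
    assume n: "\<not> ?thesis"
    have z: "skew_of c \<iota> v \<equiv>\<^sub>p 0" if "\<iota> \<in> I" "v < r" for \<iota> v
    proof -
      have 1: "c (u, v) \<equiv>\<^sub>p 0" if "u < v" "v < r" "u \<in> I \<or> v \<in> I" for u v
        using n that by (auto simp: pairs_meeting_def pairs_def)
      have "\<iota> < r" using that I by auto
      then show ?thesis using 1[of \<iota> v] cp_minus_minus_iff[of "c (v, \<iota>)" 0] 1[of v \<iota>] that
        by (auto simp: skew_of_def)
    qed
    have "skew_of c u v \<equiv>\<^sub>p 0" if "u < r" "v < r" for u v
    proof -
      have "skew_of c u v \<equiv>\<^sub>p (\<Sum>\<iota>\<in>I. X u \<iota> * skew_of c \<iota> v)" using X that by (simp add: pivot_def)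
      also have "\<dots> \<equiv>\<^sub>p (\<Sum>\<iota>\<in>I. X u \<iota> * 0)" using z that by (intro sum_cong_p cp_scalar_left)
      finally show ?thesis by simp
    qed
    then have "skew_of c (fst q) (snd q) \<equiv>\<^sub>p 0" using q(1) by (auto simp: pairs_def)
    then have "c q \<equiv>\<^sub>p 0" using q(1) by (auto simp: skew_of_def pairs_def)
    then show False using q(2) by simp
  qed
  then obtain e where e: "e \<in> pairs_meeting r I" "\<not> c e \<equiv>\<^sub>p 0" by blast
  obtain w where w: "w * c e \<equiv>\<^sub>p 1" by (rule inverse_mod[OF e(2)])
  have w0: "\<not> w \<equiv>\<^sub>p 0"
  proof
    assume "w \<equiv>\<^sub>p 0"
    then have "0 * c e \<equiv>\<^sub>p 1" using w cp_scalar_right cp_trans cp_sym by blast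
    then have "int p dvd 1" using cp_iff_dvd_diff[of 1 0] cp_sym by simp
    then show False using p_gt_1 by simp
  qed
  define s where "s = restrict (\<lambda>q. (w * c q) mod int p) (pairs r)"
  have sR: "s \<in> PiE (pairs r) (\<lambda>_. R)" unfolding s_def using mod_R by (intro restrict_PiE_iff[THEN iffD2]) blast
  have S: "skew_of s u v \<equiv>\<^sub>p w * skew_of c u v" if "u < r" "v < r" for u v
    using that cong_mod[of "w * c (u, v)"] cp_minus_minus_iff[THEN iffD2, OF cong_mod[of "w * c (v, u)"]]
    by (auto simp: skew_of_def s_def pairs_def)
  have "e \<in> pairs r" using e(1) by (auto simp: pairs_meeting_def)
  then have "s e = 1" using w p_gt_1 by (simp add: s_def cong_p_def)
  then show ?thesis
    using I sR pivot_scale[OF X w0, of "skew_of s"] S e(1) annihilating_scale[OF ann, of "skew_of s" w]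
    by (intro exI[of _ I] exI[of _ s] exI[of _ X]) auto
qed

lemma card_layered_matrices: "card (layered_matrices r n) = p ^ (2 * r * n)"
  unfolding layered_matrices_def by (subst card_PiE_R) (auto simp: card_cartesian_product mult.commute)

lemma finite_layered_matrices: "finite (layered_matrices r n)"
  unfolding layered_matrices_def by (intro finite_PiE_R) simp

text \<open>Sums over the at most 4^r possible row bases \<open>J\<close> of \<open>AX A\<close>.
  The count of normalised skew matrices enters as a factor on the left, so that exponents are only
  added.\<close>

lemma card_annihilated_pairs:
  assumes X: "pivot {..<r} {..<r} (skew_of s) I X"
    and ab: "b = a \<or> b = a + 1" "r * (r - 1) \<le> 2 * a * b" "2 * r \<le> a + 2 * b + 2"
    and P: "pairs_meeting r I \<noteq> {}"
  shows "card {(A, B) \<in> layered_matrices r a \<times> layered_matrices r b. annihilating r (skew_of s) a b A B}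
      * p ^ (card (pairs_meeting r I) - 1) \<le> 4 ^ r * p ^ (2 * r * a + 2 * r * b - 1)"
proof -
  interpret skew_mod p r "skew_of s" I X
    by unfold_locales (use X skew_of_swap in auto)
  let ?P = "card (pairs_meeting r I)"
  let ?e1 = "\<lambda>J. 2 * (r - card I) * a + (2 * card I - card J) * card J + card J * a"
  let ?e2 = "\<lambda>J. 2 * (r - card I) * b + (2 * card I - card J) * b"
  let ?J = "{J. J \<subseteq> D \<and> card J \<le> a}"
  let ?A = "\<lambda>J. {A \<in> \<Omega> a. \<exists>Y. pivot D {..<a} (AX A) J Y}"
  let ?B = "\<lambda>A. {B \<in> \<Omega> b. annihilates a b A B}"
  have finD: "finite D" using I by simp
  have finJ: "finite ?J" using finD by simp
  have P0: "1 \<le> ?P" using P finite_pairs_meeting by (simp add: Suc_le_eq card_gt_0_iff)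
  have hr: "card I \<le> r" using card_mono[OF _ I(1)] by simp
  have sub: "{(A, B) \<in> \<Omega> a \<times> \<Omega> b. annihilates a b A B} \<subseteq> (\<Union>J\<in>?J. Sigma (?A J) ?B)"
  proof (clarify)
    fix A B assume AB: "A \<in> \<Omega> a" "B \<in> \<Omega> b" "annihilates a b A B"
    obtain J Y where J: "pivot D {..<a} (AX A) J Y" using pivot_exists[OF finD] by blast
    then have JD: "J \<subseteq> D" and ind: "independent_rows {..<a} (AX A) J" by (auto simp: pivot_def)
    have "card J \<le> a" using independent_rows_card[OF _ _ ind] JD finD finite_subset by fastforce
    then show "(A, B) \<in> (\<Union>J\<in>?J. Sigma (?A J) ?B)" using AB J JD by blast
  qed
  have card_J: "card (Sigma (?A J) ?B) * p ^ (?P - 1) \<le> p ^ (2 * r * a + 2 * r * b - 1)" if J: "J \<in> ?J" for J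
  proof -
    have finA: "finite (?A J)" using finite_layered_matrices by simp
    have "card (Sigma (?A J) ?B) = (\<Sum>A\<in>?A J. card (?B A))"
      by (rule card_SigmaI[OF finA]) (use finite_layered_matrices in auto)
    also have "\<dots> \<le> (\<Sum>A\<in>?A J. p ^ ?e2 J)" by (rule sum_mono) (use card_annihilated_B in blast)
    also have "\<dots> = card (?A J) * p ^ ?e2 J" by simp
    also have "\<dots> \<le> p ^ ?e1 J * p ^ ?e2 J" using card_A_with_pivot J by (intro mult_right_mono) auto
    finally have "card (Sigma (?A J) ?B) * p ^ (?P - 1) \<le> p ^ ?e1 J * p ^ ?e2 J * p ^ (?P - 1)"
      by (rule mult_right_mono) simp
    also have "\<dots> = p ^ (?e1 J + ?e2 J + (?P - 1))" by (simp only: power_add)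
    also have "\<dots> \<le> p ^ (2 * r * a + 2 * r * b - 1)"
    proof (rule power_increasing)
      have "card J \<le> 2 * card I" using J card_mono[OF finD, of J] card_D by simp
      then have "?P + ?e1 J + ?e2 J \<le> 2 * r * a + 2 * r * b"
        using exponent_bound[OF card_pairs_meeting[OF I(1)] hr _ _ ab, of "card J"] J by simp
      then show "?e1 J + ?e2 J + (?P - 1) \<le> 2 * r * a + 2 * r * b - 1" using P0 by linarith
    qed (use p_gt_1 in simp)
    finally show ?thesis .
  qed
  have "card {(A, B) \<in> \<Omega> a \<times> \<Omega> b. annihilates a b A B} \<le> card (\<Union>J\<in>?J. Sigma (?A J) ?B)"
    by (rule card_mono[OF _ sub]) (use finJ finite_layered_matrices in auto)
  also have "\<dots> \<le> (\<Sum>J\<in>?J. card (Sigma (?A J) ?B))" by (rule card_UN_le[OF finJ])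
  finally have "card {(A, B) \<in> \<Omega> a \<times> \<Omega> b. annihilates a b A B} * p ^ (?P - 1) \<le>
      (\<Sum>J\<in>?J. card (Sigma (?A J) ?B)) * p ^ (?P - 1)" by (rule mult_right_mono) simp
  also have "\<dots> \<le> (\<Sum>J\<in>?J. p ^ (2 * r * a + 2 * r * b - 1))"
    unfolding sum_distrib_right by (rule sum_mono) (rule card_J)
  also have "\<dots> = card ?J * p ^ (2 * r * a + 2 * r * b - 1)" by simp
  also have "\<dots> \<le> 4 ^ r * p ^ (2 * r * a + 2 * r * b - 1)"
  proof (rule mult_right_mono)
    have "card ?J \<le> card (Pow D)" using finD by (intro card_mono) auto
    also have "\<dots> = 2 ^ (2 * card I)" using finD by (simp add: card_Pow card_D)
    also have "\<dots> = 4 ^ card I" by (simp add: power_mult)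
    also have "\<dots> \<le> 4 ^ r" using hr by (intro power_increasing) auto
    finally show "card ?J \<le> 4 ^ r" .
  qed simp
  finally show ?thesis .
qed

text \<open>There are at most 2^r sets \<open>I\<close>, r^2 positions of the entry 1 and 4^r sets
  \<open>J\<close>. Each choice covers at most p^(t - 1) of the p^t pairs, t = 2 r a + 2 r b, and p
  > r^2 8^r leaves a pair over.\<close>

lemma good_pair_exists:
  assumes p: "r\<^sup>2 * 8 ^ r < p" and r: "2 \<le> r"
    and ab: "b = a \<or> b = a + 1" "r * (r - 1) \<le> 2 * a * b" "2 * r \<le> a + 2 * b + 2"
  shows "\<exists>A B. \<forall>c. annihilating r (skew_of c) a b A B \<longrightarrow> (\<forall>q\<in>pairs r. c q \<equiv>\<^sub>p 0)"
proof (rule ccontr)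
  assume n: "\<not> ?thesis"
  let ?all = "layered_matrices r a \<times> layered_matrices r b"
  let ?t = "2 * r * a + 2 * r * b"
  let ?K = "{I. I \<subseteq> {..<r} \<and> pairs_meeting r I \<noteq> {}}"
  let ?S = "\<lambda>I. {s \<in> PiE (pairs r) (\<lambda>_. R). (\<exists>X. pivot {..<r} {..<r} (skew_of s) I X) \<and>
      (\<exists>e\<in>pairs_meeting r I. s e = 1)}"
  let ?T = "\<lambda>s. {(A, B) \<in> ?all. annihilating r (skew_of s) a b A B}"
  have finK: "finite ?K" by simp
  have finS: "finite (?S I)" for I using finite_PiE_R[of "pairs r"] by simp
  have fin: "finite ?all" using finite_layered_matrices by simp
  have finT: "finite (?T s)" for s using fin by (rule finite_subset[rotated]) auto
  have "?all \<subseteq> (\<Union>I\<in>?K. \<Union>s\<in>?S I. ?T s)"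
  proof (clarify)
    fix A B assume AB: "A \<in> layered_matrices r a" "B \<in> layered_matrices r b"
    obtain c q where c: "annihilating r (skew_of c) a b A B" "q \<in> pairs r" "\<not> c q \<equiv>\<^sub>p 0" using n by blast
    obtain I s X where "I \<subseteq> {..<r}" "s \<in> PiE (pairs r) (\<lambda>_. R)" "pivot {..<r} {..<r} (skew_of s) I X"
      "\<exists>e\<in>pairs_meeting r I. s e = 1" "annihilating r (skew_of s) a b A B"
      using normalise_skew[OF c(2,3,1)] by blast
    then have "I \<in> ?K" "s \<in> ?S I" "(A, B) \<in> ?T s" using AB by auto
    then show "(A, B) \<in> (\<Union>I\<in>?K. \<Union>s\<in>?S I. ?T s)" by blast
  qed
  then have "card ?all \<le> card (\<Union>I\<in>?K. \<Union>s\<in>?S I. ?T s)"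
    by (rule card_mono[rotated]) (use finK finS finT in auto)
  also have "\<dots> \<le> (\<Sum>I\<in>?K. card (\<Union>s\<in>?S I. ?T s))" by (rule card_UN_le[OF finK])
  also have "\<dots> \<le> (\<Sum>I\<in>?K. r\<^sup>2 * (4 ^ r * p ^ (?t - 1)))"
  proof (rule sum_mono)
    fix I assume I: "I \<in> ?K"
    let ?P = "card (pairs_meeting r I)"
    have "card (\<Union>s\<in>?S I. ?T s) \<le> (\<Sum>s\<in>?S I. card (?T s))" by (rule card_UN_le[OF finS])
    then have "card (\<Union>s\<in>?S I. ?T s) * p ^ (?P - 1) \<le> (\<Sum>s\<in>?S I. card (?T s)) * p ^ (?P - 1)"
      by (rule mult_right_mono) simp
    also have "\<dots> \<le> (\<Sum>s\<in>?S I. 4 ^ r * p ^ (?t - 1))"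
      unfolding sum_distrib_right
    proof (rule sum_mono)
      fix s assume "s \<in> ?S I"
      then obtain X where "pivot {..<r} {..<r} (skew_of s) I X" by auto
      from card_annihilated_pairs[OF this ab] I
      show "card (?T s) * p ^ (?P - 1) \<le> 4 ^ r * p ^ (?t - 1)" by simp
    qed
    also have "\<dots> = card (?S I) * (4 ^ r * p ^ (?t - 1))" by simp
    also have "\<dots> \<le> ?P * p ^ (?P - 1) * (4 ^ r * p ^ (?t - 1))"
      using card_skew_with_pivot I by (intro mult_right_mono) auto
    finally have "card (\<Union>s\<in>?S I. ?T s) * p ^ (?P - 1) \<le> ?P * (4 ^ r * p ^ (?t - 1)) * p ^ (?P - 1)"
      by (simp only: ac_simps)
    then have "card (\<Union>s\<in>?S I. ?T s) \<le> ?P * (4 ^ r * p ^ (?t - 1))"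
      using p_gt_1 by simp
    also have "\<dots> \<le> r\<^sup>2 * (4 ^ r * p ^ (?t - 1))"
      using card_pairs_meeting[of I r] I by (intro mult_right_mono) auto
    finally show "card (\<Union>s\<in>?S I. ?T s) \<le> r\<^sup>2 * (4 ^ r * p ^ (?t - 1))" .
  qed
  also have "\<dots> = card ?K * (r\<^sup>2 * (4 ^ r * p ^ (?t - 1)))" by simp
  also have "\<dots> \<le> 2 ^ r * (r\<^sup>2 * (4 ^ r * p ^ (?t - 1)))"
  proof (rule mult_right_mono)
    have "card ?K \<le> card (Pow {..<r})" by (intro card_mono) auto
    then show "card ?K \<le> 2 ^ r" by (simp add: card_Pow)
  qed simp
  also have "\<dots> = r\<^sup>2 * 8 ^ r * p ^ (?t - 1)"
  proof -
    have "(8::nat) ^ r = 2 ^ r * 4 ^ r" by (simp flip: power_mult_distrib)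
    then show ?thesis by (simp only: ac_simps)
  qed
  also have "\<dots> < p * p ^ (?t - 1)" using p p_gt_1 by simp
  also have "\<dots> = p ^ ?t"
  proof -
    have "0 < 2 * r * b" using r ab by (cases b) auto
    then have "?t = Suc (?t - 1)" by linarith
    then show ?thesis by (metis power_Suc)
  qed
  also have "\<dots> = card ?all"
    by (simp add: card_cartesian_product card_layered_matrices power_add)
  finally show False by simp
qed

end

section \<open>From a prime modulus to characteristic zero\<close>

lemma common_denominator:
  fixes c :: "'q \<Rightarrow> rat"
  assumes "finite P"
  shows "\<exists>d. d > 0 \<and> (\<forall>q\<in>P. \<exists>k. of_int d * c q = of_int k)"
  using assms
proof (induction P)
  case empty
  show ?case by (intro exI[of _ 1]) simp
next
  case (insert q P)
  then obtain d where d: "d > 0" "\<forall>q\<in>P. \<exists>k. of_int d * c q = of_int k" by blast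
  obtain n e where ne: "quotient_of (c q) = (n, e)" by fastforce
  then have e: "e > 0" "c q = of_int n / of_int e"
    using quotient_of_denom_pos quotient_of_div by blast+
  show ?case
  proof (rule exI[of _ "e * d"], intro conjI ballI)
    show "e * d > 0" using d e by simp
    fix q' assume "q' \<in> insert q P"
    then consider "q' = q" | k where "of_int d * c q' = of_int k" using d(2) by blast
    then show "\<exists>k. of_int (e * d) * c q' = of_int k"
    proof cases
      case 1
      then show ?thesis using e by (intro exI[of _ "d * n"]) simp
    next
      case 2
      then show ?thesis by (intro exI[of _ "e * k"]) (simp add: mult.assoc)
    qed
  qed
qed

text \<open>Descent: an integer solution is divisible by \<open>p\<close>, and the quotient is again
  a solution, so every power of \<open>p\<close> divides it.\<close>

lemma integer_system_trivial_if_mod: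
  fixes M :: "'e \<Rightarrow> 'q \<Rightarrow> int"
  assumes p: "1 < p"
    and triv: "\<And>c. (\<forall>e\<in>E. int p dvd (\<Sum>q\<in>P. M e q * c q)) \<Longrightarrow> \<forall>q\<in>P. int p dvd c q"
    and c: "\<forall>e\<in>E. (\<Sum>q\<in>P. M e q * c q) = 0" and q: "q \<in> P"
  shows "c q = 0"
proof (rule ccontr)
  assume c0: "c q \<noteq> 0"
  have pow: "\<forall>q\<in>P. int p ^ n dvd c q" if "\<forall>e\<in>E. (\<Sum>q\<in>P. M e q * c q) = 0" for n c
    using that
  proof (induction n arbitrary: c)
    case (Suc n)
    have "\<forall>q\<in>P. int p dvd c q" by (rule triv) (use Suc.prems in simp)
    then have cq: "c q = int p * (c q div int p)" if "q \<in> P" for q using that by simp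
    have "(\<Sum>q\<in>P. M e q * (c q div int p)) = 0" if "e \<in> E" for e
    proof -
      have "0 = (\<Sum>q\<in>P. M e q * c q)" using Suc.prems that by simp
      also have "\<dots> = (\<Sum>q\<in>P. int p * (M e q * (c q div int p)))"
        by (rule sum.cong) (use cq in \<open>simp_all add: mult.left_commute\<close>)
      finally show ?thesis using p by (simp flip: sum_distrib_left)
    qed
    then have IH: "\<forall>q\<in>P. int p ^ n dvd c q div int p" using Suc.IH[of "\<lambda>q. c q div int p"] by simp
    show ?case
    proof
      fix q assume q: "q \<in> P"
      have "int p * int p ^ n dvd int p * (c q div int p)" using IH q by (intro mult_dvd_mono) auto
      then show "int p ^ Suc n dvd c q" using cq[OF q] by simp
    qed
  qed simp
  have "int p ^ n \<le> \<bar>c q\<bar>" for n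
    using pow[OF c] q c0 by (simp add: zdvd_imp_le)
  moreover have "\<bar>c q\<bar> < int p ^ nat \<bar>c q\<bar>"
  proof -
    have "nat \<bar>c q\<bar> < p ^ nat \<bar>c q\<bar>" using p by (simp add: power_gt_expt)
    then show ?thesis by (simp add: nat_less_iff)
  qed
  ultimately show False using leD by blast
qed

text \<open>A nonzero solution over \<open>'k\<close> gives a rational one by a \<open>\<rat>\<close>-linear functional on \<open>'k\<close>.\<close>

lemma integer_system_lift:
  fixes M :: "'e \<Rightarrow> 'q \<Rightarrow> int" and x :: "'q \<Rightarrow> 'k::field_char_0"
  assumes P: "finite P" and p: "1 < p"
    and triv: "\<And>c. (\<forall>e\<in>E. int p dvd (\<Sum>q\<in>P. M e q * c q)) \<Longrightarrow> \<forall>q\<in>P. int p dvd c q"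
    and x: "\<forall>e\<in>E. (\<Sum>q\<in>P. of_int (M e q) * x q) = 0" and q: "q \<in> P"
  shows "x q = 0"
proof (rule ccontr)
  assume x0: "x q \<noteq> 0"
  interpret Q: vector_space "\<lambda>(a::rat) (y::'k). of_rat a * y"
    by unfold_locales (simp_all add: algebra_simps of_rat_add of_rat_mult)
  define B where "B = Q.extend_basis {x q}"
  have ind: "Q.independent {x q}" using x0 by simp
  have B: "Q.independent B" "Q.span B = UNIV" "x q \<in> B"
    using Q.independent_extend_basis[OF ind] Q.span_extend_basis[OF ind] Q.extend_basis_superset[OF ind]
    by (auto simp: B_def)
  define \<phi> where "\<phi> y = Q.representation B y (x q)" for y
  have \<phi>: "\<phi> (\<Sum>q\<in>P. of_int (M e q) * x q) = (\<Sum>q\<in>P. of_int (M e q) * \<phi> (x q))" for e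
  proof -
    have "\<phi> (\<Sum>q\<in>P. of_int (M e q) * x q) = (\<Sum>q\<in>P. \<phi> (of_rat (of_int (M e q)) * x q))"
      unfolding \<phi>_def using B by (subst Q.representation_sum) auto
    also have "\<dots> = (\<Sum>q\<in>P. of_int (M e q) * \<phi> (x q))"
      unfolding \<phi>_def using B by (subst Q.representation_scale) auto
    finally show ?thesis .
  qed
  have \<phi>q: "\<phi> (x q) = 1" unfolding \<phi>_def using B by (simp add: Q.representation_basis)
  have \<phi>0: "\<phi> 0 = 0" unfolding \<phi>_def by (simp add: Q.representation_zero)
  obtain d where d: "d > 0" "\<forall>q\<in>P. \<exists>k. of_int d * \<phi> (x q) = of_int k"
    using common_denominator[OF P, of "\<lambda>q. \<phi> (x q)"] by auto
  then obtain c where c: "\<And>q. q \<in> P \<Longrightarrow> of_int d * \<phi> (x q) = of_int (c q)" by metis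
  have "(\<Sum>q\<in>P. M e q * c q) = 0" if e: "e \<in> E" for e
  proof -
    have "(of_int (\<Sum>q\<in>P. M e q * c q) :: rat) = (\<Sum>q\<in>P. of_int (M e q) * (of_int d * \<phi> (x q)))"
      using c by simp
    also have "\<dots> = of_int d * \<phi> (\<Sum>q\<in>P. of_int (M e q) * x q)"
      by (simp add: \<phi> sum_distrib_left mult.left_commute)
    also have "\<dots> = 0" using x e \<phi>0 by simp
    finally show ?thesis by (simp only: of_int_eq_0_iff)
  qed
  then have "\<forall>e\<in>E. (\<Sum>q\<in>P. M e q * c q) = 0" by blast
  from integer_system_trivial_if_mod[OF p triv this q] have "c q = 0" by simp
  then show False using c[OF q] \<phi>q d(1) by simp
qed

section \<open>Faithful representations from separating matrices\<close>

lemma unit_sequences: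
  fixes n :: nat
  defines "d \<equiv> \<lambda>(i::nat) k. if k = i then 1 else 0 :: 'k::field"
  shows span_unit_sequences: "module.span seq_scale (d ` {..<n}) = {f. \<forall>k\<ge>n. f k = 0}"
    and dim_finite_sequences: "vector_space.dim seq_scale {f :: nat \<Rightarrow> 'k. \<forall>k\<ge>n. f k = 0} = n"
proof -
  interpret S: vector_space "seq_scale :: 'k \<Rightarrow> _" by (rule vector_space_seq_scale)
  let ?W = "{f :: nat \<Rightarrow> 'k. \<forall>k\<ge>n. f k = 0}"
  have coord: "(\<Sum>i<n. seq_scale (f i) (d i)) k = (if k < n then f k else 0)" for f k
    by (simp add: sum_fun_apply seq_scale_def d_def if_distrib cong: if_cong)
  have "?W \<subseteq> S.span (d ` {..<n})"
  proof
    fix f assume "f \<in> ?W"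
    then have "f = (\<Sum>i<n. seq_scale (f i) (d i))" by (auto simp: fun_eq_iff coord)
    also have "\<dots> \<in> S.span (d ` {..<n})" by (intro S.span_sum S.span_scale S.span_base) auto
    finally show "f \<in> S.span (d ` {..<n})" .
  qed
  moreover have "d ` {..<n} \<subseteq> ?W" by (auto simp: d_def)
  moreover have "S.subspace ?W" by (rule S.subspaceI) (auto simp: seq_scale_def)
  ultimately show sp: "S.span (d ` {..<n}) = ?W" by (intro S.span_subspace)
  have inj: "inj_on d A" for A by (auto simp: inj_on_def d_def fun_eq_iff split: if_splits)
  have "S.independent (d ` {..<n})"
  proof (rule S.independent_if_scalars_zero)
    fix f x assume s: "(\<Sum>x\<in>d ` {..<n}. seq_scale (f x) x) = 0" and "x \<in> d ` {..<n}"
    then obtain k where "k < n" "x = d k" by auto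
    then show "f x = 0"
      using s coord[of "\<lambda>i. f (d i)" k] by (simp add: sum.reindex[OF inj])
  qed simp
  then show "S.dim ?W = n"
    using S.dim_span_eq_card_independent[of "d ` {..<n}"] by (simp add: sp card_image[OF inj])
qed

locale skew_separating =
  fixes a b L r :: nat and \<alpha> \<beta> :: "nat \<times> nat \<times> nat \<Rightarrow> 'k::field_char_0"
  assumes r: "2 \<le> r"
    and separating: "\<And>s. (\<And>i j. i < a \<Longrightarrow> j < b \<Longrightarrow>
        (\<Sum>l<L. \<Sum>u<r. \<Sum>v<r. \<alpha> (i, l, u) * skew_of s u v * \<beta> (j, l, v)) = 0) \<Longrightarrow> \<forall>q\<in>pairs r. s q = 0"
begin

definition form\<alpha> where "form\<alpha> x i l = (\<Sum>u<r. \<alpha> (i, l, u) * x u)"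
definition form\<beta> where "form\<beta> x j l = (\<Sum>v<r. x v * \<beta> (j, l, v))"
text \<open>The linear extension to all bivectors of x wedge y -> \<alpha>(x) \<beta>(y) -
  \<alpha>(y) \<beta>(x), as \<open>corner_wedge\<close> confirms.\<close>

definition corner where
  "corner w i j = (\<Sum>l<L. \<Sum>u<r. \<Sum>v<r. \<alpha> (i, l, u) * skew_of w u v * \<beta> (j, l, v))"

text \<open>Block strictly lower triangular matrices for \<open>\<bbbK>\<^sup>b \<oplus> \<bbbK>\<^sup>L \<oplus> \<bbbK>\<^sup>a\<close>.\<close>

definition \<rho> :: "'k free2 \<Rightarrow> (nat \<Rightarrow> 'k) \<Rightarrow> nat \<Rightarrow> 'k" where
  "\<rho> z f k =
    (if k < b then 0
     else if k < b + L then \<Sum>j<b. form\<beta> (fst z) j (k - b) * f j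
     else if k < b + L + a then (\<Sum>l<L. form\<alpha> (fst z) (k - b - L) l * f (b + l)) +
       (\<Sum>j<b. corner (snd z) (k - b - L) j * f j)
     else 0)"

lemma \<rho>_first: "k < b \<Longrightarrow> \<rho> z f k = 0"
  and \<rho>_middle: "l < L \<Longrightarrow> \<rho> z f (b + l) = (\<Sum>j<b. form\<beta> (fst z) j l * f j)"
  and \<rho>_last: "i < a \<Longrightarrow> \<rho> z f (b + L + i) = (\<Sum>l<L. form\<alpha> (fst z) i l * f (b + l)) + (\<Sum>j<b. corner (snd z) i j * f j)"
  and \<rho>_beyond: "b + L + a \<le> k \<Longrightarrow> \<rho> z f k = 0"
  by (auto simp: \<rho>_def)

lemma \<rho>_eqI:
  assumes "\<And>k. k < b \<Longrightarrow> f k = g k" "\<And>l. l < L \<Longrightarrow> f (b + l) = g (b + l)"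
    "\<And>i. i < a \<Longrightarrow> f (b + L + i) = g (b + L + i)" "\<And>k. b + L + a \<le> k \<Longrightarrow> f k = g k"
  shows "f = g"
proof
  fix k
  consider "k < b" | l where "k = b + l" "l < L" | i where "k = b + L + i" "i < a" | "b + L + a \<le> k"
    by (metis add.assoc le_Suc_ex nat_add_left_cancel_less not_le)
  then show "f k = g k" by cases (use assms in auto)
qed

lemma form_linear:
  "form\<alpha> (x + y) i l = form\<alpha> x i l + form\<alpha> y i l" "form\<beta> (x + y) j l = form\<beta> x j l + form\<beta> y j l"
  "form\<alpha> (\<lambda>i. c * x i) i l = c * form\<alpha> x i l" "form\<beta> (\<lambda>i. c * x i) j l = c * form\<beta> x j l"
  "form\<alpha> (x - y) i l = form\<alpha> x i l - form\<alpha> y i l" "form\<beta> (x - y) j l = form\<beta> x j l - form\<beta> y j l"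
  by (simp_all add: form\<alpha>_def form\<beta>_def distrib_left distrib_right sum.distrib sum_distrib_left
      mult.left_commute mult.assoc left_diff_distrib right_diff_distrib sum_subtractf)

lemma corner_linear:
  "corner (w + z) i j = corner w i j + corner z i j" "corner (\<lambda>p. c * w p) i j = c * corner w i j"
  "corner (w - z) i j = corner w i j - corner z i j"
proof -
  have s: "skew_of (w + z) u v = skew_of w u v + skew_of z u v" "skew_of (\<lambda>p. c * w p) u v = c * skew_of w u v"
    "skew_of (w - z) u v = skew_of w u v - skew_of z u v" for u v
    by (simp_all add: skew_of_def)
  show "corner (w + z) i j = corner w i j + corner z i j" "corner (\<lambda>p. c * w p) i j = c * corner w i j"
    "corner (w - z) i j = corner w i j - corner z i j"
    by (simp_all add: corner_def s distrib_left distrib_right sum.distrib sum_distrib_left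
      mult.left_commute mult.assoc left_diff_distrib right_diff_distrib sum_subtractf)
qed

lemma corner_wedge:
  "corner (wedge x y) i j = (\<Sum>l<L. form\<alpha> x i l * form\<beta> y j l - form\<alpha> y i l * form\<beta> x j l)"
proof -
  have s: "skew_of (wedge x y) u v = x u * y v - y u * x v" for u v
    by (auto simp: skew_of_def wedge_def)
  show ?thesis unfolding corner_def form\<alpha>_def form\<beta>_def sum_product s
    by (simp add: algebra_simps flip: sum_subtractf)
qed

text \<open>If both blocks of \<open>x\<close> vanish, so does the corner of x wedge y for every y.
  Taking for y a unit vector with index v \<noteq> u, which exists by r \<ge> 2, exposes x
  u.\<close>

lemma separating_wedge:
  assumes x: "\<And>i l. i < a \<Longrightarrow> l < L \<Longrightarrow> form\<alpha> x i l = 0" "\<And>j l. j < b \<Longrightarrow> l < L \<Longrightarrow> form\<beta> x j l = 0"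
    and u: "u < r"
  shows "x u = 0"
proof -
  obtain v where v: "v < r" "v \<noteq> u"
    using r u by (metis One_nat_def Suc_1 less_2_cases_iff less_le_trans zero_neq_one)
  let ?y = "\<lambda>k. if k = v then 1 else 0 :: 'k"
  have "corner (wedge x ?y) i j = 0" if "i < a" "j < b" for i j
    using that x by (simp add: corner_wedge)
  then have "\<forall>q\<in>pairs r. wedge x ?y q = 0" unfolding corner_def by (rule separating)
  moreover have "(u, v) \<in> pairs r \<or> (v, u) \<in> pairs r" using u v by (auto simp: pairs_def)
  ultimately have "wedge x ?y (u, v) = 0 \<and> u < v \<or> wedge x ?y (v, u) = 0 \<and> v < u"
    by (auto simp: pairs_def)
  then show ?thesis using v by (auto simp: wedge_def)
qed

text \<open>Among products of two operators only the \<beta>-block followed by the \<alpha>-block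
  survives; it lands in the corner, which every operator annihilates on either side.\<close>

lemma faithful_representation:
  "faithful_lie_representation free2_scale (free2_carrier r) free2_bracket seq_scale {f. \<forall>k\<ge>b + L + a. f k = 0} \<rho>"
proof -
  let ?n = "b + L + a"
  let ?W = "{f :: nat \<Rightarrow> 'k. \<forall>k\<ge>?n. f k = 0}"
  interpret lie_algebra free2_scale "free2_carrier r :: 'k free2 set" free2_bracket by (rule lie_algebra_free2)
  interpret S: vector_space "seq_scale :: 'k \<Rightarrow> _" by (rule vector_space_seq_scale)
  have "\<exists>B. finite B \<and> S.span B = ?W" using span_unit_sequences[of ?n] by blast
  moreover have "S.subspace ?W" by (rule S.subspaceI) (auto simp: seq_scale_def)
  moreover have "inj_on (\<lambda>x. restrict (\<rho> x) ?W) (free2_carrier r)"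
  proof (rule inj_onI)
    fix x y :: "'k free2" assume x: "x \<in> free2_carrier r" and y: "y \<in> free2_carrier r"
      and eq: "restrict (\<rho> x) ?W = restrict (\<rho> y) ?W"
    let ?d = "\<lambda>m k. if k = m then 1 else 0 :: 'k"
    have e: "\<rho> x (?d m) k = \<rho> y (?d m) k" if "m < ?n" for m k
      using fun_cong[OF eq, of "?d m"] that by auto
    have d: "(\<Sum>j<n. g j * ?d m j) = (if m < n then g m else 0)" for g :: "nat \<Rightarrow> 'k" and m n
      by (simp add: if_distrib cong: if_cong)
    have \<beta>: "form\<beta> (fst x) j l = form\<beta> (fst y) j l" if "j < b" "l < L" for j l
      using e[of j "b + l"] that by (simp add: \<rho>_middle d)
    have ne: "?d j (b + l) = 0" if "j < b" for j l using that by simp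
    have c: "corner (snd x) i j = corner (snd y) i j" if "i < a" "j < b" for i j
      using e[of j "b + L + i"] that by (simp add: \<rho>_last d ne)
    have \<alpha>: "form\<alpha> (fst x) i l = form\<alpha> (fst y) i l" if "i < a" "l < L" for i l
      using e[of "b + l" "b + L + i"] that by (simp add: \<rho>_last d if_distrib cong: if_cong)
    have "(fst x - fst y) u = 0" if "u < r" for u
      by (rule separating_wedge[OF _ _ that]) (simp_all only: form_linear \<alpha> \<beta> diff_self)
    then have "fst x u = fst y u" for u
      using x y by (cases "u < r") (auto simp: free2_carrier_def)
    moreover have "corner (snd x - snd y) i j = 0" if "i < a" "j < b" for i j
      using c[OF that] by (simp only: corner_linear diff_self)
    then have "\<forall>q\<in>pairs r. (snd x - snd y) q = 0" unfolding corner_def by (rule separating)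
    then have "snd x q = snd y q" for q
      using x y by (cases "q \<in> pairs r") (auto simp: free2_carrier_def pairs_def split: prod.splits)
    ultimately show "x = y" by (simp add: prod_eq_iff fun_eq_iff)
  qed
  moreover have "\<rho> x v \<in> ?W" for x v by (simp add: \<rho>_beyond)
  moreover have "\<rho> x (v + w) = \<rho> x v + \<rho> x w" for x v w
    by (rule \<rho>_eqI) (simp_all add: \<rho>_first \<rho>_middle \<rho>_last \<rho>_beyond distrib_left sum.distrib)
  moreover have "\<rho> x (seq_scale c v) = seq_scale c (\<rho> x v)" for x c v
    by (rule \<rho>_eqI) (simp_all add: \<rho>_first \<rho>_middle \<rho>_last \<rho>_beyond seq_scale_def distrib_left
        sum_distrib_left mult.left_commute)
  moreover have "\<rho> (x + y) v = \<rho> x v + \<rho> y v" for x y v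
    by (rule \<rho>_eqI) (simp_all add: \<rho>_first \<rho>_middle \<rho>_last \<rho>_beyond form_linear corner_linear
        distrib_right sum.distrib)
  moreover have "\<rho> (free2_scale c x) v = seq_scale c (\<rho> x v)" for c x v
    by (rule \<rho>_eqI) (simp_all add: \<rho>_first \<rho>_middle \<rho>_last \<rho>_beyond form_linear corner_linear
        seq_scale_def free2_scale_def case_prod_unfold distrib_left sum_distrib_left mult.assoc)
  moreover have "\<rho> (free2_bracket x y) v = \<rho> x (\<rho> y v) - \<rho> y (\<rho> x v)" for x y v
  proof (rule \<rho>_eqI)
    have br: "fst (free2_bracket x y) = 0" "snd (free2_bracket x y) = wedge (fst x) (fst y)"
      by (simp_all add: free2_bracket_def case_prod_unfold)
    have f0: "form\<alpha> 0 i l = 0" "form\<beta> 0 j l = 0" for i j l by (simp_all add: form\<alpha>_def form\<beta>_def)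
    show "\<rho> (free2_bracket x y) v (b + l) = (\<rho> x (\<rho> y v) - \<rho> y (\<rho> x v)) (b + l)" if "l < L" for l
      using that by (simp add: \<rho>_middle \<rho>_first br f0)
    show "\<rho> (free2_bracket x y) v (b + L + i) = (\<rho> x (\<rho> y v) - \<rho> y (\<rho> x v)) (b + L + i)" if i: "i < a" for i
    proof -
      have comp: "\<rho> x (\<rho> y v) (b + L + i) = (\<Sum>j<b. \<Sum>l<L. form\<alpha> (fst x) i l * form\<beta> (fst y) j l * v j)" for x y
      proof -
        have "\<rho> x (\<rho> y v) (b + L + i) = (\<Sum>l<L. \<Sum>j<b. form\<alpha> (fst x) i l * form\<beta> (fst y) j l * v j)"
          by (simp add: \<rho>_last[OF i, of x] \<rho>_first \<rho>_middle sum_distrib_left mult.assoc)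
        also have "\<dots> = (\<Sum>j<b. \<Sum>l<L. form\<alpha> (fst x) i l * form\<beta> (fst y) j l * v j)" by (rule sum.swap)
        finally show ?thesis .
      qed
      show ?thesis
        by (simp add: \<rho>_last[OF i, of "free2_bracket x y"] br f0 corner_wedge comp sum_distrib_right
            left_diff_distrib flip: sum_subtractf)
    qed
  qed (simp_all add: \<rho>_first \<rho>_beyond)
  ultimately show ?thesis by unfold_locales blast+
qed

end

section \<open>The value of \<open>\<mu>\<close>\<close>

lemma mu_eqI:
  fixes scale :: "'k::field \<Rightarrow> 'g::ab_group_add \<Rightarrow> 'g"
  assumes "faithful_lie_representation scale L bracket seq_scale V \<pi>" "vector_space.dim seq_scale V = n"
    and "\<And>V \<pi>. faithful_lie_representation scale L bracket seq_scale V \<pi> \<Longrightarrow> n \<le> vector_space.dim seq_scale V"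
  shows "mu scale L bracket = n"
  unfolding mu_def by (rule Least_equality) (use assms in auto)

lemma (in skew_separating) mu_free2_eqI:
  assumes "\<And>V \<pi>. faithful_lie_representation (free2_scale :: 'k \<Rightarrow> _) (free2_carrier r) free2_bracket seq_scale V \<pi> \<Longrightarrow>
    b + L + a \<le> vector_space.dim seq_scale V"
  shows "mu (free2_scale :: 'k \<Rightarrow> _) (free2_carrier r) free2_bracket = b + L + a"
  by (rule mu_eqI[OF faithful_representation dim_finite_sequences assms])

text \<open>With \<open>L = 1\<close>, the products of \<open>e\<^sub>0, \<dots>, e\<^bsub>r-2\<^esub>\<close> with \<open>e\<^sub>1, \<dots>, e\<^bsub>r-1\<^esub>\<close> span the exterior square.\<close>

lemma skew_separating_one_layer:
  assumes r: "2 \<le> r"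
  shows "skew_separating (r - 1) (r - 1) 1 r (\<lambda>(i, l, u). if u = i then 1 else 0 :: 'k::field_char_0)
    (\<lambda>(j, l, v). if v = Suc j then 1 else 0)"
proof
  fix s :: "nat \<times> nat \<Rightarrow> 'k"
  assume 0: "\<And>i j. i < r - 1 \<Longrightarrow> j < r - 1 \<Longrightarrow> (\<Sum>l<1::nat. \<Sum>u<r. \<Sum>v<r.
    (case (i, l, u) of (i, l, u) \<Rightarrow> if u = i then 1 else 0) * skew_of s u v *
    (case (j, l, v) of (j, l, v) \<Rightarrow> if v = Suc j then 1 else 0)) = 0"
  have s0: "skew_of s i (Suc j) = 0" if "i < r - 1" "j < r - 1" for i j
  proof -
    have d: "(\<Sum>v<r. f v * (if v = k then 1 else 0)) = (if k < r then f k else 0)" for f :: "nat \<Rightarrow> 'k" and k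
      by (simp add: if_distrib cong: if_cong)
    have "(\<Sum>u<r. \<Sum>v<r. (if u = i then 1 else 0) * skew_of s u v * (if v = Suc j then 1 else 0)) =
        (\<Sum>u<r. skew_of s u (Suc j) * (if u = i then 1 else 0))"
    proof (rule sum.cong)
      fix u
      show "(\<Sum>v<r. (if u = i then 1 else 0) * skew_of s u v * (if v = Suc j then 1 else 0)) =
          skew_of s u (Suc j) * (if u = i then 1 else 0)"
        using that d[of "\<lambda>v. (if u = i then 1 else 0) * skew_of s u v" "Suc j"] by (simp add: mult.commute)
    qed simp
    also have "\<dots> = skew_of s i (Suc j)" using that d[of "\<lambda>u. skew_of s u (Suc j)" i] by simp
    finally show ?thesis using 0[OF that] by simp
  qed
  show "\<forall>q\<in>pairs r. s q = 0"
  proof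
    fix q assume "q \<in> pairs r"
    then obtain i j where "q = (i, j)" "i < j" "j < r" by (auto simp: pairs_def)
    then show "s q = 0" using s0[of i "j - 1"] by (simp add: skew_of_def)
  qed
qed (rule r)

lemma skew_separating_two_layers:
  assumes r: "2 \<le> r" and ab: "b = a \<or> b = a + 1" "r * (r - 1) \<le> 2 * a * b" "2 * r \<le> a + 2 * b + 2"
  shows "\<exists>\<alpha> \<beta> :: nat \<times> nat \<times> nat \<Rightarrow> 'k::field_char_0. skew_separating a b 2 r \<alpha> \<beta>"
proof -
  obtain p where p: "prime p" "r\<^sup>2 * 8 ^ r < p" using bigger_prime by blast
  interpret prime_modulus p by unfold_locales (rule p)
  obtain A B where AB: "\<And>c. annihilating r (skew_of c) a b A B \<Longrightarrow> \<forall>q\<in>pairs r. cong_p (c q) 0"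
    using good_pair_exists[OF p(2) r ab] by blast
  \<comment> \<open>The coefficients of the system in the unknowns s q, q \<in>
    \<open>pairs r\<close>. \<open>expand\<close> holds over every commutative ring and is applied
    both to integers modulo p and to the field.\<close>
  define M where "M = (\<lambda>(i, j) (u, v). \<Sum>l<2. A (i, l, u) * B (j, l, v) - A (i, l, v) * B (j, l, u))"
  have expand: "(\<Sum>l<2. \<Sum>u<r. \<Sum>v<r. of_int (A (i, l, u)) * skew_of s u v * of_int (B (j, l, v))) =
      (\<Sum>q\<in>pairs r. of_int (M (i, j) q) * s q)" for s :: "nat \<times> nat \<Rightarrow> 'a::comm_ring_1" and i j
  proof -
    have "(\<Sum>u<r. \<Sum>v<r. of_int (A (i, l, u)) * skew_of s u v * of_int (B (j, l, v))) =
        (\<Sum>(u, v)\<in>pairs r. of_int (A (i, l, u) * B (j, l, v) - A (i, l, v) * B (j, l, u)) * s (u, v))" for l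
    proof -
      have "(\<Sum>u<r. \<Sum>v<r. of_int (A (i, l, u)) * skew_of s u v * of_int (B (j, l, v))) =
        (\<Sum>(u, v)\<in>pairs r. of_int (A (i, l, u)) * skew_of s u v * of_int (B (j, l, v)) +
          of_int (A (i, l, v)) * skew_of s v u * of_int (B (j, l, u)))"
        by (rule sum_pairs[symmetric]) (simp add: skew_of_def)
      also have "\<dots> = (\<Sum>(u, v)\<in>pairs r. of_int (A (i, l, u) * B (j, l, v) - A (i, l, v) * B (j, l, u)) * s (u, v))"
        by (rule sum.cong) (auto simp: pairs_def skew_of_def algebra_simps)
      finally show ?thesis .
    qed
    then show ?thesis
      by (simp add: M_def case_prod_unfold sum_distrib_right flip: sum.swap[of _ "pairs r"])
  qed
  have "skew_separating a b 2 r (\<lambda>x. of_int (A x) :: 'k) (\<lambda>x. of_int (B x))"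
  proof
    fix s :: "nat \<times> nat \<Rightarrow> 'k"
    assume 0: "\<And>i j. i < a \<Longrightarrow> j < b \<Longrightarrow>
      (\<Sum>l<2. \<Sum>u<r. \<Sum>v<r. of_int (A (i, l, u)) * skew_of s u v * of_int (B (j, l, v))) = 0"
    show "\<forall>q\<in>pairs r. s q = 0"
    proof
      fix q assume q: "q \<in> pairs r"
      show "s q = 0"
      proof (rule integer_system_lift[OF finite_pairs p_gt_1 _ _ q])
        show "\<forall>e\<in>{..<a} \<times> {..<b}. (\<Sum>q\<in>pairs r. of_int (M e q) * s q) = 0"
          using 0 by (auto simp: expand)
        show "\<forall>q\<in>pairs r. int p dvd c q"
          if c: "\<forall>e\<in>{..<a} \<times> {..<b}. int p dvd (\<Sum>q\<in>pairs r. M e q * c q)" for c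
          using AB[of c] c expand[of _ c] by (simp add: annihilating_def cp_0_iff)
      qed
    qed
  qed (rule r)
  then show ?thesis by blast
qed

text \<open>N^2 is 4 a b or 4 a b + 1, and r (r - 1) is even, so rounding loses nothing. If the last
  inequality failed, then 3 N \<le> 4 r - 6, and squaring would give 2 r^2 + 30 r \<le> 36,
  impossible for r \<ge> 2.\<close>

lemma split_bounds:
  fixes r N :: nat
  assumes r: "2 \<le> r" and N: "2 * r * (r - 1) \<le> N\<^sup>2"
  defines "a \<equiv> N div 2" and "b \<equiv> N - N div 2"
  shows "b = a \<or> b = a + 1" "r * (r - 1) \<le> 2 * a * b" "2 * r \<le> a + 2 * b + 2"
proof -
  show ab: "b = a \<or> b = a + 1" unfolding a_def b_def by linarith
  have Nab: "N = a + b" unfolding a_def b_def by simp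
  obtain t where t: "r * (r - 1) = 2 * t" using card_pairs[of r] by metis
  have "4 * t \<le> N\<^sup>2" using N t by simp
  moreover have "N\<^sup>2 = 4 * (a * b) \<or> N\<^sup>2 = 4 * (a * b) + 1"
    using ab unfolding Nab by (auto simp: power2_eq_square algebra_simps)
  ultimately have "t \<le> a * b" by linarith
  then show "r * (r - 1) \<le> 2 * a * b" using t by simp
  show "2 * r \<le> a + 2 * b + 2"
  proof (rule ccontr)
    assume "\<not> ?thesis"
    then have "3 * int N \<le> 4 * int r - 6" using ab Nab by auto
    then have "(3 * int N)\<^sup>2 \<le> (4 * int r - 6)\<^sup>2" by (intro power_mono) auto
    moreover have "int (2 * r * (r - 1)) \<le> int (N\<^sup>2)" using N by (simp only: of_nat_le_iff)
    then have "2 * int r * (int r - 1) \<le> (int N)\<^sup>2" using r by (simp add: of_nat_diff)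
    ultimately have "2 * (int r * int r) + 30 * int r \<le> 36" by (simp add: power2_eq_square algebra_simps)
    moreover have "2 * 2 \<le> int r * int r" using r by (intro mult_mono) auto
    ultimately show False using r by linarith
  qed
qed

lemma mu_free2_ge_4:
  assumes r: "4 \<le> r"
  shows "int (mu (free2_scale :: 'k::field_char_0 \<Rightarrow> _) (free2_carrier r) free2_bracket) =
    \<lceil>sqrt (2 * real r * (real r - 1))\<rceil> + 2"
proof -
  let ?s = "sqrt (2 * real r * (real r - 1))"
  define N where "N = nat \<lceil>?s\<rceil>"
  have s0: "0 \<le> ?s" using r by simp
  have N_le: "N \<le> n" if "2 * r * (r - 1) \<le> n\<^sup>2" for n
  proof -
    have "real (2 * r * (r - 1)) \<le> real (n\<^sup>2)" using that by (simp only: of_nat_le_iff)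
    then have "2 * real r * (real r - 1) \<le> (real n)\<^sup>2" using r by (simp add: of_nat_diff)
    then have "?s \<le> real n" by (intro real_le_lsqrt) auto
    then show ?thesis by (simp add: N_def ceiling_le_iff nat_le_iff)
  qed
  have "2 * real r * (real r - 1) \<le> (real N)\<^sup>2"
    using sqrt_le_D[of "2 * real r * (real r - 1)" "real N"] s0 by (simp add: N_def)
  then have "real (2 * r * (r - 1)) \<le> real (N\<^sup>2)" using r by (simp add: of_nat_diff)
  then have N: "2 * r * (r - 1) \<le> N\<^sup>2" by (simp only: of_nat_le_iff)
  define a b where "a = N div 2" and "b = N - N div 2"
  have r2: "2 \<le> r" using r by simp
  have "\<exists>\<alpha> \<beta> :: nat \<times> nat \<times> nat \<Rightarrow> 'k. skew_separating a b 2 r \<alpha> \<beta>"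
    unfolding a_def b_def by (rule skew_separating_two_layers[OF r2 split_bounds[OF r2 N]])
  then obtain \<alpha> \<beta> :: "nat \<times> nat \<times> nat \<Rightarrow> 'k" where sep: "skew_separating a b 2 r \<alpha> \<beta>"
    by (elim exE)
  interpret skew_separating a b 2 r \<alpha> \<beta> by (rule sep)
  \<comment> \<open>Gives N \<le> 2 r - 3, so the alternative 2 r - 1 \<le> dim V also implies N + 2
    \<le> dim V. It is false for r = 3.\<close>
  have bound: "2 * r * (r - 1) \<le> (2 * r - 3)\<^sup>2"
  proof -
    obtain k where k: "r = 4 + k" using le_Suc_ex[OF assms] by blast
    have "2 * r - 3 = 2 * k + 5" "r - 1 = k + 3" using k by simp_all
    then show ?thesis unfolding k power2_eq_square by (simp add: algebra_simps)
  qed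
  have "mu (free2_scale :: 'k \<Rightarrow> _) (free2_carrier r) free2_bracket = b + 2 + a"
  proof (rule mu_free2_eqI)
    fix V \<pi> assume "faithful_lie_representation (free2_scale :: 'k \<Rightarrow> _) (free2_carrier r) free2_bracket seq_scale V \<pi>"
    from free2_rep_dim_bound[OF this r2]
    have "N + 2 \<le> vector_space.dim seq_scale V"
    proof
      assume "2 * r \<le> vector_space.dim seq_scale V + 1"
      then show ?thesis using N_le[OF bound] r by linarith
    next
      assume d: "2 * r * (r - 1) \<le> (vector_space.dim seq_scale V - 2)\<^sup>2"
      \<comment> \<open>Ensures that the truncated subtraction in dim V - 2 is a true one.\<close>
      have "0 < 2 * r * (r - 1)" using r by simp
      then have "vector_space.dim seq_scale V - 2 \<noteq> 0" using d by (intro notI) simp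
      then show ?thesis using N_le[OF d] by linarith
    qed
    then show "b + 2 + a \<le> vector_space.dim seq_scale V" by (simp add: a_def b_def)
  qed
  then have "mu (free2_scale :: 'k \<Rightarrow> _) (free2_carrier r) free2_bracket = N + 2" by (simp add: a_def b_def)
  moreover have "0 \<le> \<lceil>?s\<rceil>" using s0 by linarith
  then have "int N = \<lceil>?s\<rceil>" by (simp only: N_def int_nat_eq if_True)
  ultimately show ?thesis by simp
qed

lemma mu_free2_small:
  assumes r: "r \<in> {2, 3, 4, 5}"
  shows "mu (free2_scale :: 'k::field_char_0 \<Rightarrow> _) (free2_carrier r) free2_bracket = 2 * r - 1"
proof -
  have r2: "2 \<le> r" using r by auto
  interpret skew_separating "r - 1" "r - 1" 1 r "\<lambda>(i, l, u). if u = i then 1 else 0 :: 'k"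
    "\<lambda>(j, l, v). if v = Suc j then 1 else 0"
    by (rule skew_separating_one_layer[OF r2])
  have "mu (free2_scale :: 'k \<Rightarrow> _) (free2_carrier r) free2_bracket = (r - 1) + 1 + (r - 1)"
  proof (rule mu_free2_eqI)
    fix V \<pi> assume "faithful_lie_representation (free2_scale :: 'k \<Rightarrow> _) (free2_carrier r) free2_bracket seq_scale V \<pi>"
    from free2_rep_dim_bound[OF this r2]
    show "(r - 1) + 1 + (r - 1) \<le> vector_space.dim seq_scale V"
    proof
      let ?d = "vector_space.dim seq_scale V"
      assume d: "2 * r * (r - 1) \<le> (?d - 2)\<^sup>2"
      show ?thesis
      proof (rule ccontr)
        assume "\<not> ?thesis"
        then have "?d - 2 \<le> 2 * r - 4" using r2 by linarith
        then have "(?d - 2)\<^sup>2 \<le> (2 * r - 4)\<^sup>2" by (rule power_mono) simp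
        then have "2 * r * (r - 1) \<le> (2 * r - 4)\<^sup>2" using d by linarith
        \<comment> \<open>For r \<ge> 2, 2 r (r - 1) exceeds (2 r - 4)^2 exactly up to r =
          5.\<close>
        then show False using assms by auto
      qed
    qed (use r2 in linarith)
  qed
  then show ?thesis using r2 by linarith
qed

theorem mainTheorem1:
  fixes r :: nat
  shows "(r \<ge> 4 \<longrightarrow>
           int (mu (free2_scale :: 'k::field_char_0 \<Rightarrow> 'k free2 \<Rightarrow> 'k free2) (free2_carrier r) free2_bracket)
             = \<lceil>sqrt (2 * real r * (real r - 1))\<rceil> + 2) \<and>
         (r \<in> {2, 3, 4, 5} \<longrightarrow>
           int (mu (free2_scale :: 'k \<Rightarrow> 'k free2 \<Rightarrow> 'k free2) (free2_carrier r) free2_bracket)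
             = 2 * int r - 1)"
  using mu_free2_ge_4[of r] mu_free2_small[of r] by fastforce

end
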